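(* Let $\mathbf r$ be the rank array of a Zelevinsky permutation $v(\mathbf r)$ with block sizes $r_0,\ldots,r_n$, $d=\sum_j r_j$. Then $${\mathit K}\!{\mathcal Q}_{\mathbf r}(\mathbf x/\bar{\mathbf y})=\sum_{P\in\mathcal P(v(\mathbf r))}(-1)^{|P|-l(v(\mathbf r))}(\mathbf 1-\tilde{\mathbf x}/\tilde{\mathbf y})^{P\smallsetminus D_{\mathrm{Hom}}},$$ where $|P|$ is the number of crosses in $P$ (every $P\in\mathcal P(v(\mathbf r))$ lies in the $d\times d$ grid).
   Context: Grothendieck polynomials: for alphabets $\mathbf z,\dot{\mathbf z}$, $\pi_if=\frac{z_{i+1}f(\ldots,z_i,z_{i+1},\ldots)-z_if(\ldots,z_{i+1},z_i,\ldots)}{z_{i+1}-z_i}$; for $v\in S_k$, $\mathcal G_{w_0^k}(\mathbf z/\dot{\mathbf z})=\prod_{i+j\le k}(1-z_i/\dot z_j)$ ($w_0^k$ longest in $S_k$), and $\mathcal G_{vs_i}=\pi_i\mathcal G_v$ whenever $l(vs_i)<l(v)$ (independent of $k$). Zelevinsky permutations: fix $r_0,\ldots,r_n\ge0$, $d=\sum r_j$. Block row $j$ ($j=0,\ldots,n$ from the top) of a $d\times d$ matrix has height $r_j$; block column $i$ (counted from the right) has width $r_i$; $B_{ji}$ is the block in block row $j$ and block column $i$. A Zelevinsky permutation is a $d\times d$ permutation matrix with $B_{ji}=0$ for $i\ge j+2$ whose $1$'s proceed northwest to southeast within every block row and block column. Its rank array $\mathbf r=(r_{ij})_{i\ge j}$,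 $r_{ij}$ = number of $1$'s in blocks $B_{qp}$ with $q\ge j,p\le i$, determines it: $v=v(\mathbf r)$. $v(\mathrm{Hom})$ is the unique Zelevinsky permutation (for these block sizes) with entrywise maximal rank array. $D_{\mathrm{Hom}}$ is the set of all boxes in blocks $B_{ji}$ with $i\ge j+2$ (strictly above the block superantidiagonal). Variables $\mathbf x=\mathbf x^0,\ldots,\mathbf x^n$, $\bar{\mathbf y}=\mathbf y^n,\ldots,\mathbf y^0$ with $\mathbf x^j=x^j_1,\ldots,x^j_{r_j}$, $\mathbf y^j=y^j_1,\ldots,y^j_{r_j}$, concatenated into $d$-letter alphabets; ${\mathit K}\!{\mathcal Q}_{\mathbf r}(\mathbf x/\bar{\mathbf y})=\mathcal G_{v(\mathbf r)}(\mathbf x/\bar{\mathbf y})/\mathcal G_{v(\mathrm{Hom})}(\mathbf x/\bar{\mathbf y})$. Pipe dreams: a pipe dream is a finite set of boxes (crosses) in a grid; its word lists $s_{i+j-1}$ for each cross in row $i$, column $j$, reading each row right to left, rows top to bottom; its Demazure product $\delta(P)$ is the product of this word using $s_i^2=s_i$ and the braid relations. $\mathcal P(v)=\{P:\delta(P)=v\}$. Exponential reverse monomial: label the rows of block row $j$, top to bottom, by $x^j_{r_j},\ldots,x^j_1$, and the columns of block column $i$ (from the right), left to right, by $y^i_{r_i},\ldots,y^i_1$; for a cross $+$ let $\tilde x_+,\tilde y_+$ be the labels of its row and column; for a set $Q$ of boxes, $(\mathbf 1-\tilde{\mathbf x}/\tilde{\mathbf y})^{Q}=\prod_{+\in Q}(1-\tilde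 x_+/\tilde y_+)$.
   Formalization: The rank array, also in the definition of v(Hom), is indexed by i ≤ j rather than i ≥ j; with i ≥ j the entries depend only on the block sizes (e.g. n=1, r_0=r_1=1), so neither v(r) nor v(Hom) would be determined. *)

theory Defs
  imports
    "HOL-Library.Poly_Mapping"
    "HOL-Computational_Algebra.Polynomial_Factorial"
    "HOL-Combinatorics.Permutations"
begin

section \<open>Permutations and words in the simple transpositions\<close>

text \<open>
  An element of the symmetric group \<open>S\<^sub>k\<close> is a function \<open>v\<close> with \<open>v permutes {1..k}\<close>.  Its
  permutation matrix has its 1's in the boxes \<open>(p, v p)\<close> (row \<open>p\<close>, column \<open>v p\<close>), and
  products are compositions of functions, so that \<open>v s\<^sub>i\<close> arises from \<open>v\<close> by exchanging
  rows \<open>i\<close> and \<open>i + 1\<close> of the matrix.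
\<close>

definition simple_transp :: "nat \<Rightarrow> nat \<Rightarrow> nat" where
  "simple_transp i = transpose i (Suc i)"

definition perm_length :: "(nat \<Rightarrow> nat) \<Rightarrow> nat" where
  "perm_length v = card {(i, j). i < j \<and> v j < v i}"

definition longest_perm :: "nat \<Rightarrow> nat \<Rightarrow> nat" where
  "longest_perm k i = (if i \<in> {1..k} then k + 1 - i else i)"

text \<open>The word \<open>[a\<^sub>1, \<dots>, a\<^sub>m]\<close> stands for the product of \<open>s\<close> with indices \<open>a\<^sub>1, \<dots>, a\<^sub>m\<close> in this order.\<close>

definition word_perm :: "nat list \<Rightarrow> nat \<Rightarrow> nat" where
  "word_perm a = foldr (\<lambda>i u. simple_transp i \<circ> u) a id"

definition reduced_word :: "nat list \<Rightarrow> (nat \<Rightarrow> nat) \<Rightarrow> bool" where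
  "reduced_word a v \<longleftrightarrow> word_perm a = v \<and> length a = perm_length v"

text \<open>The braid relations comprise the commutation relations of distant generators.\<close>

inductive hecke_equiv :: "nat list \<Rightarrow> nat list \<Rightarrow> bool" where
  refl: "hecke_equiv a a"
| sym: "hecke_equiv a b \<Longrightarrow> hecke_equiv b a"
| trans: "hecke_equiv a b \<Longrightarrow> hecke_equiv b c \<Longrightarrow> hecke_equiv a c"
| idem: "hecke_equiv (a @ [i, i] @ b) (a @ [i] @ b)"
| braid: "hecke_equiv (a @ [i, Suc i, i] @ b) (a @ [Suc i, i, Suc i] @ b)"
| comm: "Suc i < j \<Longrightarrow> hecke_equiv (a @ [i, j] @ b) (a @ [j, i] @ b)"

text \<open>
  A permutation is identified with the class of its reduced words in the monoid with
  the relations above.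
\<close>

definition demazure_product :: "nat list \<Rightarrow> nat \<Rightarrow> nat" where
  "demazure_product w = (THE v. \<exists>a. reduced_word a v \<and> hecke_equiv w a)"


section \<open>Pipe dreams\<close>

type_synonym box = "nat \<times> nat"

definition pipe_word :: "box set \<Rightarrow> nat list" where
  "pipe_word P =
     concat (map (\<lambda>i. map (\<lambda>j. i + j - 1) (rev (sorted_list_of_set {j. (i, j) \<in> P})))
                 (sorted_list_of_set (fst ` P)))"

definition pipe_dreams :: "(nat \<Rightarrow> nat) \<Rightarrow> box set set" where
  "pipe_dreams v =
     {P. finite P \<and> P \<subseteq> {1..} \<times> {1..} \<and> demazure_product (pipe_word P) = v}"


section \<open>Laurent polynomials\<close>

text \<open>\<open>Z i\<close> and \<open>Y j\<close> are the letters of the two alphabets of a double Grothendieck polynomial.\<close>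

datatype letter = Z nat | Y nat

fun letter_code :: "letter \<Rightarrow> nat" where
  "letter_code (Z i) = 2 * i"
| "letter_code (Y j) = 2 * j + 1"

lemma letter_code_inj: "letter_code a = letter_code b \<Longrightarrow> a = b"
  by (cases a; cases b; simp; presburger)

text \<open>
  The order on the letters is immaterial; some linear order is needed for the library
  to see that Laurent polynomials form an integral domain.
\<close>

instantiation letter :: linorder
begin

definition less_eq_letter :: "letter \<Rightarrow> letter \<Rightarrow> bool" where
  "a \<le> b \<longleftrightarrow> letter_code a \<le> letter_code b"

definition less_letter :: "letter \<Rightarrow> letter \<Rightarrow> bool" where
  "a < b \<longleftrightarrow> letter_code a < letter_code b"

instance
  by standard (auto simp: less_eq_letter_def less_letter_def intro: letter_code_inj)

end

text \<open>Integer coefficients; exponents are finitely supported functions from letters to integers.\<close>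

type_synonym laurent = "(letter \<Rightarrow>\<^sub>0 int) \<Rightarrow>\<^sub>0 int"

definition var :: "letter \<Rightarrow> laurent" where
  "var a = Poly_Mapping.single (Poly_Mapping.single a 1) 1"

definition ratio :: "letter \<Rightarrow> letter \<Rightarrow> laurent" where
  "ratio a b = Poly_Mapping.single (Poly_Mapping.single a 1 - Poly_Mapping.single b 1) 1"

lemma ratio_times_var: "ratio a b * var b = var a"
  by (simp add: ratio_def var_def Poly_Mapping.mult_single)

definition swap_letters :: "nat \<Rightarrow> letter \<Rightarrow> letter" where
  "swap_letters i = transpose (Z i) (Z (Suc i))"

text \<open>
  The inner \<open>map_key\<close> permutes the letters in a monomial, the outer one applies this
  to all monomials of a Laurent polynomial.
\<close>

definition swap_vars :: "nat \<Rightarrow> laurent \<Rightarrow> laurent" where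
  "swap_vars i = Poly_Mapping.map_key (Poly_Mapping.map_key (swap_letters i))"

lemma swap_vars_var: "swap_vars i (var a) = var (swap_letters i a)"
proof -
  define \<sigma> where "\<sigma> = swap_letters i"
  have inv: "\<sigma> (\<sigma> b) = b" for b by (simp add: \<sigma>_def swap_letters_def)
  then have inj: "inj \<sigma>" by (metis injI)
  have mono: "Poly_Mapping.map_key \<sigma> (Poly_Mapping.single (\<sigma> b) c) = Poly_Mapping.single b c"
    for b and c :: int
    using inj by (rule Poly_Mapping.map_key_single)
  have invol: "Poly_Mapping.map_key \<sigma> (Poly_Mapping.map_key \<sigma> m) = m" for m :: "letter \<Rightarrow>\<^sub>0 int"
    using Poly_Mapping.map_key_compose[OF inj inj, of m] Poly_Mapping.map_key_id[of m]
    by (simp add: o_def inv)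
  then have inj2: "inj (Poly_Mapping.map_key \<sigma> :: (letter \<Rightarrow>\<^sub>0 int) \<Rightarrow> _)" by (metis injI)
  show ?thesis
    unfolding swap_vars_def var_def \<sigma>_def[symmetric]
    using Poly_Mapping.map_key_single[OF inj2, of "Poly_Mapping.single (\<sigma> a) 1" "1 :: int"]
      mono[of a 1] by simp
qed

text \<open>The quotient \<open>(z\<^sub>i\<^sub>+\<^sub>1 f - z\<^sub>i s\<^sub>i f) / (z\<^sub>i\<^sub>+\<^sub>1 - z\<^sub>i)\<close>, which is again a Laurent polynomial.\<close>

definition demazure_op :: "nat \<Rightarrow> laurent \<Rightarrow> laurent" where
  "demazure_op i f =
     (THE g. (var (Z (Suc i)) - var (Z i)) * g = var (Z (Suc i)) * f - var (Z i) * swap_vars i f)"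


section \<open>Grothendieck polynomials\<close>

inductive grothendieck_rel :: "nat \<Rightarrow> (nat \<Rightarrow> nat) \<Rightarrow> laurent \<Rightarrow> bool" for k where
  longest: "grothendieck_rel k (longest_perm k)
      (\<Prod>(i, j) \<in> {(i, j). 1 \<le> i \<and> 1 \<le> j \<and> i + j \<le> k}. 1 - ratio (Z i) (Y j))"
| descend: "grothendieck_rel k v g \<Longrightarrow> 1 \<le> i \<Longrightarrow> i < k \<Longrightarrow>
      perm_length (v \<circ> simple_transp i) < perm_length v \<Longrightarrow>
      grothendieck_rel k (v \<circ> simple_transp i) (demazure_op i g)"

definition grothendieck :: "(nat \<Rightarrow> nat) \<Rightarrow> laurent" where
  "grothendieck v = (THE g. \<exists>k. grothendieck_rel k v g)"


section \<open>Zelevinsky permutations\<close>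

text \<open>
  The block sizes are \<open>r 0, \<dots>, r n\<close>; block row \<open>j\<close> and block column \<open>i\<close> below are the
  intervals of the matrix rows and columns (both numbered from 1, columns from the left)
  that belong to them.  Block columns are counted from the right.
\<close>

definition total_dim :: "nat \<Rightarrow> (nat \<Rightarrow> nat) \<Rightarrow> nat" where
  "total_dim n r = (\<Sum>j\<le>n. r j)"

definition row_offset :: "(nat \<Rightarrow> nat) \<Rightarrow> nat \<Rightarrow> nat" where
  "row_offset r j = (\<Sum>q<j. r q)"

definition col_offset :: "nat \<Rightarrow> (nat \<Rightarrow> nat) \<Rightarrow> nat \<Rightarrow> nat" where
  "col_offset n r i = (\<Sum>p\<in>{i<..n}. r p)"

definition block_row :: "(nat \<Rightarrow> nat) \<Rightarrow> nat \<Rightarrow> nat set" where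
  "block_row r j = {row_offset r j + 1 .. row_offset r j + r j}"

definition block_col :: "nat \<Rightarrow> (nat \<Rightarrow> nat) \<Rightarrow> nat \<Rightarrow> nat set" where
  "block_col n r i = {col_offset n r i + 1 .. col_offset n r i + r i}"

definition zelevinsky :: "nat \<Rightarrow> (nat \<Rightarrow> nat) \<Rightarrow> (nat \<Rightarrow> nat) \<Rightarrow> bool" where
  "zelevinsky n r v \<longleftrightarrow>
     v permutes {1..total_dim n r} \<and>
     (\<forall>j i. i \<le> n \<and> j + 2 \<le> i \<longrightarrow> (\<forall>p\<in>block_row r j. v p \<notin> block_col n r i)) \<and>
     (\<forall>j\<le>n. \<forall>p\<in>block_row r j. \<forall>p'\<in>block_row r j. p < p' \<longrightarrow> v p < v p') \<and>
     (\<forall>i\<le>n. \<forall>p p'. v p \<in> block_col n r i \<and> v p' \<in> block_col n r i \<and> p < p' \<longrightarrow> v p < v p')"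

text \<open>
  \<open>rank_entry n r v i j\<close> is the number of 1's in the blocks in block rows \<open>q \<ge> j\<close> and block
  columns \<open>p \<le> i\<close>.  The rank array consists of the entries with \<open>i \<le> j \<le> n\<close> (the composite maps
  from the \<open>i\<close>-th to the \<open>j\<close>-th vector space of a quiver representation).  The entries with
  \<open>i \<ge> j\<close> depend on the block sizes only: all 1's in block columns \<open>p > i\<close> lie in block rows
  \<open>q \<ge> p - 1 \<ge> j\<close>, so the entry is \<open>(\<Sum>q=j..n. r q) - (\<Sum>p=i+1..n. r p)\<close>.
\<close>

definition rank_entry :: "nat \<Rightarrow> (nat \<Rightarrow> nat) \<Rightarrow> (nat \<Rightarrow> nat) \<Rightarrow> nat \<Rightarrow> nat \<Rightarrow> nat" where
  "rank_entry n r v i j =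
     card {m. (\<exists>q\<in>{j..n}. m \<in> block_row r q) \<and> (\<exists>p\<le>i. v m \<in> block_col n r p)}"

definition has_rank_array ::
    "nat \<Rightarrow> (nat \<Rightarrow> nat) \<Rightarrow> (nat \<Rightarrow> nat) \<Rightarrow> (nat \<Rightarrow> nat \<Rightarrow> nat) \<Rightarrow> bool" where
  "has_rank_array n r v R \<longleftrightarrow> (\<forall>j\<le>n. \<forall>i\<le>j. rank_entry n r v i j = R i j)"

definition perm_of_array :: "nat \<Rightarrow> (nat \<Rightarrow> nat) \<Rightarrow> (nat \<Rightarrow> nat \<Rightarrow> nat) \<Rightarrow> nat \<Rightarrow> nat" where
  "perm_of_array n r R = (THE v. zelevinsky n r v \<and> has_rank_array n r v R)"

definition perm_Hom :: "nat \<Rightarrow> (nat \<Rightarrow> nat) \<Rightarrow> nat \<Rightarrow> nat" where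
  "perm_Hom n r = (THE v. zelevinsky n r v \<and>
     (\<forall>w. zelevinsky n r w \<longrightarrow> (\<forall>j\<le>n. \<forall>i\<le>j. rank_entry n r w i j \<le> rank_entry n r v i j)))"

definition D_Hom :: "nat \<Rightarrow> (nat \<Rightarrow> nat) \<Rightarrow> box set" where
  "D_Hom n r = (\<Union>(j, i) \<in> {(j, i). i \<le> n \<and> j + 2 \<le> i}. block_row r j \<times> block_col n r i)"


section \<open>K-theoretic quiver polynomials\<close>

text \<open>
  The alphabets \<open>\<^bold>x = \<^bold>x\<^sup>0, \<dots>, \<^bold>x\<^sup>n\<close> and \<open>\<^bold>y\<^sup>n, \<dots>, \<^bold>y\<^sup>0\<close> are substituted for the letters
  \<open>Z 1, \<dots>, Z d\<close> and \<open>Y 1, \<dots>, Y d\<close> in this order.  As these are indeterminates on both sides, they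
  are given by their positions: \<open>x_letter r j a\<close> is \<open>x\<^sup>j\<^sub>a\<close> and \<open>y_letter n r i b\<close> is \<open>y\<^sup>i\<^sub>b\<close>.
\<close>

definition x_letter :: "(nat \<Rightarrow> nat) \<Rightarrow> nat \<Rightarrow> nat \<Rightarrow> letter" where
  "x_letter r j a = Z (row_offset r j + a)"

definition y_letter :: "nat \<Rightarrow> (nat \<Rightarrow> nat) \<Rightarrow> nat \<Rightarrow> nat \<Rightarrow> letter" where
  "y_letter n r i b = Y (col_offset n r i + b)"

definition KQ :: "nat \<Rightarrow> (nat \<Rightarrow> nat) \<Rightarrow> (nat \<Rightarrow> nat \<Rightarrow> nat) \<Rightarrow> laurent fract" where
  "KQ n r R =
     to_fract (grothendieck (perm_of_array n r R)) / to_fract (grothendieck (perm_Hom n r))"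

text \<open>
  Within a block row the labels run \<open>x\<^sup>j\<close> with indices \<open>r j, \<dots>, 1\<close> from top to bottom, and likewise
  within a block column from left to right.
\<close>

definition row_label :: "nat \<Rightarrow> (nat \<Rightarrow> nat) \<Rightarrow> nat \<Rightarrow> letter" where
  "row_label n r p = (THE t. \<exists>j\<le>n. \<exists>a\<in>{1..r j}.
     p = row_offset r j + a \<and> t = x_letter r j (r j + 1 - a))"

definition col_label :: "nat \<Rightarrow> (nat \<Rightarrow> nat) \<Rightarrow> nat \<Rightarrow> letter" where
  "col_label n r q = (THE t. \<exists>i\<le>n. \<exists>b\<in>{1..r i}.
     q = col_offset n r i + b \<and> t = y_letter n r i (r i + 1 - b))"

definition reverse_monomial :: "nat \<Rightarrow> (nat \<Rightarrow> nat) \<Rightarrow> box set \<Rightarrow> laurent" where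
  "reverse_monomial n r Q = (\<Prod>(p, q) \<in> Q. 1 - ratio (row_label n r p) (col_label n r q))"

end

theory Submission
  imports Defs
begin

text \<open>
  Let \<open>h\<^sub>i(a) = 1 + (a - 1) e\<^sub>i\<close> in the 0-Hecke algebra.  The product of the \<open>h\<^bsub>i+j-1\<^esub>(z\<^sub>i/y\<^sub>j)\<close> over the
  staircase \<open>i + j \<le> k\<close>, in reading order, expands into a sum over pipe dreams.  By the
  Yang-Baxter equation, exchanging \<open>z\<^sub>i\<close> and \<open>z\<^sub>i\<^sub>+\<^sub>1\<close> splits off a factor \<open>h\<^sub>i(z\<^sub>i/z\<^sub>i\<^sub>+\<^sub>1)\<close> on the right, and
  exchanging \<open>y\<^sub>q\<close> and \<open>y\<^sub>q\<^sub>+\<^sub>1\<close> one on the left.  The former is the recursion by Demazure operators,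
  so double Grothendieck polynomials are signed sums over pipe dreams (Fomin and Kirillov); and
  both together show that these sums are symmetric in adjacent variables at non-descents.  As a
  Zelevinsky permutation is increasing in every block row and block column, the variables may be
  reversed within the blocks.

  A permutation whose matrix vanishes on a partition diagram has this diagram in each of its pipe
  dreams; the dominant permutation of the diagram has no other pipe dream.  The permutation
  \<open>v(Hom)\<close> is dominant with diagram \<open>D\<^bsub>Hom\<^esub>\<close>, hence its Grothendieck polynomial is the common factor
  of all summands for \<open>v(\<^bold>r)\<close>.
\<close>

section \<open>Demazure products\<close>

text \<open>The reversed labels cannot be treated term by term: the weight of a single pipe dream
  changes in general when the variables of a block are reversed, and only the sum over all pipe
  dreams is invariant. The sums are therefore studied for arbitrary labellings of rows and columns,
  and numerator and denominator are both brought to the reversed labels before anything is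
  cancelled. The two symmetries are of different kinds. A factor on the right acts on the
  coefficient at \<open>v\<close> directly, according to whether \<open>v\<close> ascends or
  descends at \<open>i\<close>. A factor on the left comes before all others, so its effect has to
  be followed through the whole product; it does not reach the coefficient at \<open>v\<close> if
  the value \<open>q\<close> precedes \<open>q + 1\<close> in \<open>v\<close>. Several notions are
  definite descriptions whose existence and uniqueness have to be earned. The sum over pipe dreams
  does not mention \<open>k\<close>, which settles independence of \<open>k\<close>. The permutation
  \<open>v(Hom)\<close> is constructed as the Demazure product of its diagram; its rank function is
  maximal among all permutations that vanish on that diagram.\<close>

lemma simple_transp_simps [simp]:
  "simple_transp i i = Suc i"
  "simple_transp i (Suc i) = i"
  "simple_transp i (simple_transp i a) = a"
  "simple_transp i \<circ> simple_transp i = id"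
  by (auto simp: simple_transp_def)

lemma simple_transp_other [simp]: "a \<noteq> i \<Longrightarrow> a \<noteq> Suc i \<Longrightarrow> simple_transp i a = a"
  by (simp add: simple_transp_def)

lemma comp_simple_transp_twice [simp]: "v \<circ> simple_transp i \<circ> simple_transp i = v"
  by (simp add: o_assoc[symmetric])

lemma simple_transp_comm:
  "Suc i < j \<Longrightarrow> v \<circ> simple_transp j \<circ> simple_transp i = v \<circ> simple_transp i \<circ> simple_transp j"
proof
  fix p assume "Suc i < j"
  then show "(v \<circ> simple_transp j \<circ> simple_transp i) p = (v \<circ> simple_transp i \<circ> simple_transp j) p"
    by (cases "p = i"; cases "p = Suc i"; cases "p = j"; cases "p = Suc j") auto
qed

lemma simple_transp_braid:
  "v \<circ> simple_transp (Suc i) \<circ> simple_transp i \<circ> simple_transp (Suc i) =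
   v \<circ> simple_transp i \<circ> simple_transp (Suc i) \<circ> simple_transp i" (is "?l = ?r")
proof
  fix p
  consider "p = i" | "p = Suc i" | "p = Suc (Suc i)" | "p \<notin> {i, Suc i, Suc (Suc i)}" by blast
  then show "?l p = ?r p" by cases auto
qed

lemma inj_simple_transp: "inj (simple_transp i)"
  by (metis injI simple_transp_simps(3))

lemma simple_transp_permutes: "a \<le> i \<Longrightarrow> i < b \<Longrightarrow> simple_transp i permutes {a..b}"
  unfolding simple_transp_def by (rule permutes_swap_id) auto

text \<open>Words are arbitrary lists of indices, so no symmetric group is fixed in advance and the
  letter 0 may occur; hence the interval starts at 0.\<close>

definition finitary :: "(nat \<Rightarrow> nat) \<Rightarrow> bool" where
  "finitary v \<longleftrightarrow> (\<exists>N. v permutes {0..N})"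

lemma finitary_permutes: "v permutes {a..b} \<Longrightarrow> finitary v"
  unfolding finitary_def using permutes_subset[of v "{a..b}" "{0..b}"] by auto

lemma finitary_inj: "finitary v \<Longrightarrow> inj v"
  unfolding finitary_def by (auto dest: permutes_inj)

lemma finitary_id [simp]: "finitary id"
  unfolding finitary_def by (auto intro: permutes_id)

lemma finitary_comp:
  assumes "finitary v"
  shows "finitary (v \<circ> simple_transp i)"
proof -
  obtain N where N: "v permutes {0..N}" using assms finitary_def by auto
  have "v permutes {0..max N (Suc i)}"
    using N by (rule permutes_subset) auto
  moreover have "simple_transp i permutes {0..max N (Suc i)}"
    by (rule simple_transp_permutes) auto
  ultimately show ?thesis
    unfolding finitary_def using permutes_compose by blast
qed

text \<open>Gives \<open>perm_length\<close> its meaning, as the cardinality of an infinite set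
  would be 0.\<close>

lemma finite_inversions:
  assumes "finitary v"
  shows "finite {(i, j). i < j \<and> v j < v i}"
proof -
  obtain N where N: "v permutes {0..N}" using assms finitary_def by auto
  have le: "v a \<le> N" if "a \<le> N" for a
    using that permutes_in_image[OF N, of a] by auto
  have fix_gt: "v a = a" if "a > N" for a
    using that permutes_not_in[OF N, of a] by auto
  have "{(i, j). i < j \<and> v j < v i} \<subseteq> {0..N} \<times> {0..N}"
  proof clarify
    fix i j assume h: "i < j" "v j < v i"
    have "j \<le> N"
    proof (rule ccontr)
      assume "\<not> j \<le> N"
      then show False using h fix_gt[of j] fix_gt[of i] le[of i] by (cases "i \<le> N") auto
    qed
    then show "i \<in> {0..N} \<and> j \<in> {0..N}" using h by auto
  qed
  then show ?thesis by (rule finite_subset) auto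
qed

text \<open>Applying \<open>s_i\<close> to both positions of a pair preserves their order except for
  the pair \<open>(i, i + 1)\<close>. So it carries the inversions of \<open>v\<close> to those of
  \<open>v s_i\<close> other than this new one.\<close>

lemma perm_length_ascent:
  assumes fin: "finitary v" and asc: "v i < v (Suc i)"
  shows "perm_length (v \<circ> simple_transp i) = Suc (perm_length v)"
proof -
  let ?s = "simple_transp i"
  let ?I = "{(a, b). a < b \<and> v b < v a}"
  let ?J = "{(a, b). a < b \<and> (v \<circ> ?s) b < (v \<circ> ?s) a}"
  let ?f = "\<lambda>(a, b). (?s a, ?s b)"
  have mono: "?s a < ?s b" if "a < b" "(a, b) \<noteq> (i, Suc i)" for a b
    using that by (cases "a = i"; cases "a = Suc i"; cases "b = i"; cases "b = Suc i") auto
  have "?J = insert (i, Suc i) (?f ` ?I)"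
  proof (intro equalityI subsetI)
    fix x assume x: "x \<in> ?J"
    obtain a b where ab: "x = (a, b)" by (cases x)
    show "x \<in> insert (i, Suc i) (?f ` ?I)"
    proof (cases "x = (i, Suc i)")
      case False
      then have "(?s a, ?s b) \<in> ?I" using x ab mono[of a b] by auto
      then have "?f (?s a, ?s b) \<in> ?f ` ?I" by (rule imageI)
      then show ?thesis by (simp add: ab)
    qed auto
  next
    fix x assume "x \<in> insert (i, Suc i) (?f ` ?I)"
    then consider "x = (i, Suc i)" | a b where "a < b" "v b < v a" "x = (?s a, ?s b)"
      by auto
    then show "x \<in> ?J"
    proof cases
      case 2
      then have "(a, b) \<noteq> (i, Suc i)" using asc by auto
      then show ?thesis using 2 mono[of a b] by auto
    qed (use asc in auto)
  qed
  moreover have "(i, Suc i) \<notin> ?f ` ?I"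
  proof
    assume "(i, Suc i) \<in> ?f ` ?I"
    then obtain x where x: "?f x = (i, Suc i)" "x \<in> ?I" by (metis (no_types, lifting) imageE)
    have "?f (?f x) = x" by (cases x) simp
    then have "x = (Suc i, i)" unfolding x(1) by simp
    then show False using x(2) by simp
  qed
  moreover have "inj_on ?f ?I"
    by (rule inj_onI) (auto dest: injD[OF inj_simple_transp])
  ultimately show ?thesis
    unfolding perm_length_def using finite_inversions[OF fin]
    by (simp add: card_image)
qed

lemma perm_length_descent:
  assumes "finitary v" and "v (Suc i) < v i"
  shows "perm_length v = Suc (perm_length (v \<circ> simple_transp i))"
  using perm_length_ascent[of "v \<circ> simple_transp i" i] assms finitary_comp by simp

section \<open>Reduced words\<close>

lemma word_perm_snoc: "word_perm (a @ [i]) = word_perm a \<circ> simple_transp i"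
  unfolding word_perm_def by (induction a) (auto simp: o_assoc)

lemma word_perm_Nil: "word_perm [] = id"
  by (simp add: word_perm_def)

lemma finitary_word_perm: "finitary (word_perm a)"
proof (induction a rule: rev_induct)
  case Nil
  show ?case unfolding word_perm_Nil by (rule finitary_id)
next
  case (snoc i a)
  then show ?case unfolding word_perm_snoc by (rule finitary_comp)
qed

lemma finitary_cases:
  assumes "finitary v"
  obtains "v i < v (Suc i)" | "v (Suc i) < v i"
  using finitary_inj[OF assms] by (metis injD n_not_Suc_n nat_neq_iff)

lemma perm_length_id [simp]: "perm_length id = 0"
proof -
  have "{(i, j). i < j \<and> id j < (id i::nat)} = {}" by auto
  then show ?thesis unfolding perm_length_def by (simp only: card.empty)
qed

lemma perm_length_simple_transp_le:
  assumes "finitary v"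
  shows "perm_length (v \<circ> simple_transp i) \<le> Suc (perm_length v)"
  using perm_length_ascent[OF assms] perm_length_descent[OF assms]
  by (cases rule: finitary_cases[OF assms, of i]) fastforce+

lemma perm_length_word_perm_le: "perm_length (word_perm a) \<le> length a"
proof (induction a rule: rev_induct)
  case Nil
  have "perm_length (word_perm []) = 0" unfolding word_perm_Nil by (rule perm_length_id)
  then show ?case by simp
next
  case (snoc i a)
  have "perm_length (word_perm (a @ [i])) \<le> Suc (perm_length (word_perm a))"
    unfolding word_perm_snoc by (rule perm_length_simple_transp_le[OF finitary_word_perm])
  then show ?case using snoc by simp
qed

lemma reduced_word_snoc:
  "reduced_word (a @ [i]) v \<longleftrightarrow> v (Suc i) < v i \<and> reduced_word a (v \<circ> simple_transp i)"
proof
  assume red: "reduced_word (a @ [i]) v"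
  let ?u = "word_perm a"
  have v: "v = ?u \<circ> simple_transp i" and len: "perm_length v = Suc (length a)"
    using red by (auto simp: reduced_word_def word_perm_snoc)
  have "?u i < ?u (Suc i)"
    using finitary_cases[OF finitary_word_perm[of a], of i]
  proof cases
    case 2
    then show ?thesis using perm_length_descent[OF finitary_word_perm 2] len v
        perm_length_word_perm_le[of a] by simp
  qed
  then show "v (Suc i) < v i \<and> reduced_word a (v \<circ> simple_transp i)"
    using len perm_length_ascent[OF finitary_word_perm, of a i] v
    by (simp add: reduced_word_def)
next
  assume h: "v (Suc i) < v i \<and> reduced_word a (v \<circ> simple_transp i)"
  then have v: "v = word_perm (a @ [i])"
    by (simp add: reduced_word_def word_perm_snoc)
  then have "finitary v" by (simp add: finitary_word_perm)
  then show "reduced_word (a @ [i]) v"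
    using h perm_length_descent[of v i] unfolding reduced_word_def v[symmetric] by simp
qed

text \<open>Right multiplication by a generator in the 0-Hecke monoid, whose elements are labelled
  by permutations.\<close>

definition hecke_act :: "(nat \<Rightarrow> nat) \<Rightarrow> nat \<Rightarrow> nat \<Rightarrow> nat" where
  "hecke_act v i = (if v i < v (Suc i) then v \<circ> simple_transp i else v)"

lemma finitary_hecke_act: "finitary v \<Longrightarrow> finitary (hecke_act v i)"
  by (simp add: hecke_act_def finitary_comp)

lemma finitary_foldl_hecke_act: "finitary v \<Longrightarrow> finitary (foldl hecke_act v w)"
  by (induction w arbitrary: v) (auto simp: finitary_hecke_act)

text \<open>Each step puts the larger of two neighbouring values first, and either side sorts the
  values at \<open>i, i + 1, i + 2\<close> into decreasing order.\<close>

lemma hecke_act_braid: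
  "hecke_act (hecke_act (hecke_act v i) (Suc i)) i =
   hecke_act (hecke_act (hecke_act v (Suc i)) i) (Suc i)" (is "?l = ?r")
proof
  fix p
  consider "p = i" | "p = Suc i" | "p = Suc (Suc i)" | "p \<notin> {i, Suc i, Suc (Suc i)}" by blast
  then show "?l p = ?r p"
    by cases (auto simp: hecke_act_def)
qed

lemma hecke_act_comm:
  "Suc i < j \<Longrightarrow> hecke_act (hecke_act v i) j = hecke_act (hecke_act v j) i" (is "_ \<Longrightarrow> ?l = ?r")
proof
  fix p assume "Suc i < j"
  then show "?l p = ?r p"
    by (cases "p = i"; cases "p = Suc i"; cases "p = j"; cases "p = Suc j")
      (auto simp: hecke_act_def)
qed

lemma foldl_hecke_act_cong:
  "hecke_equiv a b \<Longrightarrow> foldl hecke_act v a = foldl hecke_act v b"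
proof (induction arbitrary: v rule: hecke_equiv.induct)
  case (idem a i b)
  then show ?case by (simp add: hecke_act_def)
next
  case (braid a i b)
  then show ?case by (simp add: hecke_act_braid)
next
  case (comm i j a b)
  then show ?case using hecke_act_comm[of i j "foldl hecke_act v a"] by simp
qed auto

lemma foldl_hecke_act_reduced_word: "reduced_word a v \<Longrightarrow> foldl hecke_act id a = v"
proof (induction a arbitrary: v rule: rev_induct)
  case Nil
  then show ?case by (simp add: reduced_word_def word_perm_def)
next
  case (snoc i a)
  then show ?case by (auto simp: reduced_word_snoc hecke_act_def)
qed

lemma hecke_equiv_append: "hecke_equiv a b \<Longrightarrow> hecke_equiv (a @ c) (b @ c)"
proof (induction rule: hecke_equiv.induct)
  case (idem a i b)
  then show ?case using hecke_equiv.idem[of a i "b @ c"] by simp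
next
  case (braid a i b)
  then show ?case using hecke_equiv.braid[of a i "b @ c"] by simp
next
  case (comm i j a b)
  then show ?case using hecke_equiv.comm[of i j a "b @ c"] by simp
qed (auto intro: hecke_equiv.intros)

lemma hecke_equiv_comm':
  "Suc i < j \<or> Suc j < i \<Longrightarrow> hecke_equiv (a @ [i, j] @ b) (a @ [j, i] @ b)"
  using hecke_equiv.comm hecke_equiv.sym by blast

lemma hecke_equiv_braid':
  "j = Suc i \<or> i = Suc j \<Longrightarrow> hecke_equiv (a @ [i, j, i] @ b) (a @ [j, i, j] @ b)"
  using hecke_equiv.braid hecke_equiv.sym by blast

text \<open>The core of Matsumoto's theorem: any descent of \<open>v\<close> can be made the last
  letter. If the word ends in \<open>j\<close>, the induction hypothesis brings \<open>i\<close> to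
  the end of the shorter word; a commutation or a braid move then exchanges the roles of
  \<open>i\<close> and \<open>j\<close>.\<close>

lemma reduced_word_exchange:
  assumes "reduced_word a v" and "v (Suc i) < v i"
  shows "\<exists>c. reduced_word (c @ [i]) v \<and> hecke_equiv a (c @ [i])"
  using assms
proof (induction "length a" arbitrary: a v i rule: less_induct)
  case less
  show ?case
  proof (cases a rule: rev_exhaust)
    case Nil
    then have "v = id" using less.prems by (simp add: reduced_word_def word_perm_def)
    then show ?thesis using less.prems by simp
  next
    case (snoc a' j)
    let ?si = "simple_transp i" and ?sj = "simple_transp j"
    have red: "reduced_word a' (v \<circ> ?sj)" and vj: "v (Suc j) < v j"
      using less.prems(1) by (auto simp: snoc reduced_word_snoc)
    note vi = less.prems(2)
    consider "i = j" | "Suc i < j \<or> Suc j < i" | "j = Suc i \<or> i = Suc j" by linarith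
    then show ?thesis
    proof cases
      case 1
      then show ?thesis using less.prems snoc hecke_equiv.refl by blast
    next
      case 2
      have "(v \<circ> ?sj) (Suc i) < (v \<circ> ?sj) i" using 2 vi by auto
      from less.hyps[OF _ red this] obtain c where
        c: "reduced_word (c @ [i]) (v \<circ> ?sj)" "hecke_equiv a' (c @ [i])"
        using snoc by fastforce
      have eq: "v \<circ> ?si \<circ> ?sj = v \<circ> ?sj \<circ> ?si"
        using 2 simple_transp_comm[of i j v] simple_transp_comm[of j i v] by metis
      have "reduced_word ((c @ [j]) @ [i]) v"
        using c(1) 2 vi vj by (simp only: reduced_word_snoc eq) auto
      moreover have "hecke_equiv a ((c @ [j]) @ [i])"
        using hecke_equiv.trans[OF hecke_equiv_append[OF c(2), of "[j]"], of "c @ [j, i]"]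
          hecke_equiv_comm'[OF 2, of c "[]"] by (simp add: snoc)
      ultimately show ?thesis by blast
    next
      case 3
      \<comment> \<open>Descents at two adjacent indices make the three values concerned decreasing,
        so the descent at \<open>i\<close> survives in \<open>v s_j\<close>, and that at
        \<open>j\<close> in \<open>v s_j s_i\<close>.\<close>
      have "(v \<circ> ?sj) (Suc i) < (v \<circ> ?sj) i" using 3 vi vj by auto
      from less.hyps[OF _ red this] obtain c where
        c: "reduced_word (c @ [i]) (v \<circ> ?sj)" "hecke_equiv a' (c @ [i])"
        using snoc by fastforce
      have redc: "reduced_word c (v \<circ> ?sj \<circ> ?si)" using c(1) by (simp add: reduced_word_snoc)
      have lenc: "length c < length a"
        using c(1) red by (simp add: snoc reduced_word_def)
      have "(v \<circ> ?sj \<circ> ?si) (Suc j) < (v \<circ> ?sj \<circ> ?si) j" using 3 vi vj by auto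
      from less.hyps[OF lenc redc this] obtain e where
        e: "reduced_word (e @ [j]) (v \<circ> ?sj \<circ> ?si)" "hecke_equiv c (e @ [j])"
        by blast
      have "v \<circ> ?sj \<circ> ?si \<circ> ?sj = v \<circ> ?si \<circ> ?sj \<circ> ?si"
        using 3 simple_transp_braid[of v i] simple_transp_braid[of v j] by metis
      then have "reduced_word (((e @ [i]) @ [j]) @ [i]) v"
        using e(1) 3 vi vj by (simp only: reduced_word_snoc) auto
      moreover have "hecke_equiv a (((e @ [i]) @ [j]) @ [i])"
      proof -
        have 1: "hecke_equiv a (c @ [i, j])"
          using hecke_equiv_append[OF c(2), of "[j]"] by (simp add: snoc)
        have 2: "hecke_equiv (c @ [i, j]) (e @ [j, i, j])"
          using hecke_equiv_append[OF e(2), of "[i, j]"] by simp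
        have 3: "hecke_equiv (e @ [j, i, j]) (e @ [i, j, i])"
          using hecke_equiv_braid'[of i j e "[]"] 3 by auto
        show ?thesis using hecke_equiv.trans[OF hecke_equiv.trans[OF 1 2] 3] by simp
      qed
      ultimately show ?thesis by blast
    qed
  qed
qed

text \<open>A new letter either lengthens the reduced word or is a descent; in the latter case it
  can be exchanged to the end and absorbed by idempotence.\<close>

lemma ex_reduced_word_hecke_equiv:
  "\<exists>a. reduced_word a (foldl hecke_act id w) \<and> hecke_equiv w a"
proof (induction w rule: rev_induct)
  case Nil
  have "reduced_word [] id" by (simp add: reduced_word_def word_perm_Nil)
  then show ?case
    unfolding foldl.simps by (intro exI[of _ "[]"] conjI hecke_equiv.refl)
next
  case (snoc i w)
  let ?v = "foldl hecke_act id w"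
  obtain a where a: "reduced_word a ?v" "hecke_equiv w a" using snoc by blast
  have fin: "finitary ?v" by (simp add: finitary_foldl_hecke_act)
  have eq: "hecke_equiv (w @ [i]) (a @ [i])" using a(2) by (rule hecke_equiv_append)
  show ?case using finitary_cases[OF fin, of i]
  proof cases
    case 1
    then have "reduced_word (a @ [i]) (foldl hecke_act id (w @ [i]))"
      using a(1) by (auto simp: hecke_act_def reduced_word_snoc)
    then show ?thesis using eq by blast
  next
    case 2
    obtain c where c: "reduced_word (c @ [i]) ?v" "hecke_equiv a (c @ [i])"
      using reduced_word_exchange[OF a(1) 2] by blast
    have "hecke_equiv (a @ [i]) (c @ [i, i])"
      using hecke_equiv_append[OF c(2), of "[i]"] by simp
    moreover have "hecke_equiv (c @ [i, i]) (c @ [i])"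
      using hecke_equiv.idem[of c i "[]"] by simp
    ultimately have "hecke_equiv (w @ [i]) (c @ [i])"
      using eq hecke_equiv.trans by blast
    moreover have "foldl hecke_act id (w @ [i]) = ?v" using 2 by (simp add: hecke_act_def)
    ultimately show ?thesis using c(1) by metis
  qed
qed

text \<open>The value is unique because acting on \<open>id\<close> is constant on Hecke classes and
  recovers a permutation from any of its reduced words.\<close>

lemma demazure_product_eq: "demazure_product w = foldl hecke_act id w"
  unfolding demazure_product_def
proof (rule the_equality)
  show "\<exists>a. reduced_word a (foldl hecke_act id w) \<and> hecke_equiv w a"
    by (rule ex_reduced_word_hecke_equiv)
next
  fix v assume "\<exists>a. reduced_word a v \<and> hecke_equiv w a"
  then show "v = foldl hecke_act id w"
    using foldl_hecke_act_cong foldl_hecke_act_reduced_word by metis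
qed

lemma perm_length_hecke_act_le:
  "finitary v \<Longrightarrow> perm_length (hecke_act v i) \<le> Suc (perm_length v)"
  by (simp add: hecke_act_def perm_length_simple_transp_le)

lemma demazure_product_Nil: "demazure_product [] = id"
  by (simp add: demazure_product_eq)

lemma demazure_product_snoc: "demazure_product (w @ [i]) = hecke_act (demazure_product w) i"
  by (simp add: demazure_product_eq)

lemma finitary_demazure_product: "finitary (demazure_product w)"
  by (simp add: demazure_product_eq finitary_foldl_hecke_act)

lemma perm_length_demazure_product_le: "perm_length (demazure_product w) \<le> length w"
proof (induction w rule: rev_induct)
  case (snoc i w)
  then show ?case
    using perm_length_hecke_act_le[OF finitary_demazure_product, of w i]
    by (simp add: demazure_product_snoc)
qed (simp add: demazure_product_Nil perm_length_id[unfolded id_def])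

section \<open>Factors satisfying the Yang-Baxter equation\<close>

text \<open>
  Right multiplication by \<open>1 + (a - 1) e\<^sub>i\<close> in the 0-Hecke algebra (\<open>e\<^sub>i\<^sup>2 = e\<^sub>i\<close>), in terms of the
  coefficients with respect to the basis of the \<open>e\<^sub>v\<close>.
\<close>

definition hecke_factor ::
    "nat \<Rightarrow> 'a::comm_ring_1 \<Rightarrow> ((nat \<Rightarrow> nat) \<Rightarrow> 'a) \<Rightarrow> (nat \<Rightarrow> nat) \<Rightarrow> 'a" where
  "hecke_factor i a f v =
     (if v (Suc i) < v i then a * f v + (a - 1) * f (v \<circ> simple_transp i) else f v)"

text \<open>For an idempotent \<open>e\<close>, the elements \<open>1 + (a - 1) e\<close> multiply
  like their parameters \<open>a\<close>.\<close>

lemma hecke_factor_mult: "hecke_factor i a (hecke_factor i b f) = hecke_factor i (a * b) f"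
  by (rule ext) (simp add: hecke_factor_def algebra_simps)

lemma hecke_factor_comm:
  assumes "Suc i < j"
  shows "hecke_factor i a (hecke_factor j b f) = hecke_factor j b (hecke_factor i a f)"
proof
  fix v :: "nat \<Rightarrow> nat"
  have "(v \<circ> simple_transp i) j = v j" "(v \<circ> simple_transp i) (Suc j) = v (Suc j)"
    "(v \<circ> simple_transp j) i = v i" "(v \<circ> simple_transp j) (Suc i) = v (Suc i)"
    using assms by auto
  then show "hecke_factor i a (hecke_factor j b f) v = hecke_factor j b (hecke_factor i a f) v"
    unfolding hecke_factor_def simple_transp_comm[OF assms] by (simp add: algebra_simps)
qed

text \<open>The multiplicative form of the Yang-Baxter equation, checked on coefficients: only the
  values of \<open>f\<close> on the coset of \<open>v\<close> under \<open>s_i\<close> and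
  \<open>s_(i+1)\<close> enter, and the order of three values decides which terms occur.\<close>

lemma hecke_factor_yang_baxter:
  "hecke_factor i a (hecke_factor (Suc i) (a * b) (hecke_factor i b f)) =
   hecke_factor (Suc i) b (hecke_factor i (a * b) (hecke_factor (Suc i) a f))"
proof
  fix v
  let ?s = "simple_transp i" and ?t = "simple_transp (Suc i)"
  define f1 f2 f12 f21 f121 where f: "f1 = f (v \<circ> ?s)" "f2 = f (v \<circ> ?t)"
    "f12 = f (v \<circ> ?s \<circ> ?t)" "f21 = f (v \<circ> ?t \<circ> ?s)" "f121 = f (v \<circ> ?s \<circ> ?t \<circ> ?s)"
  define x y z where xyz: "x = v i" "y = v (Suc i)" "z = v (Suc (Suc i))"
  have vals: "(v \<circ> ?s) i = y" "(v \<circ> ?s) (Suc i) = x" "(v \<circ> ?s) (Suc (Suc i)) = z"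
    "(v \<circ> ?t) i = x" "(v \<circ> ?t) (Suc i) = z" "(v \<circ> ?t) (Suc (Suc i)) = y"
    "(v \<circ> ?s \<circ> ?t) i = y" "(v \<circ> ?s \<circ> ?t) (Suc i) = z" "(v \<circ> ?s \<circ> ?t) (Suc (Suc i)) = x"
    "(v \<circ> ?t \<circ> ?s) i = z" "(v \<circ> ?t \<circ> ?s) (Suc i) = x" "(v \<circ> ?t \<circ> ?s) (Suc (Suc i)) = y"
    by (auto simp: xyz)
  show "hecke_factor i a (hecke_factor (Suc i) (a * b) (hecke_factor i b f)) v =
        hecke_factor (Suc i) b (hecke_factor i (a * b) (hecke_factor (Suc i) a f)) v"
    unfolding hecke_factor_def vals xyz[symmetric] simple_transp_braid comp_simple_transp_twice
      f[symmetric]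
    by (cases "y < x"; cases "z < y"; cases "z < x") (simp_all add: algebra_simps)
qed

section \<open>Exchanging rows and columns of a product over the staircase\<close>

definition hecke_prod :: "(nat \<times> 'a::comm_ring_1) list \<Rightarrow> ((nat \<Rightarrow> nat) \<Rightarrow> 'a) \<Rightarrow> (nat \<Rightarrow> nat) \<Rightarrow> 'a" where
  "hecke_prod L = fold (\<lambda>(i, a). hecke_factor i a) L"

lemma hecke_prod_simps [simp]:
  "hecke_prod [] F = F"
  "hecke_prod ((i, a) # L) F = hecke_prod L (hecke_factor i a F)"
  "hecke_prod (L @ M) F = hecke_prod M (hecke_prod L F)"
  by (simp_all add: hecke_prod_def)

lemma hecke_prod_comm:
  assumes "\<And>i a. (i, a) \<in> set L \<Longrightarrow> Suc i < m \<or> Suc m < i"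
  shows "hecke_prod L (hecke_factor m b F) = hecke_factor m b (hecke_prod L F)"
  using assms
proof (induction L arbitrary: F)
  case (Cons x L)
  obtain i a where x: "x = (i, a)" by (cases x)
  have "Suc i < m \<or> Suc m < i" using Cons.prems[of i a] by (simp add: x)
  then have "hecke_factor i a (hecke_factor m b F) = hecke_factor m b (hecke_factor i a F)"
    using hecke_factor_comm by metis
  moreover have "hecke_prod L (hecke_factor m b (hecke_factor i a F)) =
      hecke_factor m b (hecke_prod L (hecke_factor i a F))"
    by (rule Cons.IH) (use Cons.prems in auto)
  ultimately show ?case by (simp add: x)
qed simp

definition row_factors :: "nat \<Rightarrow> (nat \<Rightarrow> 'a) \<Rightarrow> nat \<Rightarrow> (nat \<times> 'a) list" where
  "row_factors i f c = map (\<lambda>j. (i + j - 1, f j)) (rev [1..<Suc c])"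

lemma row_factors_0 [simp]: "row_factors i f 0 = []"
  by (simp add: row_factors_def)

lemma row_factors_Suc [simp]: "row_factors i f (Suc c) = (i + c, f (Suc c)) # row_factors i f c"
  by (simp add: row_factors_def)

lemma row_factors_cong:
  "(\<And>j. 1 \<le> j \<Longrightarrow> j \<le> c \<Longrightarrow> f j = g j) \<Longrightarrow> row_factors i f c = row_factors i g c"
  by (auto simp: row_factors_def simp del: upt_Suc)

lemma set_row_factors: "(m, a) \<in> set (row_factors i f c) \<Longrightarrow> i \<le> m \<and> m < i + c"
  by (auto simp: row_factors_def)

text \<open>A factor with parameter \<open>t = f / g\<close> enters before two rows of equal length
  and passes through them column by column, from right to left. Each column costs one Yang-Baxter
  move, which exchanges its two weights and lowers the index of the travelling factor by
  one.\<close>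

lemma two_rows_swap:
  assumes "\<And>j. f j = t * g j"
  shows "hecke_prod (row_factors i f c @ row_factors (Suc i) g c) (hecke_factor (i + c) t F) =
         hecke_factor i t (hecke_prod (row_factors i g c @ row_factors (Suc i) f c) F)"
proof (induction c arbitrary: F)
  case (Suc c)
  let ?m = "i + c"
  have past: "hecke_prod (row_factors i h c) (hecke_factor (Suc ?m) b G) =
      hecke_factor (Suc ?m) b (hecke_prod (row_factors i h c) G)" for h b G
    by (rule hecke_prod_comm) (auto dest: set_row_factors)
  let ?F = "hecke_factor (Suc ?m) (f (Suc c)) (hecke_factor ?m (g (Suc c)) F)"
  have "hecke_prod (row_factors i f (Suc c) @ row_factors (Suc i) g (Suc c))
      (hecke_factor (i + Suc c) t F) =
    hecke_prod (row_factors (Suc i) g c) (hecke_factor (Suc ?m) (g (Suc c))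
      (hecke_prod (row_factors i f c) (hecke_factor ?m (f (Suc c)) (hecke_factor (Suc ?m) t F))))"
    by simp
  also have "\<dots> = hecke_prod (row_factors i f c @ row_factors (Suc i) g c)
      (hecke_factor (Suc ?m) (g (Suc c)) (hecke_factor ?m (f (Suc c)) (hecke_factor (Suc ?m) t F)))"
    by (simp add: past)
  also have "\<dots> = hecke_prod (row_factors i f c @ row_factors (Suc i) g c)
      (hecke_factor ?m t (hecke_factor (Suc ?m) (f (Suc c)) (hecke_factor ?m (g (Suc c)) F)))"
    using hecke_factor_yang_baxter[of ?m t "g (Suc c)"] by (simp add: assms)
  also have "\<dots> = hecke_factor i t (hecke_prod (row_factors i g c @ row_factors (Suc i) f c) ?F)"
    by (rule Suc.IH)
  also have "\<dots> = hecke_factor i t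
      (hecke_prod (row_factors i g (Suc c) @ row_factors (Suc i) f (Suc c)) F)"
    by (simp add: past)
  finally show ?case .
qed simp

text \<open>Here the travelling factor crosses a single row. One Yang-Baxter move at columns
  \<open>q\<close> and \<open>q + 1\<close> exchanges their weights and raises its index by one; it
  commutes with the rest of the row.\<close>

lemma row_column_swap:
  assumes "f (Suc q) = t * f q" and "1 \<le> q" and "Suc q \<le> c" and "1 \<le> p"
  shows "hecke_prod (row_factors p f c) (hecke_factor (p + q - 1) t F) =
         hecke_factor (p + q) t (hecke_prod (row_factors p (\<lambda>j. f (simple_transp q j)) c) F)"
  using assms(3)
proof (induction c arbitrary: F rule: dec_induct)
  case base
  obtain q' where q: "q = Suc q'" using assms(2) by (cases q) auto
  let ?m = "p + q'"
  have past: "hecke_prod (row_factors p f q') (hecke_factor (Suc ?m) b G) =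
      hecke_factor (Suc ?m) b (hecke_prod (row_factors p f q') G)" for b G
    by (rule hecke_prod_comm) (auto dest: set_row_factors)
  have same: "row_factors p (\<lambda>j. f (simple_transp q j)) q' = row_factors p f q'"
    by (rule row_factors_cong) (simp add: q)
  have "hecke_factor ?m (f q) (hecke_factor (Suc ?m) (f (Suc q)) (hecke_factor ?m t F)) =
      hecke_factor (Suc ?m) t (hecke_factor ?m (f (Suc q)) (hecke_factor (Suc ?m) (f q) F))"
    using hecke_factor_yang_baxter[of ?m "f q" t] by (simp add: assms(1) mult.commute)
  then show ?case using same past by (simp add: q)
next
  case (step c)
  have "hecke_factor (p + c) b (hecke_factor (p + q - 1) t F) =
      hecke_factor (p + q - 1) t (hecke_factor (p + c) b F)" for b
    by (rule hecke_factor_comm[symmetric]) (use step.hyps assms in auto)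
  then show ?case using step by simp
qed

text \<open>The first row \<open>p\<close> is variable because a column exchange proceeds row by row
  from the top.\<close>

definition staircase_factors :: "nat \<Rightarrow> (nat \<Rightarrow> nat \<Rightarrow> 'a) \<Rightarrow> nat \<Rightarrow> (nat \<times> 'a) list" where
  "staircase_factors k w p = concat (map (\<lambda>i. row_factors i (w i) (k - i)) [p..<Suc k])"

lemma staircase_factors_Cons:
  "p \<le> k \<Longrightarrow> staircase_factors k w p = row_factors p (w p) (k - p) @ staircase_factors k w (Suc p)"
  by (simp add: staircase_factors_def upt_conv_Cons del: upt_Suc)

lemma staircase_factors_cong:
  "(\<And>i j. p \<le> i \<Longrightarrow> 1 \<le> j \<Longrightarrow> i + j \<le> k \<Longrightarrow> w i j = w' i j) \<Longrightarrow>
   staircase_factors k w p = staircase_factors k w' p"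
  unfolding staircase_factors_def
  by (intro arg_cong[where f = concat] map_cong HOL.refl row_factors_cong) auto

lemma set_staircase_factors: "(m, a) \<in> set (staircase_factors k w p) \<Longrightarrow> p \<le> m"
  by (auto simp: staircase_factors_def simp del: upt_Suc dest!: set_row_factors)

lemma staircase_factors_append:
  "p \<le> i \<Longrightarrow> i \<le> Suc k \<Longrightarrow> staircase_factors k w p =
    concat (map (\<lambda>i. row_factors i (w i) (k - i)) [p..<i]) @ staircase_factors k w i"
  using upt_add_eq_append[of p i "Suc k - i"] by (simp add: staircase_factors_def del: upt_Suc)

text \<open>In the staircase, row \<open>i\<close> has one box more than row \<open>i + 1\<close>.
  The weight of this surplus box supplies the factor with parameter \<open>t\<close> that travels
  through the two rows; it emerges with index \<open>i\<close> and commutes with all later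
  rows.\<close>

lemma staircase_row_swap:
  assumes "1 \<le> i" and "i < k" and t: "\<And>j. w i j = t * w (Suc i) j"
  shows "hecke_prod (staircase_factors k w 1) F =
         hecke_factor i t (hecke_prod (staircase_factors k (\<lambda>p. w (simple_transp i p)) 1) F)"
proof -
  let ?w = "\<lambda>p. w (simple_transp i p)"
  define c where "c = k - Suc i"
  have k: "k = i + Suc c" using assms by (simp add: c_def)
  let ?pre = "concat (map (\<lambda>i. row_factors i (w i) (k - i)) [1..<i])"
  have split: "staircase_factors k u 1 = concat (map (\<lambda>i. row_factors i (u i) (k - i)) [1..<i]) @
      (i + c, u i (Suc c)) # row_factors i (u i) c @ row_factors (Suc i) (u (Suc i)) c @
      staircase_factors k u (Suc (Suc i))" for u :: "nat \<Rightarrow> nat \<Rightarrow> 'a"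
    using assms by (subst staircase_factors_append[of 1 i])
      (simp_all add: staircase_factors_Cons k)
  have pre: "concat (map (\<lambda>i. row_factors i (?w i) (k - i)) [1..<i]) = ?pre"
    by (intro arg_cong[where f = concat] map_cong HOL.refl) auto
  have post: "staircase_factors k ?w (Suc (Suc i)) = staircase_factors k w (Suc (Suc i))"
    by (rule staircase_factors_cong) simp
  let ?G = "hecke_prod ?pre F"
  \<comment> \<open>The surplus box is split into the travelling factor and the surplus box of the
    exchanged staircase.\<close>
  have "hecke_factor (i + c) (w i (Suc c)) ?G =
      hecke_factor (i + c) t (hecke_factor (i + c) (w (Suc i) (Suc c)) ?G)"
    by (simp add: hecke_factor_mult t)
  then have "hecke_prod (staircase_factors k w 1) F =
      hecke_prod (staircase_factors k w (Suc (Suc i)))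
        (hecke_prod (row_factors i (w i) c @ row_factors (Suc i) (w (Suc i)) c)
          (hecke_factor (i + c) t (hecke_factor (i + c) (w (Suc i) (Suc c)) ?G)))"
    unfolding split by simp
  also have "\<dots> = hecke_prod (staircase_factors k w (Suc (Suc i)))
      (hecke_factor i t (hecke_prod (row_factors i (w (Suc i)) c @ row_factors (Suc i) (w i) c)
        (hecke_factor (i + c) (w (Suc i) (Suc c)) ?G)))"
    by (subst two_rows_swap) (simp_all add: t)
  also have "\<dots> = hecke_factor i t (hecke_prod (staircase_factors k w (Suc (Suc i)))
      (hecke_prod (row_factors i (w (Suc i)) c @ row_factors (Suc i) (w i) c)
        (hecke_factor (i + c) (w (Suc i) (Suc c)) ?G)))"
    by (rule hecke_prod_comm) (auto dest: set_staircase_factors)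
  also have "\<dots> = hecke_factor i t (hecke_prod (staircase_factors k ?w 1) F)"
    unfolding split pre post by simp
  finally show ?thesis .
qed

text \<open>The travelling factor gains one in index with every row until row \<open>k - q\<close>,
  whose last box is in column \<open>q\<close>. There it has the same index as that box and is
  absorbed into its weight, turning \<open>w p q\<close> into \<open>w p (Suc q)\<close>.\<close>

lemma staircase_column_swap:
  assumes "1 \<le> q" and "1 \<le> p" and "p + q \<le> k" and t: "\<And>i. w i (Suc q) = t * w i q"
  shows "hecke_prod (staircase_factors k w p) (hecke_factor (p + q - 1) t F) =
         hecke_prod (staircase_factors k (\<lambda>i j. w i (simple_transp q j)) p) F"
  using assms(2,3)
proof (induction "k - q - p" arbitrary: p F)
  case 0
  then have k: "k - p = q" "p \<le> k" by auto
  let ?w = "\<lambda>i j. w i (simple_transp q j)"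
  obtain q' where q: "q = Suc q'" using assms(1) by (cases q) auto
  have rest: "staircase_factors k ?w (Suc p) = staircase_factors k w (Suc p)"
    by (rule staircase_factors_cong) (use k in auto)
  have same: "row_factors p (?w p) q' = row_factors p (w p) q'"
    by (rule row_factors_cong) (simp add: q)
  have "hecke_factor (p + q') (w p q) (hecke_factor (p + q') t F) =
      hecke_factor (p + q') (w p (Suc q)) F"
    by (simp add: hecke_factor_mult t mult.commute)
  then show ?case using same rest k by (simp add: staircase_factors_Cons q)
next
  case (Suc x)
  then have c: "Suc q \<le> k - p" "p \<le> k" by auto
  have "x = k - q - Suc p" "1 \<le> Suc p" "Suc p + q \<le> k" using Suc by auto
  note IH = Suc.hyps(1)[OF this]
  show ?case
    using row_column_swap[of "w p" q t "k - p" p F, OF t assms(1) c(1) Suc.prems(1)] IH c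
    by (simp add: staircase_factors_Cons)
qed

text \<open>
  A factor computes the value at \<open>v\<close> from the values at \<open>v\<close> and at some \<open>v s\<^sub>i\<close> shorter than \<open>v\<close>, and
  passing from \<open>v\<close> to \<open>v s\<^sub>i\<close> does not invert the values \<open>q\<close> and \<open>q + 1\<close>.
\<close>

lemma hecke_prod_agree:
  assumes "\<And>v. (\<exists>a b. a < b \<and> v a = q \<and> v b = Suc q) \<Longrightarrow> f v = g v"
    and "\<exists>a b. a < b \<and> v a = q \<and> v b = Suc q"
  shows "hecke_prod L f v = hecke_prod L g v"
  using assms
proof (induction L arbitrary: f g)
  case (Cons x L)
  obtain i a where x: "x = (i, a)" by (cases x)
  have "hecke_factor i a f u = hecke_factor i a g u"
    if u: "\<exists>a b. a < b \<and> u a = q \<and> u b = Suc q" for u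
  proof (cases "u (Suc i) < u i")
    case True
    obtain a b where ab: "a < b" "u a = q" "u b = Suc q" using u by blast
    then have "(a, b) \<noteq> (i, Suc i)" using True by auto
    then have "simple_transp i a < simple_transp i b"
      using ab(1) by (cases "a = i"; cases "a = Suc i"; cases "b = i"; cases "b = Suc i") auto
    moreover have "(u \<circ> simple_transp i) (simple_transp i a) = q"
      "(u \<circ> simple_transp i) (simple_transp i b) = Suc q" using ab by auto
    ultimately have "f (u \<circ> simple_transp i) = g (u \<circ> simple_transp i)"
      using Cons.prems(1) by blast
    then show ?thesis using Cons.prems(1)[OF u] by (simp add: hecke_factor_def)
  qed (simp add: hecke_factor_def Cons.prems(1)[OF u])
  then show ?case using Cons.IH[of "hecke_factor i a f" "hecke_factor i a g"] Cons.prems(2) x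
    by simp
qed auto

text \<open>The unit of the 0-Hecke algebra, as a coefficient function.\<close>

definition indicator_id :: "(nat \<Rightarrow> nat) \<Rightarrow> 'a::comm_ring_1" where
  "indicator_id v = of_bool (v = id)"

definition staircase_coeff :: "nat \<Rightarrow> (nat \<Rightarrow> nat \<Rightarrow> 'a::comm_ring_1) \<Rightarrow> (nat \<Rightarrow> nat) \<Rightarrow> 'a" where
  "staircase_coeff k w = hecke_prod (staircase_factors k w 1) indicator_id"

lemma staircase_coeff_row_swap:
  assumes "1 \<le> i" and "i < k" and "\<And>j. w i j = t * w (Suc i) j"
  shows "staircase_coeff k w = hecke_factor i t (staircase_coeff k (\<lambda>p. w (simple_transp i p)))"
  unfolding staircase_coeff_def using assms by (rule staircase_row_swap)

lemma staircase_coeff_column_swap: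
  assumes q: "1 \<le> q" "q < k" and t: "\<And>i. w i (Suc q) = t * w i q"
    and v: "\<exists>a b. a < b \<and> v a = q \<and> v b = Suc q"
  shows "staircase_coeff k w v = staircase_coeff k (\<lambda>i j. w i (simple_transp q j)) v"
proof -
  \<comment> \<open>Multiplying the unit by a factor of index \<open>q\<close> can change
    coefficients only at \<open>id\<close> and \<open>s_q\<close>. The unit has no descent, and in
    \<open>s_q\<close> the value \<open>q + 1\<close> precedes \<open>q\<close>.\<close>
  have "hecke_factor q t indicator_id u = indicator_id u"
    if u: "\<exists>a b. a < b \<and> u a = q \<and> u b = Suc q" for u
  proof (cases "u (Suc q) < u q")
    case True
    then have "u \<noteq> id" by auto
    moreover have "u \<circ> simple_transp q \<noteq> id"
    proof
      assume "u \<circ> simple_transp q = id"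
      then have eq: "u = simple_transp q" by (metis comp_simple_transp_twice id_comp)
      obtain a b where ab: "a < b" "u a = q" "u b = Suc q" using u by blast
      have "a = Suc q" "b = q"
        using ab(2,3) unfolding eq by (metis simple_transp_simps)+
      then show False using ab by simp
    qed
    ultimately show ?thesis by (simp add: hecke_factor_def indicator_id_def)
  qed (simp add: hecke_factor_def)
  then have "staircase_coeff k w v = hecke_prod (staircase_factors k w 1) (hecke_factor q t indicator_id) v"
    unfolding staircase_coeff_def using v
    by (intro hecke_prod_agree[where q = q]) auto
  also have "\<dots> = staircase_coeff k (\<lambda>i j. w i (simple_transp q j)) v"
    unfolding staircase_coeff_def
    using staircase_column_swap[of q 1 k w t] q t by simp
  finally show ?thesis .
qed

section \<open>Expansion into pipe dreams\<close>

text \<open>The fibres of the action: they explain why a coefficient at a descent collects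
  contributions from exactly \<open>v\<close> and \<open>v s_m\<close>.\<close>

lemma hecke_act_eq_iff:
  assumes "finitary u"
  shows "hecke_act u m = v \<longleftrightarrow> v (Suc m) < v m \<and> (u = v \<or> u = v \<circ> simple_transp m)"
  using finitary_cases[OF assms, of m]
proof cases
  case 1
  then have "hecke_act u m = u \<circ> simple_transp m" by (simp add: hecke_act_def)
  then show ?thesis using 1 by auto
next
  case 2
  then have "hecke_act u m = u" by (simp add: hecke_act_def)
  then show ?thesis using 2 by auto
qed

text \<open>Expanding the product selects from each factor either 1 or \<open>(w b - 1) e\<close>.
  The set \<open>P\<close> collects the boxes of the second kind, and their generators multiply to
  the Demazure product.\<close>

lemma hecke_prod_expand:
  fixes w :: "'b \<Rightarrow> 'a::comm_ring_1"
  assumes "distinct B"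
  shows "hecke_prod (map (\<lambda>b. (l b, w b)) B) indicator_id v =
    (\<Sum>P\<in>Pow (set B). of_bool (demazure_product (map l (filter (\<lambda>b. b \<in> P) B)) = v) * (\<Prod>b\<in>P. w b - 1))"
  using assms
proof (induction B arbitrary: v rule: rev_induct)
  case Nil
  show ?case by (auto simp: indicator_id_def demazure_product_Nil[unfolded id_def] id_def)
next
  case (snoc b B)
  let ?X = "set B" and ?D = "\<lambda>P. demazure_product (map l (filter (\<lambda>b. b \<in> P) B))"
  let ?p = "\<lambda>P. \<Prod>b\<in>P. w b - 1"
  have b: "b \<notin> ?X" and dist: "distinct B" using snoc.prems by auto
  define e where "e P u = of_bool (?D P = u) * ?p P" for P u
  define T where "T u = (\<Sum>P\<in>Pow ?X. e P u)" for u
  have IH: "hecke_prod (map (\<lambda>b. (l b, w b)) B) indicator_id = T"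
    unfolding T_def e_def using snoc.IH[OF dist] by (intro ext)
  define t where
    "t P = of_bool (demazure_product (map l (filter (\<lambda>c. c \<in> P) (B @ [b]))) = v) * ?p P" for P
  have t1: "t P = e P v" if "P \<in> Pow ?X" for P
    using that b by (auto simp: t_def e_def)
  have t2: "t (insert b P) = (w b - 1) * (if v (Suc (l b)) < v (l b) then
      e P v + e P (v \<circ> simple_transp (l b)) else 0)"
    if P: "P \<in> Pow ?X" for P
  proof -
    have fP: "finite P" "b \<notin> P" using P b finite_subset by auto
    have "filter (\<lambda>c. c \<in> insert b P) B = filter (\<lambda>c. c \<in> P) B"
      using b by (intro filter_cong) auto
    then have "t (insert b P) = of_bool (hecke_act (?D P) (l b) = v) * ((w b - 1) * ?p P)"
      using fP by (simp add: t_def demazure_product_snoc)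
    \<comment> \<open>The two members of a fibre are distinct, so the indicator of their disjunction
      is a sum of indicators.\<close>
    moreover have "\<not> (v = v \<circ> simple_transp (l b) \<and> v (Suc (l b)) < v (l b))"
      by (metis comp_apply less_not_refl simple_transp_simps(1))
    ultimately show ?thesis
      unfolding hecke_act_eq_iff[OF finitary_demazure_product] e_def by auto
  qed
  have "(\<Sum>P\<in>Pow (insert b ?X). t P) = (\<Sum>P\<in>Pow ?X. t P) + (\<Sum>P\<in>insert b ` Pow ?X. t P)"
    unfolding Pow_insert by (rule sum.union_disjoint) (use b in auto)
  also have "(\<Sum>P\<in>insert b ` Pow ?X. t P) = (\<Sum>P\<in>Pow ?X. t (insert b P))"
    by (rule sum.reindex_cong[where l = "insert b"]) (use b in \<open>auto simp: inj_on_def\<close>)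
  also have "(\<Sum>P\<in>Pow ?X. t P) + (\<Sum>P\<in>Pow ?X. t (insert b P)) =
      T v + (w b - 1) * (if v (Suc (l b)) < v (l b) then T v + T (v \<circ> simple_transp (l b)) else 0)"
    using t1 t2 by (simp add: T_def sum_distrib_left[symmetric] sum.distrib)
  also have "\<dots> = hecke_factor (l b) (w b) T v"
    by (simp add: hecke_factor_def algebra_simps)
  finally show ?case unfolding t_def by (simp only: IH hecke_prod_simps map_append list.map set_append list.set Un_insert_right Un_empty_right)
qed

definition staircase :: "nat \<Rightarrow> box set" where
  "staircase k = {(i, j). 1 \<le> i \<and> 1 \<le> j \<and> i + j \<le> k}"

definition row_word :: "nat \<Rightarrow> box set \<Rightarrow> nat \<Rightarrow> nat list" where
  "row_word k P i = map (\<lambda>j. i + j - 1) (filter (\<lambda>j. (i, j) \<in> P) (rev [1..<Suc (k - i)]))"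

text \<open>A list in reading order, so that the word of any subset results from filtering.\<close>

definition staircase_boxes :: "nat \<Rightarrow> box list" where
  "staircase_boxes k = concat (map (\<lambda>i. map (Pair i) (rev [1..<Suc (k - i)])) [1..<Suc k])"

lemma finite_staircase: "finite (staircase k)"
  by (rule finite_subset[of _ "{1..k} \<times> {1..k}"]) (auto simp: staircase_def)

lemma set_staircase_boxes: "set (staircase_boxes k) = staircase k"
  by (auto simp: staircase_boxes_def staircase_def simp del: upt_Suc)
    (rule_tac x = a in bexI, auto)

lemma distinct_concat_map_Pair:
  "distinct xs \<Longrightarrow> (\<And>x. distinct (g x)) \<Longrightarrow> distinct (concat (map (\<lambda>x. map (Pair x) (g x)) xs))"
  by (induction xs) (auto simp: distinct_map inj_on_def)

lemma distinct_staircase_boxes: "distinct (staircase_boxes k)"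
  unfolding staircase_boxes_def by (intro distinct_concat_map_Pair) (simp_all del: upt_Suc)

lemma staircase_factors_boxes:
  "staircase_factors k w 1 = map (\<lambda>b. (fst b + snd b - 1, w (fst b) (snd b))) (staircase_boxes k)"
  by (simp add: staircase_factors_def staircase_boxes_def row_factors_def map_concat o_def
      del: upt_Suc)

lemma staircase_boxes_word:
  "map (\<lambda>b. fst b + snd b - 1) (filter (\<lambda>b. b \<in> P) (staircase_boxes k)) =
   concat (map (row_word k P) [1..<Suc k])"
  by (simp add: staircase_boxes_def row_word_def[abs_def] map_concat filter_concat filter_map o_def
      del: upt_Suc)

lemma sorted_list_of_set_subset_upt:
  "A \<subseteq> {a..<b} \<Longrightarrow> sorted_list_of_set A = filter (\<lambda>x. x \<in> A) [a..<b]"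
proof -
  assume "A \<subseteq> {a..<b}"
  then have "A = set (filter (\<lambda>x. x \<in> A) [a..<b])" by auto
  moreover have "sorted (filter (\<lambda>x. x \<in> A) [a..<b])" "distinct (filter (\<lambda>x. x \<in> A) [a..<b])"
    by (simp_all add: sorted_wrt_filter)
  ultimately show ?thesis
    using sorted_list_of_set.idem_if_sorted_distinct by metis
qed

lemma concat_map_filter:
  "(\<And>x. x \<in> set xs \<Longrightarrow> \<not> Q x \<Longrightarrow> f x = []) \<Longrightarrow> concat (map f (filter Q xs)) = concat (map f xs)"
  by (induction xs) auto

lemma pipe_word_staircase:
  assumes P: "P \<subseteq> staircase k"
  shows "pipe_word P = concat (map (row_word k P) [1..<Suc k])"
proof -
  let ?f = "\<lambda>i. map (\<lambda>j. i + j - 1) (rev (sorted_list_of_set {j. (i, j) \<in> P}))"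
  have "fst ` P \<subseteq> {1..<Suc k}" using P by (auto simp: staircase_def)
  then have rows: "sorted_list_of_set (fst ` P) = filter (\<lambda>i. i \<in> fst ` P) [1..<Suc k]"
    by (rule sorted_list_of_set_subset_upt)
  have row: "?f i = row_word k P i" for i
  proof -
    have "{j. (i, j) \<in> P} \<subseteq> {1..<Suc (k - i)}" using P by (auto simp: staircase_def)
    then show ?thesis
      by (simp add: sorted_list_of_set_subset_upt row_word_def rev_filter del: upt_Suc)
  qed
  have "row_word k P i = []" if "i \<notin> fst ` P" for i
    using that by (force simp: row_word_def filter_empty_conv)
  then show ?thesis
    unfolding pipe_word_def rows row by (intro concat_map_filter)
qed

lemma staircase_coeff_eq:
  "staircase_coeff k w v = (\<Sum>P\<in>Pow (staircase k).
     of_bool (demazure_product (pipe_word P) = v) * (\<Prod>(i, j)\<in>P. w i j - 1))"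
proof -
  have "demazure_product (map (\<lambda>b. fst b + snd b - 1) (filter (\<lambda>b. b \<in> P) (staircase_boxes k))) =
      demazure_product (pipe_word P)" if "P \<in> Pow (staircase k)" for P
    using that by (simp only: staircase_boxes_word pipe_word_staircase Pow_iff)
  then show ?thesis
    unfolding staircase_coeff_def staircase_factors_boxes
      hecke_prod_expand[OF distinct_staircase_boxes] set_staircase_boxes case_prod_unfold
    by (intro sum.cong) auto
qed

text \<open>Steps of the action only move larger values to the left, so a value above
  \<open>m\<close> among the positions up to \<open>m\<close> never disappears. This confines pipe
  dreams for \<open>S_k\<close> to the staircase: a cross outside it has a letter
  \<open>m >= k\<close>, and no such displacement exists in \<open>S_k\<close>.\<close>

lemma demazure_product_moves:
  assumes "m \<in> set w"
  shows "\<exists>p\<le>m. m < demazure_product w p"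
  using assms
proof (induction w rule: rev_induct)
  case (snoc i w)
  let ?u = "demazure_product w"
  have fin: "finitary ?u" by (rule finitary_demazure_product)
  show ?case
  proof (cases "\<exists>p\<le>m. m < ?u p")
    case True
    then obtain p where p: "p \<le> m" "m < ?u p" by blast
    show ?thesis
    proof (cases "?u i < ?u (Suc i)")
      case asc: True
      then have D: "demazure_product (w @ [i]) = ?u \<circ> simple_transp i"
        by (simp add: demazure_product_snoc hecke_act_def)
      show ?thesis
      proof (cases "i = m \<and> p = m")
        case True
        then have "m < demazure_product (w @ [i]) m" using asc p unfolding D by simp
        then show ?thesis by blast
      next
        case False
        then have "simple_transp i p \<le> m" using p
          by (cases "p = i"; cases "p = Suc i") auto
        moreover have "m < demazure_product (w @ [i]) (simple_transp i p)" using p unfolding D by simp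
        ultimately show ?thesis by blast
      qed
    next
      case False
      then have "demazure_product (w @ [i]) = ?u"
        by (simp add: demazure_product_snoc hecke_act_def)
      then show ?thesis using p by metis
    qed
  next
    case False
    then have i: "i = m" using snoc by auto
    \<comment> \<open>If the positions up to \<open>m\<close> still carry exactly the values up to
      \<open>m\<close>, then the value at \<open>m + 1\<close> is larger and \<open>s_m\<close>
      brings it to position \<open>m\<close>.\<close>
    have le: "?u p \<le> m" if "p \<le> m" for p using False that by auto
    then have sub: "?u ` {0..m} \<subseteq> {0..m}" by (intro image_subsetI) simp
    have "inj_on ?u {0..m}" using finitary_inj[OF fin] by (rule inj_on_subset) simp
    then have "?u ` {0..m} = {0..m}" by (rule endo_inj_surj[OF finite_atLeastAtMost sub])
    moreover have "?u (Suc m) \<notin> ?u ` {0..m}"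
      using inj_image_mem_iff[OF finitary_inj[OF fin]] by simp
    ultimately have gt: "m < ?u (Suc m)" by simp
    then have "demazure_product (w @ [i]) = ?u \<circ> simple_transp m"
      using le[of m] by (simp add: i demazure_product_snoc hecke_act_def)
    then have "m < demazure_product (w @ [i]) m" using gt by simp
    then show ?thesis by blast
  qed
qed simp

lemma pipe_dreams_subset_staircase:
  assumes v: "v permutes {1..k}" and P: "P \<in> pipe_dreams v"
  shows "P \<subseteq> staircase k"
proof
  fix b assume b: "b \<in> P"
  obtain i j where ij: "b = (i, j)" by (cases b)
  have fin: "finite P" and sub: "P \<subseteq> {1..} \<times> {1..}" and D: "demazure_product (pipe_word P) = v"
    using P by (auto simp: pipe_dreams_def)
  have "finite {j. (i, j) \<in> P}"
    by (rule finite_subset[OF _ finite_imageI[OF fin, of snd]]) force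
  then have "i + j - 1 \<in> set (pipe_word P)"
    using b fin by (force simp: pipe_word_def ij)
  from demazure_product_moves[OF this] obtain p where p: "p \<le> i + j - 1" "i + j - 1 < v p"
    unfolding D by blast
  then have "p \<in> {1..k}" using permutes_not_in[OF v, of p] by force
  then have "v p \<le> k" using permutes_in_image[OF v] by auto
  then show "b \<in> staircase k" using p b sub by (auto simp: ij staircase_def)
qed

lemma pipe_dreams_eq:
  assumes "v permutes {1..k}"
  shows "pipe_dreams v = {P \<in> Pow (staircase k). demazure_product (pipe_word P) = v}"
proof (intro equalityI subsetI)
  fix P assume "P \<in> pipe_dreams v"
  then show "P \<in> {P \<in> Pow (staircase k). demazure_product (pipe_word P) = v}"
    using pipe_dreams_subset_staircase[OF assms] by (simp add: pipe_dreams_def)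
next
  fix P assume "P \<in> {P \<in> Pow (staircase k). demazure_product (pipe_word P) = v}"
  then show "P \<in> pipe_dreams v"
    using finite_subset[OF _ finite_staircase[of k], of P] by (auto simp: pipe_dreams_def staircase_def)
qed

lemma staircase_coeff_pipe_dreams:
  assumes "v permutes {1..k}"
  shows "staircase_coeff k w v = (\<Sum>P\<in>pipe_dreams v. \<Prod>(i, j)\<in>P. w i j - 1)"
  unfolding staircase_coeff_eq pipe_dreams_eq[OF assms]
  by (rule sum.mono_neutral_cong_right) (auto simp: finite_staircase)

text \<open>Makes the truncated subtraction \<open>card P - perm_length v\<close> a true difference.
  The word has one letter for each cross, and a letter adds at most one to the length.\<close>

lemma perm_length_le_card_pipe_dream:
  assumes "v permutes {1..k}" and "P \<in> pipe_dreams v"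
  shows "perm_length v \<le> card P"
proof -
  have P: "P \<subseteq> staircase k" "demazure_product (pipe_word P) = v"
    using assms by (auto simp: pipe_dreams_eq)
  have "length (pipe_word P) = length (filter (\<lambda>b. b \<in> P) (staircase_boxes k))"
    unfolding pipe_word_staircase[OF P(1)] staircase_boxes_word[symmetric] by simp
  also have "\<dots> = card (set (filter (\<lambda>b. b \<in> P) (staircase_boxes k)))"
    by (rule distinct_card[symmetric]) (simp add: distinct_staircase_boxes)
  also have "set (filter (\<lambda>b. b \<in> P) (staircase_boxes k)) = P"
    using P(1) by (auto simp: set_staircase_boxes)
  finally show ?thesis using perm_length_demazure_product_le[of "pipe_word P"] P(2) by simp
qed

section \<open>Pipe dreams and partition diagrams\<close>

lemma foldl_hecke_act_fixed:
  assumes "\<And>m. m \<in> set a \<Longrightarrow> x \<noteq> m \<and> x \<noteq> Suc m"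
  shows "foldl hecke_act u a x = u x"
  using assms
proof (induction a arbitrary: u)
  case (Cons m a)
  have "foldl hecke_act (hecke_act u m) a x = hecke_act u m x"
    using Cons by simp
  also have "hecke_act u m x = u x"
    using Cons.prems[of m] by (simp add: hecke_act_def)
  finally show ?case by simp
qed simp

lemma hecke_act_permutes: "u permutes {1..k} \<Longrightarrow> 1 \<le> m \<Longrightarrow> m < k \<Longrightarrow> hecke_act u m permutes {1..k}"
  by (simp add: hecke_act_def permutes_compose simple_transp_permutes)

lemma foldl_hecke_act_permutes:
  "u permutes {1..k} \<Longrightarrow> (\<And>m. m \<in> set a \<Longrightarrow> 1 \<le> m \<and> m < k) \<Longrightarrow> foldl hecke_act u a permutes {1..k}"
proof (induction a arbitrary: u)
  case (Cons m a)
  have "hecke_act u m permutes {1..k}" using Cons.prems by (intro hecke_act_permutes) auto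
  then show ?case using Cons by simp
qed simp

lemma permutes_ge_1: "u permutes {1..k} \<Longrightarrow> 1 \<le> u x \<longleftrightarrow> 1 \<le> (x::nat)"
  using permutes_in_image[of u "{1..k}" x] permutes_not_in[of u "{1..k}" x] by force

text \<open>Only ascents are ever exchanged, so a larger value that precedes a smaller one stays in
  front of it.\<close>

lemma foldl_hecke_act_inversion:
  assumes "a < b" and "\<exists>x y. x < y \<and> u x = b \<and> u y = a"
  shows "\<exists>x y. x < y \<and> foldl hecke_act u w x = b \<and> foldl hecke_act u w y = a"
proof (induction w rule: rev_induct)
  case Nil
  then show ?case using assms(2) by auto
next
  case (snoc m w)
  let ?u = "foldl hecke_act u w"
  obtain x y where xy: "x < y" "?u x = b" "?u y = a" using snoc by blast
  show ?case
  proof (cases "?u m < ?u (Suc m)")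
    case True
    then have "(x, y) \<noteq> (m, Suc m)" using xy assms(1) by auto
    then have "simple_transp m x < simple_transp m y"
      using xy(1) by (cases "x = m"; cases "x = Suc m"; cases "y = m"; cases "y = Suc m") auto
    moreover have "foldl hecke_act u (w @ [m]) = ?u \<circ> simple_transp m"
      using True by (simp add: hecke_act_def)
    moreover have "(?u \<circ> simple_transp m) (simple_transp m x) = b"
      "(?u \<circ> simple_transp m) (simple_transp m y) = a" using xy by simp_all
    ultimately show ?thesis by metis
  next
    case False
    then have "foldl hecke_act u (w @ [m]) = ?u" by (simp add: hecke_act_def)
    then show ?thesis using xy by metis
  qed
qed

definition located :: "nat \<Rightarrow> nat \<Rightarrow> (nat \<Rightarrow> nat) \<Rightarrow> bool" where
  "located q c u \<longleftrightarrow> (\<forall>x. 1 \<le> u x \<and> u x \<le> q \<longrightarrow> x \<le> c)"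

lemma located_mono: "located q c u \<Longrightarrow> c \<le> c' \<Longrightarrow> located q c' u"
  unfolding located_def using le_trans by blast

lemma located_hecke_act:
  assumes "located q c u"
  shows "m \<noteq> c \<Longrightarrow> located q c (hecke_act u m)" and "located q (Suc c) (hecke_act u c)"
proof -
  have "x \<le> (if m = c then Suc c else c)" if "1 \<le> hecke_act u m x" "hecke_act u m x \<le> q" for m x
  proof (cases "u m < u (Suc m)")
    case True
    then have "simple_transp m x \<le> c"
      using that assms by (auto simp: hecke_act_def located_def)
    then show ?thesis by (cases "x = m"; cases "x = Suc m") (auto split: if_splits)
  next
    case False
    then have "x \<le> c" using that assms by (auto simp: hecke_act_def located_def)
    then show ?thesis by auto
  qed
  then show "m \<noteq> c \<Longrightarrow> located q c (hecke_act u m)" and "located q (Suc c) (hecke_act u c)"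
    unfolding located_def by (metis, metis)
qed

lemma located_foldl:
  "located q c u \<Longrightarrow> c \<notin> set a \<Longrightarrow> located q c (foldl hecke_act u a)"
  by (induction a arbitrary: u) (auto simp: located_hecke_act)

text \<open>Only the letter \<open>c\<close> can push a value beyond position \<open>c\<close>. In a
  decreasing word the letter \<open>c + 1\<close> cannot follow it, so one row moves the bound by at
  most one.\<close>

lemma located_foldl_decreasing:
  assumes "located q c u" and "sorted_wrt (>) a"
  shows "located q (Suc c) (foldl hecke_act u a)"
proof (cases "c \<in> set a")
  case True
  then obtain b d where a: "a = b @ c # d" by (meson split_list)
  then have "c \<notin> set b" "Suc c \<notin> set d"
    using assms(2) by (auto simp: sorted_wrt_append)
  then have "located q (Suc c) (foldl hecke_act (hecke_act (foldl hecke_act u b) c) d)"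
    using assms(1) by (intro located_foldl located_hecke_act(2)) auto
  then show ?thesis by (simp add: a)
next
  case False
  then show ?thesis using located_foldl[OF assms(1)] located_mono by force
qed

lemma set_row_word: "m \<in> set (row_word k P i) \<Longrightarrow> i \<le> m \<and> m < max i k"
  by (auto simp: row_word_def simp del: upt_Suc)

lemma sorted_row_word: "sorted_wrt (>) (row_word k P i)"
  unfolding row_word_def sorted_wrt_map
  by (rule sorted_wrt_filter)
    (auto simp: sorted_wrt_rev simp del: upt_Suc intro: sorted_wrt_mono_rel[OF _ sorted_wrt_upt])

definition rows_word :: "nat \<Rightarrow> box set \<Rightarrow> nat \<Rightarrow> nat \<Rightarrow> nat list" where
  "rows_word k P a b = concat (map (row_word k P) [a..<b])"

lemma rows_word_split: "a \<le> b \<Longrightarrow> b \<le> c \<Longrightarrow> rows_word k P a c = rows_word k P a b @ rows_word k P b c"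
  using upt_add_eq_append[of a b "c - b"] by (simp add: rows_word_def)

lemma rows_word_step: "a \<le> b \<Longrightarrow> rows_word k P a (Suc b) = rows_word k P a b @ row_word k P b"
  by (simp add: rows_word_def)

lemma set_rows_word: "m \<in> set (rows_word k P a b) \<Longrightarrow> a \<le> m \<and> (b \<le> k \<longrightarrow> m < k)"
  by (force simp: rows_word_def dest: set_row_word)

lemma pipe_word_rows: "P \<subseteq> staircase k \<Longrightarrow> pipe_word P = rows_word k P 1 (Suc k)"
  by (simp add: pipe_word_staircase rows_word_def)

lemma located_rows_word: "located q (i + q) (foldl hecke_act id (rows_word k P 1 (Suc i)))"
proof (induction i)
  case 0
  show ?case by (simp add: rows_word_def located_def)
next
  case (Suc i)
  show ?case
    using located_foldl_decreasing[OF Suc sorted_row_word, of k P "Suc i"]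
      rows_word_step[of 1 "Suc i" k P] by simp
qed

text \<open>
  In general the values \<open>1, \<dots>, q\<close> are among the first \<open>p + q\<close> positions after row \<open>p\<close>.  Without a
  cross at \<open>(p, q)\<close> they are among the first \<open>p + q - 1\<close>, so one of them is in the first \<open>p\<close>
  positions, which later rows do not touch.
\<close>

lemma pipe_dream_missing_box:
  assumes P: "P \<subseteq> staircase k" and pq: "(p, q) \<notin> P" "1 \<le> p" "p \<le> k" "1 \<le> q"
  shows "\<exists>x\<le>p. 1 \<le> demazure_product (pipe_word P) x \<and> demazure_product (pipe_word P) x \<le> q"
proof -
  define u where "u = foldl hecke_act id (rows_word k P 1 p)"
  define u' where "u' = foldl hecke_act u (row_word k P p)"
  obtain p' where p': "p = Suc p'" using pq(2) by (cases p) auto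
  have "located q (p + q - 1) u"
    unfolding u_def p' using located_rows_word[of q p' k P] by simp
  moreover have "p + q - 1 \<notin> set (row_word k P p)"
  proof
    assume "p + q - 1 \<in> set (row_word k P p)"
    then obtain j where "p + q - 1 = p + j - 1" "(p, j) \<in> P" "1 \<le> j"
      by (auto simp: row_word_def simp del: upt_Suc)
    then have "j = q" using pq by simp
    then show False using \<open>(p, j) \<in> P\<close> pq by simp
  qed
  ultimately have loc: "located q (p + q - 1) u'"
    unfolding u'_def by (rule located_foldl)
  have u': "u' = foldl hecke_act id (rows_word k P 1 (Suc p))"
    using pq by (simp add: u'_def u_def rows_word_step)
  have "finitary u'" unfolding u' by (rule finitary_foldl_hecke_act) simp
  have "u' 0 = 0"
    unfolding u' by (subst foldl_hecke_act_fixed) (auto dest: set_rows_word)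
  have "bij u'" using \<open>finitary u'\<close> unfolding finitary_def by (auto dest: permutes_bij)
  have "\<exists>x\<le>p. 1 \<le> u' x \<and> u' x \<le> q"
  proof (rule ccontr)
    assume none: "\<not> ?thesis"
    \<comment> \<open>Pigeonhole: \<open>q\<close> values would have to fit into
      \<open>q - 1\<close> positions.\<close>
    have "u' -` {1..q} \<subseteq> {p<..p + q - 1}"
    proof
      fix x assume "x \<in> u' -` {1..q}"
      then have "1 \<le> u' x" "u' x \<le> q" by auto
      then show "x \<in> {p<..p + q - 1}" using loc none unfolding located_def by force
    qed
    then have "card (u' -` {1..q}) \<le> card {p<..p + q - 1}" by (rule card_mono[rotated]) simp
    moreover have "card (u' -` {1..q}) = card {1..q}"
      using \<open>bij u'\<close> by (intro card_vimage_inj) (auto simp: bij_def)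
    ultimately show False using pq by simp
  qed
  then obtain x where x: "x \<le> p" "1 \<le> u' x" "u' x \<le> q" by blast
  have "demazure_product (pipe_word P) = foldl hecke_act u' (rows_word k P (Suc p) (Suc k))"
    using rows_word_split[of 1 "Suc p" "Suc k" k P] pq
    by (simp add: demazure_product_eq pipe_word_rows[OF P] u')
  moreover have "foldl hecke_act u' (rows_word k P (Suc p) (Suc k)) x = u' x"
    by (rule foldl_hecke_act_fixed) (use x(1) in \<open>auto dest: set_rows_word\<close>)
  ultimately show ?thesis using x by auto
qed

section \<open>Dominant permutations and their unique pipe dreams\<close>

definition diagram :: "nat \<Rightarrow> (nat \<Rightarrow> nat) \<Rightarrow> box set" where
  "diagram k l = {(i, j). 1 \<le> i \<and> i \<le> k \<and> 1 \<le> j \<and> j \<le> l i}"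

text \<open>
  \<open>v\<close> is the dominant permutation whose Rothe diagram is the partition with row lengths \<open>l\<close>.
\<close>

definition dominant :: "nat \<Rightarrow> (nat \<Rightarrow> nat) \<Rightarrow> (nat \<Rightarrow> nat) \<Rightarrow> bool" where
  "dominant k l v \<longleftrightarrow> v permutes {1..k} \<and> (\<forall>x\<in>{1..k}. l x < v x) \<and>
     (\<forall>x y. 1 \<le> x \<and> x < y \<and> v y < v x \<longrightarrow> v y \<le> l x)"

definition partition_rows :: "nat \<Rightarrow> (nat \<Rightarrow> nat) \<Rightarrow> bool" where
  "partition_rows k l \<longleftrightarrow> (\<forall>x y. 1 \<le> x \<and> x \<le> y \<and> y \<le> k \<longrightarrow> l y \<le> l x) \<and> (\<forall>x\<in>{1..k}. x + l x \<le> k)"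

lemma partition_rows_antimono: "partition_rows k l \<Longrightarrow> 1 \<le> x \<Longrightarrow> x \<le> y \<Longrightarrow> y \<le> k \<Longrightarrow> l y \<le> l x"
  by (simp add: partition_rows_def)

lemma partition_rows_le: "partition_rows k l \<Longrightarrow> 1 \<le> x \<Longrightarrow> x \<le> k \<Longrightarrow> x + l x \<le> k"
  by (simp add: partition_rows_def)

lemma diagram_subset_staircase: "partition_rows k l \<Longrightarrow> diagram k l \<subseteq> staircase k"
  using partition_rows_le[of k l] by (force simp: diagram_def staircase_def)

lemma row_word_diagram:
  assumes "partition_rows k l" and "1 \<le> i" and "i \<le> k"
  shows "row_word k (diagram k l) i = rev [i..<i + l i]"
proof -
  obtain m where m: "k - i = l i + m"
    using partition_rows_le[OF assms] by (metis le_add_diff_inverse le_diff_conv2 add.commute assms(3))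
  have "filter (\<lambda>j. (i, j) \<in> diagram k l) [1..<Suc (k - i)] = [1..<Suc (l i)]"
  proof -
    have "[1..<Suc (k - i)] = [1..<Suc (l i)] @ [Suc (l i)..<Suc (k - i)]"
      using upt_add_eq_append[of 1 "Suc (l i)" m] by (simp add: m del: upt_Suc)
    moreover have "filter (\<lambda>j. (i, j) \<in> diagram k l) [1..<Suc (l i)] = [1..<Suc (l i)]"
      using assms by (intro filter_True) (auto simp: diagram_def)
    moreover have "filter (\<lambda>j. (i, j) \<in> diagram k l) [Suc (l i)..<Suc (k - i)] = []"
      by (intro filter_False) (auto simp: diagram_def)
    ultimately show ?thesis by (simp del: upt_Suc)
  qed
  moreover have "map (\<lambda>j. i + j - 1) [1..<Suc m] = [i..<i + m]" for m
    by (induction m) auto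
  ultimately show ?thesis by (simp add: row_word_def rev_filter[symmetric] rev_map[symmetric] del: upt_Suc)
qed

text \<open>The value at \<open>a + l\<close> is compared with its left neighbours one after the
  other. By monotonicity every comparison is an ascent, so it slides all the way to
  \<open>a\<close>.\<close>

lemma foldl_hecke_act_row:
  assumes "\<And>x y. a \<le> x \<Longrightarrow> x < y \<Longrightarrow> y \<le> a + l \<Longrightarrow> u x < u y"
  shows "foldl hecke_act u (rev [a..<a + l]) x =
    (if x = a then u (a + l) else if a < x \<and> x \<le> a + l then u (x - 1) else u x)"
  using assms
proof (induction l arbitrary: u)
  case (Suc l)
  define w where "w = u \<circ> simple_transp (a + l)"
  have w: "w (a + l) = u (Suc (a + l))" "w (Suc (a + l)) = u (a + l)"
    "y \<noteq> a + l \<Longrightarrow> y \<noteq> Suc (a + l) \<Longrightarrow> w y = u y" for y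
    by (simp_all add: w_def)
  have "hecke_act u (a + l) = w"
    using Suc.prems[of "a + l" "Suc (a + l)"] by (simp add: hecke_act_def w_def)
  then have "foldl hecke_act u (rev [a..<a + Suc l]) x = foldl hecke_act w (rev [a..<a + l]) x"
    by simp
  also have "\<dots> = (if x = a then w (a + l) else if a < x \<and> x \<le> a + l then w (x - 1) else w x)"
  proof (rule Suc.IH)
    show "w x < w y" if "a \<le> x" "x < y" "y \<le> a + l" for x y
      using that Suc.prems[of x y] Suc.prems[of x "Suc (a + l)"] w(1) w(3)[of x] w(3)[of y]
      by (cases "y = a + l") auto
  qed
  also have "\<dots> = (if x = a then u (a + Suc l) else if a < x \<and> x \<le> a + Suc l then u (x - 1) else u x)"
    using w(1,2) w(3)[of x] w(3)[of "x - 1"] by (cases "x = Suc (a + l)") auto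
  finally show ?case .
qed simp

text \<open>
  The state after the first \<open>i\<close> rows: a row of length \<open>l\<close> moves the value at position \<open>i + l\<close>
  to position \<open>i\<close>, and the positions that are not yet treated stay increasing.
\<close>

lemma diagram_state:
  assumes l: "partition_rows k l" and "i \<le> k"
  defines "u \<equiv> foldl hecke_act id (rows_word k (diagram k l) 1 (Suc i))"
  shows "u permutes {1..k}"
    and "\<And>x y. i < x \<Longrightarrow> x < y \<Longrightarrow> u x < u y"
    and "\<And>x. 1 \<le> x \<Longrightarrow> x \<le> i \<Longrightarrow> l x < u x"
    and "\<And>x y. 1 \<le> x \<Longrightarrow> x \<le> i \<Longrightarrow> x < y \<Longrightarrow> u y < u x \<Longrightarrow> u y \<le> l x"
proof -
  define U where "U i = foldl hecke_act id (rows_word k (diagram k l) 1 (Suc i))" for i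
  define inv where "inv i w \<longleftrightarrow> w permutes {1..k} \<and> (\<forall>x y. i < x \<and> x < y \<longrightarrow> w x < w y) \<and>
    (\<forall>x. 1 \<le> x \<and> x \<le> i \<longrightarrow> l x < w x) \<and>
    (\<forall>x y. 1 \<le> x \<and> x \<le> i \<and> x < y \<and> w y < w x \<longrightarrow> w y \<le> l x)" for i w
  have "inv i (U i)" using \<open>i \<le> k\<close>
  proof (induction i)
    case 0
    have "U 0 = id" by (simp add: U_def rows_word_def)
    then show ?case by (auto simp: inv_def permutes_id[unfolded id_def])
  next
    case (Suc i)
    define a w where "a = Suc i" and "w = U i"
    have a: "1 \<le> a" "a \<le> k" using Suc.prems by (auto simp: a_def)
    have w: "w permutes {1..k}" and inc: "\<And>x y. a \<le> x \<Longrightarrow> x < y \<Longrightarrow> w x < w y"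
      and avoid: "\<And>x. 1 \<le> x \<Longrightarrow> x < a \<Longrightarrow> l x < w x"
      and greedy: "\<And>x y. 1 \<le> x \<Longrightarrow> x < a \<Longrightarrow> x < y \<Longrightarrow> w y < w x \<Longrightarrow> w y \<le> l x"
      using Suc by (auto simp: inv_def a_def w_def)
    have al: "a + l a \<le> k" by (rule partition_rows_le[OF l a])
    have "U (Suc i) = foldl hecke_act w (row_word k (diagram k l) a)"
      using rows_word_step[of 1 "Suc i" k "diagram k l"] by (simp add: U_def w_def a_def)
    then have U: "U (Suc i) x = (if x = a then w (a + l a) else
        if a < x \<and> x \<le> a + l a then w (x - 1) else w x)" for x
      using foldl_hecke_act_row[of a "l a" w x] inc row_word_diagram[OF l a] by simp
    have "U (Suc i) permutes {1..k}"
      unfolding \<open>U (Suc i) = foldl hecke_act w _\<close> row_word_diagram[OF l a]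
      by (rule foldl_hecke_act_permutes[OF w]) (use a al in auto)
    moreover have "U (Suc i) x < U (Suc i) y" if "a < x" "x < y" for x y
      using that by (auto simp: U intro!: inc)
    \<comment> \<open>The values from position \<open>a\<close> on are positive and strictly
      increasing.\<close>
    moreover have big: "t < w (a + t)" for t
    proof (induction t)
      case 0
      then show ?case using permutes_ge_1[OF w, of a] a by simp
    next
      case (Suc t)
      then show ?case using inc[of "a + t" "a + Suc t"] by simp
    qed
    have "l x < U (Suc i) x" if "1 \<le> x" "x \<le> a" for x
      using that big[of "l a"] avoid[of x] by (auto simp: U)
    \<comment> \<open>The treated rows avoid the values \<open>1, ..., l a\<close>, since row
      lengths do not increase downwards. By monotonicity these values fill the positions just from
      \<open>a\<close> on.\<close>
    moreover have small: "w z \<le> l a" if z: "a \<le> z" "z < a + l a" for z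
    proof (rule ccontr)
      assume "\<not> w z \<le> l a"
      have "w -` {1..l a} \<subseteq> {a..<z}"
      proof
        fix y assume "y \<in> w -` {1..l a}"
        then have y: "1 \<le> y" "w y \<le> l a" using permutes_ge_1[OF w, of y] by auto
        then have "a \<le> y"
          using avoid[of y] partition_rows_antimono[OF l, of y a] a by fastforce
        moreover have "y < z"
          using inc[of z y] y \<open>\<not> w z \<le> l a\<close> z by (cases "y = z"; cases "z < y") auto
        ultimately show "y \<in> {a..<z}" by simp
      qed
      then have "card (w -` {1..l a}) \<le> card {a..<z}" by (rule card_mono[rotated]) simp
      moreover have "card (w -` {1..l a}) = card {1..l a}"
        using permutes_bij[OF w] by (intro card_vimage_inj) (auto simp: bij_def)
      ultimately show False using z by simp
    qed
    have "U (Suc i) y \<le> l x" if xy: "1 \<le> x" "x \<le> a" "x < y" "U (Suc i) y < U (Suc i) x" for x y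
    proof (cases "x = a")
      case True
      then have y: "a < y" "U (Suc i) y < w (a + l a)" using xy by (auto simp: U)
      then have "y \<le> a + l a" using inc[of "a + l a" y] by (cases "y \<le> a + l a") (auto simp: U)
      then have "U (Suc i) y = w (y - 1)" using y by (simp add: U)
      also have "\<dots> \<le> l a" using y \<open>y \<le> a + l a\<close> by (intro small) auto
      finally show ?thesis by (simp add: True)
    next
      case False
      then have x: "x < a" "U (Suc i) x = w x" using xy by (auto simp: U)
      \<comment> \<open>Before this row the value at \<open>y\<close> stood at some position that is
        also to the right of \<open>x\<close>, so the earlier bound applies.\<close>
      obtain y' where y': "U (Suc i) y = w y'" "x < y'"
      proof (cases "y = a")
        case True
        then show ?thesis using x that[of "a + l a"] by (simp add: U)
      next
        case False
        then show ?thesis using x xy that[of "y - 1"] that[of y] by (auto simp: U split: if_splits)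
      qed
      then show ?thesis using greedy[of x y'] x xy by simp
    qed
    ultimately show ?case by (auto simp: inv_def a_def)
  qed
  moreover have "u = U i" by (simp add: u_def U_def)
  ultimately show "u permutes {1..k}"
    and "\<And>x y. i < x \<Longrightarrow> x < y \<Longrightarrow> u x < u y"
    and "\<And>x. 1 \<le> x \<Longrightarrow> x \<le> i \<Longrightarrow> l x < u x"
    and "\<And>x y. 1 \<le> x \<Longrightarrow> x \<le> i \<Longrightarrow> x < y \<Longrightarrow> u y < u x \<Longrightarrow> u y \<le> l x"
    by (auto simp: inv_def)
qed

lemma dominant_diagram:
  assumes l: "partition_rows k l"
  shows "dominant k l (demazure_product (pipe_word (diagram k l)))"
proof -
  have "demazure_product (pipe_word (diagram k l)) =
      foldl hecke_act id (rows_word k (diagram k l) 1 (Suc k))"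
    by (simp add: demazure_product_eq pipe_word_rows[OF diagram_subset_staircase[OF l]])
  note eq = this
  note st = diagram_state[OF l order_refl, folded eq]
  have "demazure_product (pipe_word (diagram k l)) y \<le> l x"
    if xy: "1 \<le> x" "x < y" "demazure_product (pipe_word (diagram k l)) y <
      demazure_product (pipe_word (diagram k l)) x" for x y
  proof (cases "x \<le> k")
    case False
    then show ?thesis using xy st(2)[of x y] by simp
  qed (use xy st(4) in blast)
  then show ?thesis using st(1,3) by (auto simp: dominant_def)
qed

lemma card_initial_step:
  "card {x\<in>{1..Suc a}. f x \<le> b} = card {x\<in>{1..a}. f x \<le> b} + of_bool (f (Suc a) \<le> b)"
proof -
  have "{x\<in>{1..Suc a}. f x \<le> b} =
      (if f (Suc a) \<le> b then insert (Suc a) {x\<in>{1..a}. f x \<le> b} else {x\<in>{1..a}. f x \<le> b})"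
    by (auto simp: le_Suc_eq)
  then show ?thesis by simp
qed

text \<open>This extremal property serves twice: it shows that the diagram determines its dominant
  permutation, and it identifies \<open>v(Hom)\<close>.\<close>

lemma dominant_rank_maximal:
  fixes w :: "nat \<Rightarrow> nat"
  assumes l: "partition_rows k l" and v: "dominant k l v" and w: "w permutes {1..k}"
    and avoid: "\<And>x. x \<in> {1..k} \<Longrightarrow> l x < w x" and "a \<le> k"
  shows "card {x\<in>{1..a}. w x \<le> b} \<le> card {x\<in>{1..a}. v x \<le> b}"
  using \<open>a \<le> k\<close>
proof (induction a)
  case (Suc a)
  let ?A = "Suc a"
  have IH: "card {x\<in>{1..a}. w x \<le> b} \<le> card {x\<in>{1..a}. v x \<le> b}" using Suc by simp
  consider "v ?A \<le> b" | "b \<le> l ?A" | "b < v ?A" "l ?A < b" by linarith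
  then show ?case
  proof cases
    case 1
    then show ?thesis using IH unfolding card_initial_step by simp
  next
    case 2
    have "b < w x" if "x \<in> {1..?A}" for x
      using that avoid[of x] partition_rows_antimono[OF l, of x ?A] Suc.prems 2 by fastforce
    then have "{x\<in>{1..?A}. w x \<le> b} = {}" by force
    then show ?thesis by (metis card.empty le0)
  next
    \<comment> \<open>The rows of \<open>w\<close> up to this one avoid the values up to
      \<open>l ?A\<close>, so they contain at most \<open>b - l ?A\<close> values not exceeding
      \<open>b\<close>. For \<open>v\<close> this number is reached: a value in that range occurring
      later would be inverted with \<open>v ?A\<close> and hence be at most
      \<open>l ?A\<close>.\<close>
    case 3
    have perm: "v permutes {1..k}" using v by (simp add: dominant_def)
    have vim: "card (f -` {l ?A<..b}) = b - l ?A" if "f permutes {1..k}" for f :: "nat \<Rightarrow> nat"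
      using permutes_bij[OF that] by (subst card_vimage_inj) (auto simp: bij_def)
    have "{x\<in>{1..?A}. w x \<le> b} \<subseteq> w -` {l ?A<..b}"
    proof clarsimp
      fix x assume "Suc 0 \<le> x" "x \<le> ?A" "w x \<le> b"
      then show "l ?A < w x"
        using avoid[of x] partition_rows_antimono[OF l, of x ?A] Suc.prems by fastforce
    qed
    moreover have fin: "finite (f -` {l ?A<..b})" if "f permutes {1..k}" for f :: "nat \<Rightarrow> nat"
      using permutes_inj[OF that] by (intro finite_vimageI) auto
    ultimately have "card {x\<in>{1..?A}. w x \<le> b} \<le> b - l ?A"
      using card_mono[OF fin[OF w]] vim[OF w] by metis
    moreover have "v -` {l ?A<..b} \<subseteq> {x\<in>{1..?A}. v x \<le> b}"
    proof
      fix y assume "y \<in> v -` {l ?A<..b}"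
      then have y: "l ?A < v y" "v y \<le> b" by auto
      then have "1 \<le> y" using permutes_ge_1[OF perm, of y] by simp
      moreover have "y \<le> ?A"
      proof (rule ccontr)
        assume "\<not> y \<le> ?A"
        then have "v y \<le> l ?A" using v y 3 unfolding dominant_def by auto
        then show False using y by simp
      qed
      ultimately show "y \<in> {x\<in>{1..?A}. v x \<le> b}" using y by simp
    qed
    then have "b - l ?A \<le> card {x\<in>{1..?A}. v x \<le> b}"
      unfolding vim[OF perm, symmetric] by (rule card_mono[rotated]) simp
    ultimately show ?thesis by simp
  qed
qed simp

text \<open>Maximality in both directions gives equal northwest rank functions, whose row
  differences recover the permutation.\<close>

lemma dominant_unique:
  assumes l: "partition_rows k l" and v: "dominant k l v" and w: "dominant k l w"
  shows "v = w"
proof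
  fix a
  have perm: "v permutes {1..k}" "w permutes {1..k}" using v w by (auto simp: dominant_def)
  have av: "x \<in> {1..k} \<Longrightarrow> l x < v x" "x \<in> {1..k} \<Longrightarrow> l x < w x" for x
    using v w by (auto simp: dominant_def)
  have card_eq: "card {x\<in>{1..a}. w x \<le> b} = card {x\<in>{1..a}. v x \<le> b}" if "a \<le> k" for a b
    using dominant_rank_maximal[OF l v perm(2) av(2) that]
      dominant_rank_maximal[OF l w perm(1) av(1) that] by (rule antisym)
  show "v a = w a"
  proof (cases "a \<in> {1..k}")
    case True
    then obtain a' where a': "a = Suc a'" by (cases a) auto
    have "v a \<le> b \<longleftrightarrow> w a \<le> b" for b
    proof -
      have "(of_bool (v a \<le> b) :: nat) = of_bool (w a \<le> b)"
        using card_eq[of "Suc a'" b] card_eq[of a' b] True unfolding card_initial_step a' by simp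
      then show ?thesis by (simp only: of_bool_eq_iff)
    qed
    from this[of "v a"] this[of "w a"] show ?thesis by simp
  next
    case False
    then show ?thesis using permutes_not_in perm by metis
  qed
qed

lemma row_word_largest:
  assumes "(p, j) \<in> P" and "1 \<le> j" and "p + j \<le> k" and "\<And>j'. j < j' \<Longrightarrow> (p, j') \<notin> P"
  shows "\<exists>w. row_word k P p = (p + j - 1) # w"
proof -
  define m where "m = k - p - j"
  have m: "k - p = j + m" using assms(3) by (simp add: m_def)
  have "rev [1..<Suc (k - p)] = rev [Suc j..<Suc (j + m)] @ [j] @ rev [1..<j]"
    using upt_add_eq_append[of 1 "Suc j" m] assms(2) by (simp add: m)
  moreover have "filter (\<lambda>j. (p, j) \<in> P) (rev [Suc j..<Suc (j + m)]) = []"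
    using assms(4) by (intro filter_False) auto
  ultimately show ?thesis using assms(1) by (simp add: row_word_def del: upt_Suc)
qed

text \<open>
  An additional cross would invert two values that follow a smaller one, which is impossible in
  a dominant permutation.
\<close>

lemma dominant_pipe_dream_unique:
  assumes l: "partition_rows k l" and v: "dominant k l v" and P: "P \<subseteq> staircase k"
    and D: "demazure_product (pipe_word P) = v" and sub: "diagram k l \<subseteq> P"
  shows "P = diagram k l"
proof (rule ccontr)
  assume "P \<noteq> diagram k l"
  then have ex: "\<exists>p. \<exists>j. (p, j) \<in> P - diagram k l" using sub by auto
  \<comment> \<open>In the first row with an extra cross, the rightmost extra cross is read before
    everything else of that row. Up to this cross the word is that of the diagram, whose state is
    known.\<close>
  define p where "p = (LEAST p. \<exists>j. (p, j) \<in> P - diagram k l)"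
  have pj: "\<exists>j. (p, j) \<in> P - diagram k l" unfolding p_def by (rule LeastI_ex[OF ex])
  have min: "(p', j) \<in> P \<longleftrightarrow> (p', j) \<in> diagram k l" if "p' < p" for p' j
    using that not_less_Least[of p' "\<lambda>p. \<exists>j. (p, j) \<in> P - diagram k l"] sub
    unfolding p_def by blast
  define J where "J = {j. (p, j) \<in> P - diagram k l}"
  have J: "J \<noteq> {}" using pj by (simp add: J_def)
  have "finite J"
    by (rule finite_subset[of _ "{0..k}"]) (use P in \<open>auto simp: J_def staircase_def\<close>)
  define j where "j = Max J"
  have "j \<in> J" unfolding j_def using J \<open>finite J\<close> by (rule Max_in[rotated])
  then have jP: "(p, j) \<in> P" "(p, j) \<notin> diagram k l" by (auto simp: J_def)
  then have pk: "1 \<le> p" "1 \<le> j" "p + j \<le> k" using P by (auto simp: staircase_def)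
  then have lj: "l p < j" using jP(2) by (auto simp: diagram_def)
  have "(p, j') \<notin> P" if "j < j'" for j'
  proof
    assume "(p, j') \<in> P"
    then have "j' \<in> J" using that lj by (auto simp: J_def diagram_def)
    then show False using that Max_ge[OF \<open>finite J\<close>, of j'] by (simp add: j_def)
  qed
  then obtain w where w: "row_word k P p = (p + j - 1) # w"
    using row_word_largest jP(1) pk by blast
  define m where "m = p + j - 1"
  obtain i where i: "p = Suc i" using pk(1) by (cases p) auto
  define u where "u = foldl hecke_act id (rows_word k (diagram k l) 1 p)"
  have same: "row_word k P x = row_word k (diagram k l) x" if "x < p" for x
    unfolding row_word_def using min[OF that] by simp
  have "rows_word k P 1 p = rows_word k (diagram k l) 1 p"
    unfolding rows_word_def by (intro arg_cong[where f = concat] map_cong HOL.refl same) auto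
  then have v_eq: "v = foldl hecke_act (hecke_act u m) (w @ rows_word k P (Suc p) (Suc k))"
    using rows_word_split[of 1 p "Suc k" k P] rows_word_split[of p "Suc p" "Suc k" k P] pk
      rows_word_step[of p p k P]
    by (simp add: D[symmetric] demazure_product_eq pipe_word_rows[OF P] u_def m_def w
        rows_word_def[of k P p p])
  have "i \<le> k" using pk i by simp
  note st = diagram_state[OF l this, folded i, folded u_def]
  have inc: "u x < u y" if "p \<le> x" "x < y" for x y using st(2)[of x y] that i by simp
  have big: "t < u (p + t)" for t
  proof (induction t)
    case 0
    then show ?case using permutes_ge_1[OF st(1), of p] pk by simp
  next
    case (Suc t)
    then show ?case using inc[of "p + t" "p + Suc t"] by simp
  qed
  \<comment> \<open>The extra cross brings \<open>b\<close> in front of \<open>a\<close>, and this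
    inversion persists. Both values exceed \<open>l p\<close>.\<close>
  define a b where "a = u m" and "b = u (Suc m)"
  have ab: "a < b" unfolding a_def b_def by (rule inc) (use pk in \<open>auto simp: m_def\<close>)
  have a: "l p < a"
    using big[of "j - 1"] lj pk by (simp add: a_def m_def)
  have "hecke_act u m = u \<circ> simple_transp m" using ab by (simp add: hecke_act_def a_def b_def)
  then have "hecke_act u m m = b" "hecke_act u m (Suc m) = a" by (simp_all add: a_def b_def)
  then have "\<exists>x y. x < y \<and> hecke_act u m x = b \<and> hecke_act u m y = a" by blast
  then have "\<exists>x y. x < y \<and> v x = b \<and> v y = a"
    unfolding v_eq by (rule foldl_hecke_act_inversion[OF ab])
  then obtain x y where xy: "x < y" "v x = b" "v y = a" by blast
  \<comment> \<open>Rows from \<open>p\<close> on do not touch earlier positions, and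
    \<open>b\<close> stood at \<open>m + 1\<close>, to the right of \<open>p\<close>.\<close>
  have "p \<le> x"
  proof (rule ccontr)
    assume "\<not> p \<le> x"
    then have x: "x < p" by simp
    have "set w \<subseteq> set (row_word k P p)" by (auto simp: w)
    then have "v x = hecke_act u m x"
      unfolding v_eq using x by (intro foldl_hecke_act_fixed) (fastforce dest: set_rows_word set_row_word)
    also have "hecke_act u m x = u x"
      using x pk by (auto simp: hecke_act_def m_def)
    finally have "u x = u (Suc m)" using xy by (simp add: b_def)
    then have "x = Suc m" using permutes_inj[OF st(1)] by (meson injD)
    then show False using x pk by (simp add: m_def)
  qed
  \<comment> \<open>This leads to \<open>a = v y <= l x <= l p < a\<close>.\<close>
  have "v y \<le> l x"
    using v xy ab pk \<open>p \<le> x\<close> unfolding dominant_def by auto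
  moreover have "x \<le> k"
  proof (rule ccontr)
    assume "\<not> x \<le> k"
    then have "v x = x" "v y = y" using v xy permutes_not_in[of v "{1..k}"]
      by (auto simp: dominant_def)
    then show False using xy ab by simp
  qed
  ultimately show False
    using partition_rows_antimono[OF l, of p x] pk \<open>p \<le> x\<close> a xy by simp
qed

text \<open>A missing box \<open>(p, q)\<close> would force a value at most \<open>q\<close> into
  one of the rows up to \<open>p\<close>, all of which have \<open>l x >= l p >= q\<close>.\<close>

lemma pipe_dream_contains_diagram:
  assumes l: "partition_rows k l" and v: "v permutes {1..k}" "\<And>x. x \<in> {1..k} \<Longrightarrow> l x < v x"
    and P: "P \<in> pipe_dreams v"
  shows "diagram k l \<subseteq> P"
proof (clarsimp simp: diagram_def)
  fix p q assume pq: "Suc 0 \<le> p" "p \<le> k" "Suc 0 \<le> q" "q \<le> l p"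
  show "(p, q) \<in> P"
  proof (rule ccontr)
    assume "(p, q) \<notin> P"
    moreover have "P \<subseteq> staircase k" "demazure_product (pipe_word P) = v"
      using P v(1) by (auto simp: pipe_dreams_eq)
    ultimately obtain x where x: "x \<le> p" "1 \<le> v x" "v x \<le> q"
      using pipe_dream_missing_box[of P k p q] pq by auto
    then have "1 \<le> x" using permutes_ge_1[OF v(1)] by simp
    then show False
      using v(2)[of x] partition_rows_antimono[OF l, of x p] x pq by fastforce
  qed
qed

lemma pipe_dreams_dominant:
  assumes l: "partition_rows k l" and v: "dominant k l v"
  shows "pipe_dreams v = {diagram k l}"
proof -
  have perm: "v permutes {1..k}" and avoid: "\<And>x. x \<in> {1..k} \<Longrightarrow> l x < v x"
    using v by (auto simp: dominant_def)
  have "demazure_product (pipe_word (diagram k l)) = v"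
    using dominant_unique[OF l dominant_diagram[OF l] v] .
  then have "diagram k l \<in> pipe_dreams v"
    using diagram_subset_staircase[OF l] by (simp add: pipe_dreams_eq[OF perm])
  moreover have "P = diagram k l" if "P \<in> pipe_dreams v" for P
    using that pipe_dream_contains_diagram[OF l perm avoid that]
      dominant_pipe_dream_unique[OF l v] by (simp add: pipe_dreams_eq[OF perm])
  ultimately show ?thesis by blast
qed

text \<open>The map \<open>(x, y)\<close> to \<open>(x, v y)\<close> is the usual bijection from
  inversions to the Rothe diagram.\<close>

lemma perm_length_dominant:
  assumes l: "partition_rows k l" and v: "dominant k l v"
  shows "perm_length v = card (diagram k l)"
proof -
  have perm: "v permutes {1..k}" and avoid: "\<And>x. x \<in> {1..k} \<Longrightarrow> l x < v x"
    and greedy: "\<And>x y. 1 \<le> x \<Longrightarrow> x < y \<Longrightarrow> v y < v x \<Longrightarrow> v y \<le> l x"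
    using v by (auto simp: dominant_def)
  have out: "v x = x" if "x \<notin> {1..k}" for x by (rule permutes_not_in[OF perm that])
  let ?f = "\<lambda>(x, y). (x, v y)"
  have "diagram k l = ?f ` {(x, y). x < y \<and> v y < v x}"
  proof (intro equalityI subsetI)
    fix b assume "b \<in> diagram k l"
    then obtain x q where b: "b = (x, q)" "1 \<le> x" "x \<le> k" "1 \<le> q" "q \<le> l x"
      by (auto simp: diagram_def)
    obtain y where y: "v y = q" using permutes_surj[OF perm] by (metis surjD)
    have "1 \<le> y" using permutes_ge_1[OF perm, of y] b y by simp
    have "x < y"
    proof (rule ccontr)
      assume "\<not> x < y"
      then show False
        using avoid[of y] partition_rows_antimono[OF l, of y x] b y \<open>1 \<le> y\<close> by fastforce
    qed
    moreover have "v y < v x" using avoid[of x] b y by fastforce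
    ultimately have "?f (x, y) \<in> ?f ` {(x, y). x < y \<and> v y < v x}" by blast
    then show "b \<in> ?f ` {(x, y). x < y \<and> v y < v x}" by (simp add: b y)
  next
    fix b assume "b \<in> ?f ` {(x, y). x < y \<and> v y < v x}"
    then obtain x y where b: "b = (x, v y)" "x < y" "v y < v x" by auto
    have "1 \<le> v x" using b by simp
    then have x: "1 \<le> x" using permutes_ge_1[OF perm] by blast
    have "x \<le> k"
      using out[of x] out[of y] b by (cases "x \<le> k") auto
    moreover have "1 \<le> v y" using permutes_ge_1[OF perm, of y] b x by simp
    ultimately show "b \<in> diagram k l" using greedy[OF x b(2,3)] x b by (simp add: diagram_def)
  qed
  moreover have "inj_on ?f {(x, y). x < y \<and> v y < v x}"
    by (rule inj_onI) (auto dest: injD[OF permutes_inj[OF perm]])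
  ultimately show ?thesis by (simp add: perm_length_def card_image)
qed

lemma partition_rows_staircase: "partition_rows k (\<lambda>i. k - i)"
  by (auto simp: partition_rows_def)

lemma diagram_staircase: "diagram k (\<lambda>i. k - i) = staircase k"
  by (auto simp: diagram_def staircase_def)

text \<open>The base case of the recursion for Grothendieck polynomials is thus a dominant case: its
  product over the staircase is the weight of the only pipe dream.\<close>

lemma dominant_longest_perm: "dominant k (\<lambda>i. k - i) (longest_perm k)"
proof -
  have "longest_perm k permutes {1..k}"
  proof (rule bij_imp_permutes)
    show "bij_betw (longest_perm k) {1..k} {1..k}"
      by (rule bij_betw_byWitness[where f' = "longest_perm k"]) (auto simp: longest_perm_def)
  qed (auto simp: longest_perm_def)
  moreover have "longest_perm k y \<le> k - x" if "1 \<le> x" "x < y" "longest_perm k y < longest_perm k x" for x y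
    using that by (auto simp: longest_perm_def split: if_splits)
  ultimately show ?thesis by (auto simp: dominant_def longest_perm_def)
qed

lemmas pipe_dreams_longest_perm =
  pipe_dreams_dominant[OF partition_rows_staircase dominant_longest_perm, unfolded diagram_staircase]

lemmas perm_length_longest_perm =
  perm_length_dominant[OF partition_rows_staircase dominant_longest_perm, unfolded diagram_staircase]

section \<open>Grothendieck polynomials as sums over pipe dreams\<close>

lemma poly_mapping_single_induct:
  assumes "Q 0" and "\<And>p k c. Q p \<Longrightarrow> Q (p + Poly_Mapping.single k c)"
  shows "Q (p :: 'a \<Rightarrow>\<^sub>0 'b::comm_monoid_add)"
proof (induction p rule: Poly_Mapping.update_induct)
  case (update p k c)
  have "Poly_Mapping.update k c p = p + Poly_Mapping.single k c"
    using update(1) by (intro poly_mapping_eqI)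
      (auto simp: lookup_update lookup_add lookup_single when_def in_keys_iff)
  then show ?case using assms(2) update by metis
qed (rule assms(1))

lemma map_key_swap_letters:
  fixes m :: "letter \<Rightarrow>\<^sub>0 int"
  shows "Poly_Mapping.map_key (swap_letters i) (Poly_Mapping.map_key (swap_letters i) m) = m"
    and "Poly_Mapping.map_key (swap_letters i) (m + m') =
      Poly_Mapping.map_key (swap_letters i) m + Poly_Mapping.map_key (swap_letters i) m'"
    and "Poly_Mapping.map_key (swap_letters i) (Poly_Mapping.single a c) =
      Poly_Mapping.single (swap_letters i a) c"
proof -
  have inv: "swap_letters i (swap_letters i b) = b" for b by (simp add: swap_letters_def)
  then have inj: "inj (swap_letters i)" by (metis injI)
  show "Poly_Mapping.map_key (swap_letters i) (Poly_Mapping.map_key (swap_letters i) m) = m"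
    using Poly_Mapping.map_key_compose[OF inj inj, of m] Poly_Mapping.map_key_id[of m]
    by (simp add: o_def inv)
  show "Poly_Mapping.map_key (swap_letters i) (m + m') =
      Poly_Mapping.map_key (swap_letters i) m + Poly_Mapping.map_key (swap_letters i) m'"
    by (rule Poly_Mapping.map_key_plus[OF inj])
  show "Poly_Mapping.map_key (swap_letters i) (Poly_Mapping.single a c) =
      Poly_Mapping.single (swap_letters i a) c"
    using Poly_Mapping.map_key_single[OF inj, of "swap_letters i a" c] by (simp add: inv)
qed

lemma inj_map_key_swap_letters:
  "inj (Poly_Mapping.map_key (swap_letters i) :: (letter \<Rightarrow>\<^sub>0 int) \<Rightarrow> _)"
  using map_key_swap_letters(1) by (metis injI)

lemma swap_vars_add: "swap_vars i (f + g) = swap_vars i f + swap_vars i g"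
  unfolding swap_vars_def by (rule Poly_Mapping.map_key_plus[OF inj_map_key_swap_letters])

lemma swap_vars_0: "swap_vars i 0 = 0"
  unfolding swap_vars_def by (rule Poly_Mapping.map_key_zero[OF inj_map_key_swap_letters])

lemma swap_vars_single:
  "swap_vars i (Poly_Mapping.single m c) =
   Poly_Mapping.single (Poly_Mapping.map_key (swap_letters i) m) c"
  using Poly_Mapping.map_key_single[OF inj_map_key_swap_letters[of i],
      of "Poly_Mapping.map_key (swap_letters i) m" c]
  by (simp add: swap_vars_def map_key_swap_letters(1))

lemma swap_vars_mult: "swap_vars i (f * g) = swap_vars i f * swap_vars i g"
proof (induction f rule: poly_mapping_single_induct)
  case (2 f m c)
  have "swap_vars i (Poly_Mapping.single m c * g) = swap_vars i (Poly_Mapping.single m c) * swap_vars i g"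
  proof (induction g rule: poly_mapping_single_induct)
    case (2 g m' c')
    have "swap_vars i (Poly_Mapping.single m c * Poly_Mapping.single m' c') =
        swap_vars i (Poly_Mapping.single m c) * swap_vars i (Poly_Mapping.single m' c')"
      unfolding Poly_Mapping.mult_single swap_vars_single map_key_swap_letters(2) ..
    then show ?case using 2 by (simp add: distrib_left swap_vars_add)
  qed (simp add: swap_vars_0)
  then show ?case using 2 by (simp add: distrib_right swap_vars_add)
qed (simp add: swap_vars_0)

lemma swap_vars_1: "swap_vars i 1 = 1"
proof -
  have "Poly_Mapping.map_key (swap_letters i) (0 :: letter \<Rightarrow>\<^sub>0 int) = 0"
    using map_key_swap_letters(3)[of i "Z 0" 0] by simp
  then show ?thesis
    using swap_vars_single[of i 0 1] by simp
qed

lemma swap_vars_minus: "swap_vars i (- f) = - swap_vars i f"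
  using swap_vars_add[of i f "- f"] by (simp add: swap_vars_0 eq_neg_iff_add_eq_0 add.commute)

lemma swap_vars_diff: "swap_vars i (f - g) = swap_vars i f - swap_vars i g"
  using swap_vars_add[of i f "- g"] by (simp add: swap_vars_minus)

lemma swap_vars_sum: "swap_vars i (sum f A) = (\<Sum>a\<in>A. swap_vars i (f a))"
  by (induction A rule: infinite_finite_induct) (simp_all add: swap_vars_0 swap_vars_add)

lemma swap_vars_prod: "swap_vars i (prod f A) = (\<Prod>a\<in>A. swap_vars i (f a))"
  by (induction A rule: infinite_finite_induct) (simp_all add: swap_vars_1 swap_vars_mult)

lemma swap_vars_ratio: "swap_vars i (ratio a b) = ratio (swap_letters i a) (swap_letters i b)"
proof -
  let ?\<phi> = "Poly_Mapping.map_key (swap_letters i) :: (letter \<Rightarrow>\<^sub>0 int) \<Rightarrow> _"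
  have "?\<phi> (m - m') + ?\<phi> m' = ?\<phi> m" for m m'
    using map_key_swap_letters(2)[of i "m - m'" m'] by simp
  then have "?\<phi> (m - m') = ?\<phi> m - ?\<phi> m'" for m m' by (metis eq_diff_eq)
  then show ?thesis by (simp add: ratio_def swap_vars_single map_key_swap_letters(3))
qed

lemma ratio_mult: "ratio a b * ratio b c = ratio a c"
  by (simp add: ratio_def Poly_Mapping.mult_single)

lemma var_inject: "var a = var b \<longleftrightarrow> a = b"
proof
  assume "var a = var b"
  then have "Poly_Mapping.keys (var a) = Poly_Mapping.keys (var b)" by simp
  then have "Poly_Mapping.single a (1 :: int) = Poly_Mapping.single b 1" by (simp add: var_def)
  then have "Poly_Mapping.keys (Poly_Mapping.single a (1 :: int)) =
      Poly_Mapping.keys (Poly_Mapping.single b (1 :: int))" by simp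
  then show "a = b" by simp
qed simp

text \<open>Labellings are arbitrary functions, so that exchanging variables becomes composition
  with a transposition of positions.\<close>

definition letter_coeff ::
    "nat \<Rightarrow> (nat \<Rightarrow> letter) \<Rightarrow> (nat \<Rightarrow> letter) \<Rightarrow> (nat \<Rightarrow> nat) \<Rightarrow> laurent" where
  "letter_coeff k \<xi> \<eta> = staircase_coeff k (\<lambda>i j. ratio (\<xi> i) (\<eta> j))"

lemma letter_coeff_row_swap:
  assumes "1 \<le> i" and "i < k"
  shows "letter_coeff k \<xi> \<eta> =
    hecke_factor i (ratio (\<xi> i) (\<xi> (Suc i))) (letter_coeff k (\<xi> \<circ> simple_transp i) \<eta>)"
  unfolding letter_coeff_def o_def
  by (rule staircase_coeff_row_swap[OF assms]) (simp add: ratio_mult)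

lemma letter_coeff_row_symmetric:
  "1 \<le> i \<Longrightarrow> i < k \<Longrightarrow> v i < v (Suc i) \<Longrightarrow>
   letter_coeff k (\<xi> \<circ> simple_transp i) \<eta> v = letter_coeff k \<xi> \<eta> v"
  using letter_coeff_row_swap[of i k \<xi> \<eta>] by (simp add: hecke_factor_def)

lemma letter_coeff_column_symmetric:
  assumes "1 \<le> q" and "q < k" and "\<exists>a b. a < b \<and> v a = q \<and> v b = Suc q"
  shows "letter_coeff k \<xi> (\<eta> \<circ> simple_transp q) v = letter_coeff k \<xi> \<eta> v"
  unfolding letter_coeff_def o_def
  using staircase_coeff_column_swap[of q k "\<lambda>i j. ratio (\<xi> i) (\<eta> j)" "ratio (\<eta> q) (\<eta> (Suc q))" v] assms
  by (simp add: ratio_mult mult.commute)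

lemma swap_vars_letter_coeff:
  "swap_vars i (letter_coeff k Z Y v) = letter_coeff k (Z \<circ> simple_transp i) Y v"
proof -
  have "swap_letters i (Z p) = Z (simple_transp i p)" "swap_letters i (Y q) = Y q" for p q
    by (auto simp: swap_letters_def simple_transp_def transpose_def)
  moreover have "swap_vars i (of_bool c * f) = of_bool c * swap_vars i f" for c f
    by (cases c) (simp_all add: swap_vars_0)
  ultimately show ?thesis
    unfolding letter_coeff_def staircase_coeff_eq swap_vars_sum
    by (simp add: swap_vars_prod swap_vars_diff swap_vars_1 swap_vars_ratio case_prod_unfold)
qed

definition pipe_sum :: "(nat \<Rightarrow> letter) \<Rightarrow> (nat \<Rightarrow> letter) \<Rightarrow> (nat \<Rightarrow> nat) \<Rightarrow> laurent" where
  "pipe_sum \<xi> \<eta> v = (\<Sum>P\<in>pipe_dreams v.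
     (- 1) ^ (card P - perm_length v) * (\<Prod>(i, j)\<in>P. 1 - ratio (\<xi> i) (\<eta> j)))"

lemma letter_coeff_pipe_sum:
  assumes v: "v permutes {1..k}"
  shows "letter_coeff k \<xi> \<eta> v = (- 1) ^ perm_length v * pipe_sum \<xi> \<eta> v"
proof -
  have "(\<Prod>(i, j)\<in>P. ratio (\<xi> i) (\<eta> j) - 1) = (- 1) ^ perm_length v *
      ((- 1) ^ (card P - perm_length v) * (\<Prod>(i, j)\<in>P. 1 - ratio (\<xi> i) (\<eta> j)))"
    if P: "P \<in> pipe_dreams v" for P
  proof -
    have "(\<Prod>(i, j)\<in>P. ratio (\<xi> i) (\<eta> j) - 1) = (\<Prod>(i, j)\<in>P. (- 1) * (1 - ratio (\<xi> i) (\<eta> j)))"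
      by (intro prod.cong) auto
    also have "\<dots> = (- 1) ^ card P * (\<Prod>(i, j)\<in>P. 1 - ratio (\<xi> i) (\<eta> j))"
      unfolding case_prod_unfold by (simp only: prod.distrib prod_constant)
    also have "(- 1 :: laurent) ^ card P = (- 1) ^ perm_length v * (- 1) ^ (card P - perm_length v)"
      using perm_length_le_card_pipe_dream[OF v P] by (simp add: power_add[symmetric])
    finally show ?thesis by (simp add: mult.assoc)
  qed
  then show ?thesis
    unfolding letter_coeff_def staircase_coeff_pipe_dreams[OF v] pipe_sum_def sum_distrib_left
    by (intro sum.cong) auto
qed

text \<open>Let \<open>C\<close> and \<open>C'\<close> be the coefficients before and after
  exchanging \<open>z_i\<close> and \<open>z_(i+1)\<close>, and \<open>t = z_i / z_(i+1)\<close>. At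
  the descent the row exchange reads \<open>C v = t C' v + (t - 1) C' (v s_i)\<close>. Since
  \<open>v s_i\<close> ascends at \<open>i\<close>, its coefficient is symmetric and
  \<open>C'\<close> becomes \<open>C\<close> there. Multiplying by \<open>z_(i+1)\<close> gives the
  defining equation of the operator; the signs arise from the parity of the lengths.\<close>

lemma demazure_op_pipe_sum:
  assumes v: "v permutes {1..k}" and i: "1 \<le> i" "i < k" and desc: "v (Suc i) < v i"
  shows "demazure_op i (pipe_sum Z Y v) = pipe_sum Z Y (v \<circ> simple_transp i)"
proof -
  let ?w = "v \<circ> simple_transp i" and ?z = "var (Z i)" and ?z' = "var (Z (Suc i))"
  let ?e = "(- 1) ^ perm_length ?w :: laurent"
  let ?C = "letter_coeff k Z Y" and ?C' = "letter_coeff k (Z \<circ> simple_transp i) Y"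
  define t where "t = ratio (Z i) (Z (Suc i))"
  have w: "?w permutes {1..k}" using v i by (simp add: permutes_compose simple_transp_permutes)
  have len: "perm_length v = Suc (perm_length ?w)"
    by (rule perm_length_descent[OF finitary_permutes[OF v] desc])
  have Cv: "?C v = - ?e * pipe_sum Z Y v" "?C ?w = ?e * pipe_sum Z Y ?w"
    by (simp_all add: letter_coeff_pipe_sum[OF v] letter_coeff_pipe_sum[OF w] len)
  have e: "swap_vars i ((- 1) ^ m) = (- 1) ^ m" for m
    by (induction m) (simp_all add: swap_vars_1 swap_vars_minus)
  have C'v: "?C' v = - ?e * swap_vars i (pipe_sum Z Y v)"
    unfolding swap_vars_letter_coeff[symmetric] Cv by (simp add: swap_vars_mult swap_vars_minus e)
  have "?C' ?w = ?C ?w" using i desc by (intro letter_coeff_row_symmetric) auto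
  then have Ct: "?C v = t * ?C' v + (t - 1) * ?C ?w"
    using letter_coeff_row_swap[OF i, of Z Y] desc by (simp add: hecke_factor_def t_def)
  have "?z' * ?C v = (t * ?z') * ?C' v + (t * ?z' - ?z') * ?C ?w"
    unfolding Ct by (simp add: algebra_simps)
  also have "t * ?z' = ?z" by (simp add: t_def ratio_times_var)
  finally have "?z' * ?C v = ?z * ?C' v + (?z - ?z') * ?C ?w" .
  then have "?e * ((?z' - ?z) * pipe_sum Z Y ?w) =
      ?e * (?z' * pipe_sum Z Y v - ?z * swap_vars i (pipe_sum Z Y v))"
    unfolding Cv C'v by (simp add: algebra_simps)
  then have eq: "(?z' - ?z) * pipe_sum Z Y ?w = ?z' * pipe_sum Z Y v - ?z * swap_vars i (pipe_sum Z Y v)"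
    by simp
  \<comment> \<open>Cancelling in an integral domain makes the described quotient unique.\<close>
  have "?z' - ?z \<noteq> 0" by (simp add: var_inject)
  then show ?thesis
    unfolding demazure_op_def using eq by (intro the_equality) (simp, metis mult_left_cancel)
qed

lemma pipe_sum_longest_perm:
  "pipe_sum Z Y (longest_perm k) =
   (\<Prod>(i, j) \<in> {(i, j). 1 \<le> i \<and> 1 \<le> j \<and> i + j \<le> k}. 1 - ratio (Z i) (Y j))"
  by (simp add: pipe_sum_def pipe_dreams_longest_perm perm_length_longest_perm)
    (simp add: staircase_def)

lemma descent_of_perm_length_less:
  assumes "finitary v" and "perm_length (v \<circ> simple_transp i) < perm_length v"
  shows "v (Suc i) < v i"
  using finitary_cases[OF assms(1), of i] perm_length_ascent[OF assms(1), of i] assms(2) by fastforce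

lemma grothendieck_rel_pipe_sum:
  "grothendieck_rel k v g \<Longrightarrow> v permutes {1..k} \<and> g = pipe_sum Z Y v"
proof (induction rule: grothendieck_rel.induct)
  case longest
  then show ?case using dominant_longest_perm pipe_sum_longest_perm by (simp add: dominant_def)
next
  case (descend v g i)
  then have v: "v permutes {1..k}" and desc: "v (Suc i) < v i"
    using descent_of_perm_length_less[OF finitary_permutes] by auto
  have "v \<circ> simple_transp i permutes {1..k}"
    using v descend by (intro permutes_compose simple_transp_permutes) auto
  moreover have "demazure_op i g = pipe_sum Z Y (v \<circ> simple_transp i)"
    using demazure_op_pipe_sum[OF v _ _ desc] descend by blast
  ultimately show ?case by blast
qed

section \<open>Existence and uniqueness of Grothendieck polynomials\<close>

lemma perm_length_bound:
  assumes "v permutes {1..k}"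
  shows "perm_length v \<le> k * k"
proof -
  have "{(i, j). i < j \<and> v j < v i} \<subseteq> {1..k} \<times> {1..k}"
  proof clarify
    fix i j assume h: "i < j" "v j < v i"
    have fix_out: "v x = x" if "x \<notin> {1..k}" for x using that permutes_not_in[OF assms] by blast
    have in_k: "v x \<in> {1..k}" if "x \<in> {1..k}" for x using that permutes_in_image[OF assms] by blast
    have "i \<in> {1..k}"
    proof (rule ccontr)
      assume "i \<notin> {1..k}"
      then show False using h fix_out[of i] fix_out[of j] in_k[of j] by (cases "j \<in> {1..k}") auto
    qed
    moreover have "j \<in> {1..k}"
    proof (rule ccontr)
      assume "j \<notin> {1..k}"
      then show False using h fix_out[of j] in_k[of i] calculation by auto
    qed
    ultimately show "i \<in> {1..k} \<and> j \<in> {1..k}" by blast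
  qed
  then have "card {(i, j). i < j \<and> v j < v i} \<le> card ({1..k} \<times> {1..k})"
    by (rule card_mono[rotated]) simp
  then show ?thesis by (simp add: perm_length_def)
qed

lemma no_ascent_longest_perm:
  assumes v: "v permutes {1..k}" and desc: "\<And>i. 1 \<le> i \<Longrightarrow> i < k \<Longrightarrow> v (Suc i) < v i"
  shows "v = longest_perm k"
proof -
  have le: "v i \<le> k + 1 - i" if "i \<in> {1..k}" for i
    using that
  proof (induction i)
    case (Suc i)
    then show ?case
      using desc[of i] permutes_in_image[OF v, of "Suc i"] by (cases "i = 0") auto
  qed simp
  have ge: "k + 1 - i \<le> v i" if "i \<in> {1..k}" for i
    using that
  proof (induction "k - i" arbitrary: i)
    case 0
    then show ?case using permutes_in_image[OF v, of i] by auto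
  next
    case (Suc x)
    then have "k + 1 - Suc i \<le> v (Suc i)" by (intro Suc.hyps(1)) auto
    moreover have "i < k" using Suc.hyps(2) by simp
    ultimately show ?case using desc[of i] Suc.prems by simp
  qed
  show ?thesis
  proof
    fix i
    show "v i = longest_perm k i"
    proof (cases "i \<in> {1..k}")
      case True
      then show ?thesis using le[of i] ge[of i] by (simp add: longest_perm_def)
    next
      case False
      then show ?thesis using permutes_not_in[OF v False] by (auto simp: longest_perm_def)
    qed
  qed
qed

text \<open>Climbs from \<open>v\<close> along ascents until the longest permutation is reached. The
  crude bound \<open>k * k\<close> on lengths provides the termination measure.\<close>

lemma ex_grothendieck_rel:
  assumes "v permutes {1..k}"
  shows "\<exists>g. grothendieck_rel k v g"
  using assms
proof (induction "k * k - perm_length v" arbitrary: v rule: less_induct)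
  case less
  show ?case
  proof (cases "\<forall>i. 1 \<le> i \<and> i < k \<longrightarrow> v (Suc i) < v i")
    case True
    then have "v = longest_perm k" using no_ascent_longest_perm[OF less.prems] by blast
    then show ?thesis using grothendieck_rel.longest by blast
  next
    case False
    then obtain i where i: "1 \<le> i" "i < k" "\<not> v (Suc i) < v i" by blast
    have fin: "finitary v" by (rule finitary_permutes[OF less.prems])
    let ?w = "v \<circ> simple_transp i"
    have "v i < v (Suc i)" using finitary_cases[OF fin, of i] i(3) by blast
    then have len: "perm_length ?w = Suc (perm_length v)" by (rule perm_length_ascent[OF fin])
    have w: "?w permutes {1..k}"
      using less.prems i by (simp add: permutes_compose simple_transp_permutes)
    have "k * k - perm_length ?w < k * k - perm_length v"
      using perm_length_bound[OF w] len by simp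
    from less.hyps[OF this w] obtain g where "grothendieck_rel k ?w g" by blast
    from grothendieck_rel.descend[OF this i(1,2)] len show ?thesis by auto
  qed
qed

text \<open>Every derivation yields the same sum, whatever descents it uses and whatever
  \<open>k\<close> is, so the description is well defined and stable in \<open>k\<close>.\<close>

lemma grothendieck_pipe_sum:
  assumes "v permutes {1..k}"
  shows "grothendieck v = pipe_sum Z Y v"
  unfolding grothendieck_def
  using ex_grothendieck_rel[OF assms] grothendieck_rel_pipe_sum
  by (intro the_equality) (metis, blast)

section \<open>Symmetry within the blocks\<close>

text \<open>A permutation that preserves classes is a product of transpositions within classes:
  composing with the transposition of \<open>a\<close> and \<open>\<sigma> a\<close> fixes
  \<open>a\<close> and stays within its class.\<close>

lemma class_preserving_permutes_induct:
  assumes "finite S" and "\<sigma> permutes S" and "\<And>p. c (\<sigma> p) = c p"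
    and "G id" and "\<And>\<tau> a b. G \<tau> \<Longrightarrow> a \<in> S \<Longrightarrow> b \<in> S \<Longrightarrow> c a = c b \<Longrightarrow> G (transpose a b \<circ> \<tau>)"
  shows "G \<sigma>"
  using assms(1,2,3,5)
proof (induction S arbitrary: \<sigma> rule: finite_induct)
  case empty
  then have "\<sigma> = id" by simp
  then show ?case using assms(4) by metis
next
  case (insert a S)
  let ?\<tau> = "transpose a (\<sigma> a) \<circ> \<sigma>"
  have "?\<tau> permutes S" using insert.prems(1) by (rule permutes_insert_lemma)
  moreover have "c (?\<tau> p) = c p" for p
    using insert.prems(2)[of p] insert.prems(2)[of a] by (auto simp: transpose_def)
  ultimately have G: "G ?\<tau>" using insert.IH insert.prems(3) by blast
  have "\<sigma> a \<in> insert a S" using permutes_in_image[OF insert.prems(1)] by blast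
  then have "G (transpose a (\<sigma> a) \<circ> ?\<tau>)"
    using insert.prems(2)[of a] by (intro insert.prems(3)[OF G]) simp_all
  moreover have "transpose a (\<sigma> a) \<circ> ?\<tau> = \<sigma>" by (simp add: o_assoc)
  ultimately show ?case by simp
qed

text \<open>The transposition of \<open>a\<close> and \<open>b + 1\<close> is that of
  \<open>a\<close> and \<open>b\<close> conjugated by \<open>s_b\<close>.\<close>

lemma transpose_invariant:
  assumes "\<And>i \<xi>. a \<le> i \<Longrightarrow> i < b \<Longrightarrow> F (\<xi> \<circ> simple_transp i) = F \<xi>" and "a \<le> b"
  shows "F (\<xi> \<circ> transpose a b) = F \<xi>"
  using assms(2,1)
proof (induction b arbitrary: \<xi> rule: dec_induct)
  case (step b)
  show ?case
  proof (cases "a = b")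
    case True
    then show ?thesis using step.prems[of b \<xi>] by (simp add: simple_transp_def)
  next
    case False
    have "transpose a (Suc b) = simple_transp b \<circ> transpose a b \<circ> simple_transp b"
    proof
      fix p show "transpose a (Suc b) p = (simple_transp b \<circ> transpose a b \<circ> simple_transp b) p"
        using step.hyps False by (auto simp: transpose_def simple_transp_def)
    qed
    then have "F (\<xi> \<circ> transpose a (Suc b)) = F (\<xi> \<circ> simple_transp b \<circ> transpose a b \<circ> simple_transp b)"
      by (simp only: o_assoc)
    also have "\<dots> = F (\<xi> \<circ> simple_transp b \<circ> transpose a b)"
      by (rule step.prems) (use step.hyps in auto)
    also have "\<dots> = F (\<xi> \<circ> simple_transp b)"
      by (rule step.IH) (use step.prems in auto)
    also have "\<dots> = F \<xi>"
      by (rule step.prems) (use step.hyps in auto)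
    finally show ?thesis .
  qed
qed simp

section \<open>Geometry of the blocks\<close>

lemma row_offset_Suc: "row_offset r (Suc j) = row_offset r j + r j"
  by (simp add: row_offset_def)

lemma row_offset_mono: "j \<le> j' \<Longrightarrow> row_offset r j \<le> row_offset r j'"
  unfolding row_offset_def by (rule sum_mono2) auto

lemma total_dim_row_offset: "total_dim n r = row_offset r (Suc n)"
  by (simp add: total_dim_def row_offset_def lessThan_Suc_atMost)

lemma mem_block_row: "p \<in> block_row r j \<longleftrightarrow> row_offset r j < p \<and> p \<le> row_offset r (Suc j)"
  by (auto simp: block_row_def row_offset_Suc)

text \<open>The least index passes over empty blocks, whose right end coincides with that of the
  preceding block.\<close>

definition block_of :: "(nat \<Rightarrow> nat) \<Rightarrow> nat \<Rightarrow> nat" where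
  "block_of r p = (LEAST j. p \<le> row_offset r (Suc j))"

lemma block_of_eq: "p \<in> block_row r j \<Longrightarrow> block_of r p = j"
  unfolding block_of_def
proof (rule Least_equality)
  fix j' assume "p \<in> block_row r j" "p \<le> row_offset r (Suc j')"
  then show "j \<le> j'"
    using row_offset_mono[of "Suc j'" j r] by (cases "j \<le> j'") (auto simp: mem_block_row)
qed (simp add: mem_block_row)

lemma ex_block_row: "p \<in> {1..total_dim n r} \<Longrightarrow> \<exists>j\<le>n. p \<in> block_row r j"
proof (induction n)
  case 0
  then show ?case by (auto simp: mem_block_row total_dim_row_offset row_offset_def)
next
  case (Suc n)
  show ?case
  proof (cases "p \<le> total_dim n r")
    case True
    then show ?thesis using Suc by (auto intro: le_SucI)
  next
    case False
    then have "p \<in> block_row r (Suc n)"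
      using Suc.prems by (simp add: mem_block_row total_dim_row_offset)
    then show ?thesis by blast
  qed
qed

lemma block_row_subset: "j \<le> n \<Longrightarrow> block_row r j \<subseteq> {1..total_dim n r}"
  using row_offset_mono[of "Suc j" "Suc n" r] by (auto simp: mem_block_row total_dim_row_offset)

text \<open>The longest element of the Young subgroup given by the block sizes.\<close>

definition reverse_blocks :: "nat \<Rightarrow> (nat \<Rightarrow> nat) \<Rightarrow> nat \<Rightarrow> nat" where
  "reverse_blocks n r p = (if p \<in> {1..total_dim n r}
     then row_offset r (block_of r p) + row_offset r (Suc (block_of r p)) + 1 - p else p)"

lemma reverse_blocks_block:
  assumes "j \<le> n" and "p \<in> block_row r j"
  shows "reverse_blocks n r p = row_offset r j + row_offset r (Suc j) + 1 - p"
    and "reverse_blocks n r p \<in> block_row r j"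
proof -
  show eq: "reverse_blocks n r p = row_offset r j + row_offset r (Suc j) + 1 - p"
  proof -
    have "p \<in> {1..total_dim n r}" using block_row_subset[OF assms(1)] assms(2) by blast
    then show ?thesis by (simp only: reverse_blocks_def block_of_eq[OF assms(2)] if_True)
  qed
  show "reverse_blocks n r p \<in> block_row r j"
    unfolding eq using assms(2) by (auto simp: mem_block_row)
qed

lemma block_of_reverse_blocks: "block_of r (reverse_blocks n r p) = block_of r p"
proof (cases "p \<in> {1..total_dim n r}")
  case True
  then obtain j where j: "j \<le> n" "p \<in> block_row r j" using ex_block_row by blast
  then show ?thesis using reverse_blocks_block(2)[OF j] block_of_eq by metis
next
  case False
  then show ?thesis unfolding reverse_blocks_def by metis
qed

lemma reverse_blocks_permutes: "reverse_blocks n r permutes {1..total_dim n r}"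
proof (rule bij_imp_permutes)
  have "reverse_blocks n r p \<in> {1..total_dim n r} \<and> reverse_blocks n r (reverse_blocks n r p) = p"
    if p: "p \<in> {1..total_dim n r}" for p
  proof -
    obtain j where j: "j \<le> n" "p \<in> block_row r j" using ex_block_row[OF p] by blast
    note rev = reverse_blocks_block[OF j]
    have "reverse_blocks n r (reverse_blocks n r p) = p"
      using reverse_blocks_block(1)[OF j(1) rev(2)] rev(1) j(2) by (simp add: mem_block_row)
    then show ?thesis using rev(2) block_row_subset[OF j(1)] by blast
  qed
  then show "bij_betw (reverse_blocks n r) {1..total_dim n r} {1..total_dim n r}"
    by (intro bij_betw_byWitness[where f' = "reverse_blocks n r"]) auto
qed (auto simp: reverse_blocks_def)

lemma reverse_blocks_invariant:
  assumes "\<And>i j \<xi>. j \<le> n \<Longrightarrow> i \<in> block_row r j \<Longrightarrow> Suc i \<in> block_row r j \<Longrightarrow>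
    F (\<xi> \<circ> simple_transp i) = F \<xi>"
  shows "F (\<xi> \<circ> reverse_blocks n r) = F \<xi>"
proof -
  have le: "F (\<xi> \<circ> transpose a b) = F \<xi>"
    if ab: "a \<in> {1..total_dim n r}" "b \<in> {1..total_dim n r}" "block_of r a = block_of r b" "a \<le> b"
    for a b and \<xi> :: "nat \<Rightarrow> 'a"
  proof -
    obtain j where j: "j \<le> n" "a \<in> block_row r j" using ex_block_row[OF ab(1)] by blast
    obtain j' where j': "j' \<le> n" "b \<in> block_row r j'" using ex_block_row[OF ab(2)] by blast
    have "j' = j" using block_of_eq[OF j(2)] block_of_eq[OF j'(2)] ab(3) by simp
    then have "i \<in> block_row r j \<and> Suc i \<in> block_row r j" if "a \<le> i" "i < b" for i
      using that j(2) j'(2) by (auto simp: mem_block_row)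
    then show ?thesis by (intro transpose_invariant assms[OF j(1)] ab(4)) blast+
  qed
  have sym: "F (\<xi> \<circ> transpose a b) = F \<xi>"
    if "a \<in> {1..total_dim n r}" "b \<in> {1..total_dim n r}" "block_of r a = block_of r b"
    for a b and \<xi> :: "nat \<Rightarrow> 'a"
    using le[of a b \<xi>] le[of b a \<xi>] that by (cases "a \<le> b") (auto simp: transpose_commute)
  have "\<forall>\<xi>. F (\<xi> \<circ> reverse_blocks n r) = F \<xi>"
  proof (rule class_preserving_permutes_induct[where c = "block_of r"
        and G = "\<lambda>\<sigma>. \<forall>\<xi>. F (\<xi> \<circ> \<sigma>) = F \<xi>", OF _ reverse_blocks_permutes[of n r]])
    show "block_of r (reverse_blocks n r p) = block_of r p" for p
      by (rule block_of_reverse_blocks)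
    show "\<forall>\<xi>. F (\<xi> \<circ> (transpose a b \<circ> \<tau>)) = F \<xi>"
      if "\<forall>\<xi>. F (\<xi> \<circ> \<tau>) = F \<xi>" "a \<in> {1..total_dim n r}" "b \<in> {1..total_dim n r}"
        "block_of r a = block_of r b" for \<tau> a b
      using that sym by (simp add: o_assoc)
  qed auto
  then show ?thesis by blast
qed

text \<open>Block columns, counted from the right, are block rows for the reversed block sizes.\<close>

lemma col_offset_row_offset: "i \<le> n \<Longrightarrow> col_offset n r i = row_offset (\<lambda>m. r (n - m)) (n - i)"
  unfolding col_offset_def row_offset_def
  by (rule sum.reindex_bij_witness[where i = "\<lambda>m. n - m" and j = "\<lambda>m. n - m"]) auto

lemma total_dim_reverse: "total_dim n (\<lambda>m. r (n - m)) = total_dim n r"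
  unfolding total_dim_def
  by (rule sum.reindex_bij_witness[where i = "\<lambda>m. n - m" and j = "\<lambda>m. n - m"]) auto

lemma block_col_block_row: "i \<le> n \<Longrightarrow> block_col n r i = block_row (\<lambda>m. r (n - m)) (n - i)"
  by (simp add: block_col_def block_row_def col_offset_row_offset)

lemma ex_block_col: "q \<in> {1..total_dim n r} \<Longrightarrow> \<exists>i\<le>n. q \<in> block_col n r i"
proof -
  assume "q \<in> {1..total_dim n r}"
  then obtain j where "j \<le> n" "q \<in> block_row (\<lambda>m. r (n - m)) j"
    using ex_block_row[of q n "\<lambda>m. r (n - m)"] total_dim_reverse[of n r] by auto
  then show ?thesis using block_col_block_row[of "n - j" n r] by (intro exI[of _ "n - j"]) auto
qed

lemma block_col_subset: "i \<le> n \<Longrightarrow> block_col n r i \<subseteq> {1..total_dim n r}"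
  using block_row_subset[of "n - i" n "\<lambda>m. r (n - m)"]
  by (simp add: block_col_block_row total_dim_reverse)

lemma row_label_eq:
  assumes "p \<in> {1..total_dim n r}"
  shows "row_label n r p = Z (reverse_blocks n r p)"
proof -
  obtain j where j: "j \<le> n" "p \<in> block_row r j" using ex_block_row[OF assms] by blast
  note rev = reverse_blocks_block(1)[OF j]
  show ?thesis
    unfolding row_label_def
  proof (rule the_equality)
    have "p = row_offset r j + (p - row_offset r j)" "p - row_offset r j \<in> {1..r j}"
      using j(2) by (auto simp: mem_block_row row_offset_Suc)
    moreover have "Z (reverse_blocks n r p) = x_letter r j (r j + 1 - (p - row_offset r j))"
      using j(2) by (simp add: rev x_letter_def mem_block_row row_offset_Suc)
    ultimately show "\<exists>j\<le>n. \<exists>a\<in>{1..r j}. p = row_offset r j + a \<and>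
        Z (reverse_blocks n r p) = x_letter r j (r j + 1 - a)"
      using j(1) by blast
  next
    fix t assume "\<exists>j\<le>n. \<exists>a\<in>{1..r j}. p = row_offset r j + a \<and> t = x_letter r j (r j + 1 - a)"
    then obtain j' a where a: "a \<in> {1..r j'}" "p = row_offset r j' + a" "t = x_letter r j' (r j' + 1 - a)"
      by blast
    then have "p \<in> block_row r j'" by (simp add: block_row_def)
    then have "j' = j" using block_of_eq j(2) by metis
    then show "t = Z (reverse_blocks n r p)"
      unfolding a(3) rev x_letter_def using a(1,2) by (simp add: row_offset_Suc)
  qed
qed

lemma col_label_eq:
  assumes "q \<in> {1..total_dim n r}"
  shows "col_label n r q = Y (reverse_blocks n (\<lambda>m. r (n - m)) q)"
proof -
  let ?r = "\<lambda>m. r (n - m)"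
  obtain i where i: "i \<le> n" "q \<in> block_col n r i" using ex_block_col[OF assms] by blast
  then have row: "q \<in> block_row ?r (n - i)" by (simp add: block_col_block_row)
  have rev: "reverse_blocks n ?r q = col_offset n r i + (col_offset n r i + r i) + 1 - q"
    using reverse_blocks_block(1)[OF _ row, of n] i(1) by (simp add: col_offset_row_offset row_offset_Suc)
  show ?thesis
    unfolding col_label_def
  proof (rule the_equality)
    have "q = col_offset n r i + (q - col_offset n r i)" "q - col_offset n r i \<in> {1..r i}"
      using i(2) by (auto simp: block_col_def)
    moreover have "Y (reverse_blocks n ?r q) = y_letter n r i (r i + 1 - (q - col_offset n r i))"
      using i(2) by (simp add: rev y_letter_def block_col_def)
    ultimately show "\<exists>i\<le>n. \<exists>b\<in>{1..r i}. q = col_offset n r i + b \<and>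
        Y (reverse_blocks n ?r q) = y_letter n r i (r i + 1 - b)"
      using i(1) by blast
  next
    fix t assume "\<exists>i\<le>n. \<exists>b\<in>{1..r i}. q = col_offset n r i + b \<and> t = y_letter n r i (r i + 1 - b)"
    then obtain i' b where b: "i' \<le> n" "b \<in> {1..r i'}" "q = col_offset n r i' + b"
      "t = y_letter n r i' (r i' + 1 - b)" by blast
    then have "q \<in> block_col n r i'" by (simp add: block_col_def)
    then have "q \<in> block_row ?r (n - i')" using b(1) by (simp add: block_col_block_row)
    then have "n - i' = n - i" using block_of_eq row by metis
    then have "i' = i" using b(1) i(1) by simp
    then show "t = Y (reverse_blocks n ?r q)"
      unfolding b(4) rev y_letter_def using b(2,3) by simp
  qed
qed

text \<open>The row and column labels are definite descriptions known only inside the grid; the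
  staircase involves no other positions.\<close>

lemma letter_coeff_cong:
  assumes "\<And>p. p \<in> {1..k} \<Longrightarrow> \<xi> p = \<xi>' p" and "\<And>q. q \<in> {1..k} \<Longrightarrow> \<eta> q = \<eta>' q"
  shows "letter_coeff k \<xi> \<eta> = letter_coeff k \<xi>' \<eta>'"
proof -
  have "staircase_factors k (\<lambda>i j. ratio (\<xi> i) (\<eta> j)) 1 = staircase_factors k (\<lambda>i j. ratio (\<xi>' i) (\<eta>' j)) 1"
    using assms by (intro staircase_factors_cong) auto
  then show ?thesis unfolding letter_coeff_def staircase_coeff_def by metis
qed

lemma zelevinsky_permutes: "zelevinsky n r v \<Longrightarrow> v permutes {1..total_dim n r}"
  by (simp add: zelevinsky_def)

lemma zelevinsky_row_increasing:
  "zelevinsky n r v \<Longrightarrow> j \<le> n \<Longrightarrow> p \<in> block_row r j \<Longrightarrow> p' \<in> block_row r j \<Longrightarrow> p < p' \<Longrightarrow> v p < v p'"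
  by (simp add: zelevinsky_def)

lemma zelevinsky_col_increasing:
  "zelevinsky n r v \<Longrightarrow> i \<le> n \<Longrightarrow> v p \<in> block_col n r i \<Longrightarrow> v p' \<in> block_col n r i \<Longrightarrow> p < p' \<Longrightarrow> v p < v p'"
  by (simp add: zelevinsky_def)

lemma pipe_sum_labels:
  assumes v: "zelevinsky n r v"
  shows "pipe_sum (row_label n r) (col_label n r) v = pipe_sum Z Y v"
proof -
  let ?d = "total_dim n r" and ?r = "\<lambda>m. r (n - m)"
  have perm: "v permutes {1..?d}" by (rule zelevinsky_permutes[OF v])
  have rows: "letter_coeff ?d (\<xi> \<circ> simple_transp i) \<eta> v = letter_coeff ?d \<xi> \<eta> v"
    if "j \<le> n" "i \<in> block_row r j" "Suc i \<in> block_row r j" for i j \<xi> \<eta>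
  proof (rule letter_coeff_row_symmetric)
    show "1 \<le> i" "i < ?d" using block_row_subset[OF that(1), of r] that(2,3) by auto
    show "v i < v (Suc i)" using zelevinsky_row_increasing[OF v that] by simp
  qed
  have cols: "letter_coeff ?d \<xi> (\<eta> \<circ> simple_transp q) v = letter_coeff ?d \<xi> \<eta> v"
    if "j \<le> n" "q \<in> block_row ?r j" "Suc q \<in> block_row ?r j" for q j \<xi> \<eta>
  proof (rule letter_coeff_column_symmetric)
    have q: "q \<in> block_col n r (n - j)" "Suc q \<in> block_col n r (n - j)"
      using that by (simp_all add: block_col_block_row)
    show "1 \<le> q" "q < ?d" using block_col_subset[of "n - j" n r] q by auto
    obtain a b where ab: "v a = q" "v b = Suc q" using permutes_surj[OF perm] by (metis surjD)
    have "a < b"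
      using zelevinsky_col_increasing[OF v, of "n - j" b a] q ab by (cases a b rule: linorder_cases) auto
    then show "\<exists>a b. a < b \<and> v a = q \<and> v b = Suc q" using ab by blast
  qed
  have "letter_coeff ?d (row_label n r) (col_label n r) v =
      letter_coeff ?d (Z \<circ> reverse_blocks n r) (Y \<circ> reverse_blocks n ?r) v"
    using row_label_eq[of _ n r] col_label_eq[of _ n r] by (subst letter_coeff_cong) auto
  also have "\<dots> = letter_coeff ?d Z (Y \<circ> reverse_blocks n ?r) v"
    using rows by (rule reverse_blocks_invariant[where F = "\<lambda>\<xi>. letter_coeff ?d \<xi> (Y \<circ> reverse_blocks n ?r) v"])
  also have "\<dots> = letter_coeff ?d Z Y v"
    using cols by (rule reverse_blocks_invariant[where F = "\<lambda>\<eta>. letter_coeff ?d Z \<eta> v"])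
  finally show ?thesis by (simp add: letter_coeff_pipe_sum[OF perm])
qed

section \<open>Zelevinsky permutations\<close>

lemma col_offset_mono: "c \<le> c' \<Longrightarrow> col_offset n r c' \<le> col_offset n r c"
  unfolding col_offset_def by (rule sum_mono2) auto

lemma col_offset_le: "col_offset n r c \<le> total_dim n r"
  unfolding col_offset_def total_dim_def by (rule sum_mono2) auto

lemma col_offset_step:
  assumes "c < i" and "i \<le> n"
  shows "col_offset n r i + r i \<le> col_offset n r c"
proof -
  have "col_offset n r i + r i = sum r (insert i {i<..n})" by (simp add: col_offset_def)
  also have "\<dots> \<le> col_offset n r c"
    unfolding col_offset_def by (rule sum_mono2) (use assms in auto)
  finally show ?thesis .
qed

text \<open>Block columns are counted from the right, so a larger index lies further left.\<close>

lemma block_col_le_iff: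
  assumes "q \<in> block_col n r i" and "i \<le> n"
  shows "q \<le> col_offset n r c \<longleftrightarrow> c < i"
  using assms col_offset_step[of c i n r] col_offset_mono[of i c n r]
  by (cases "c < i") (auto simp: block_col_def)

lemma row_offset_add_col_offset_le: "row_offset r (Suc j) + col_offset n r (Suc j) \<le> total_dim n r"
  if "j \<le> n"
proof -
  have "row_offset r (Suc j) + col_offset n r (Suc j) = sum r ({..<Suc j} \<union> {Suc j<..n})"
    unfolding row_offset_def col_offset_def by (rule sum.union_disjoint[symmetric]) auto
  also have "\<dots> \<le> total_dim n r"
    unfolding total_dim_def by (rule sum_mono2) (use that in auto)
  finally show ?thesis .
qed

text \<open>
  For \<open>p\<close> in block row \<open>j\<close> the condition on \<open>i\<close> says \<open>i \<ge> j + 2\<close>; for \<open>i = 0\<close> the truncated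
  subtraction is harmless, since \<open>row_offset r 0 = 0 < p\<close>.
\<close>

definition hom_shape :: "nat \<Rightarrow> (nat \<Rightarrow> nat) \<Rightarrow> nat \<Rightarrow> nat" where
  "hom_shape n r p = (\<Sum>i | i \<le> n \<and> p \<le> row_offset r (i - 1). r i)"

lemma hom_shape_eq:
  assumes "p \<in> block_row r j"
  shows "hom_shape n r p = col_offset n r (Suc j)"
proof -
  have "p \<le> row_offset r (i - 1) \<longleftrightarrow> Suc j < i" for i
  proof (cases "Suc j < i")
    case True
    then have "Suc j \<le> i - 1" by simp
    from row_offset_mono[OF this, of r] show ?thesis using True assms by (simp add: mem_block_row)
  next
    case False
    then have "i - 1 \<le> j" by simp
    from row_offset_mono[OF this, of r] show ?thesis using False assms by (simp add: mem_block_row)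
  qed
  note iff = this
  have "{i. i \<le> n \<and> p \<le> row_offset r (i - 1)} = {Suc j<..n}"
    unfolding iff by auto
  then show ?thesis unfolding hom_shape_def col_offset_def by (rule arg_cong)
qed

lemma partition_rows_hom_shape: "partition_rows (total_dim n r) (hom_shape n r)"
proof -
  have "hom_shape n r y \<le> hom_shape n r x" if "x \<le> y" for x y
    unfolding hom_shape_def by (rule sum_mono2) (use that in auto)
  moreover have "x + hom_shape n r x \<le> total_dim n r" if x: "x \<in> {1..total_dim n r}" for x
  proof -
    obtain j where j: "j \<le> n" "x \<in> block_row r j" using ex_block_row[OF x] by blast
    then have "x \<le> row_offset r (Suc j)" by (simp add: mem_block_row)
    then show ?thesis
      using row_offset_add_col_offset_le[OF j(1), of r] by (simp add: hom_shape_eq[OF j(2)])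
  qed
  ultimately show ?thesis by (simp add: partition_rows_def)
qed

lemma D_Hom_diagram: "D_Hom n r = diagram (total_dim n r) (hom_shape n r)"
proof (intro equalityI subsetI)
  fix b assume "b \<in> D_Hom n r"
  then obtain j i p q where b: "b = (p, q)" "i \<le> n" "j + 2 \<le> i" "p \<in> block_row r j" "q \<in> block_col n r i"
    by (auto simp: D_Hom_def)
  then have "p \<in> {1..total_dim n r}" "q \<in> {1..total_dim n r}"
    using block_row_subset[of j n r] block_col_subset[of i n r] by auto
  moreover have "q \<le> hom_shape n r p"
    using block_col_le_iff[OF b(5,2), of "Suc j"] b(3) by (simp add: hom_shape_eq[OF b(4)])
  ultimately show "b \<in> diagram (total_dim n r) (hom_shape n r)" by (simp add: diagram_def b)
next
  fix b assume "b \<in> diagram (total_dim n r) (hom_shape n r)"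
  then obtain p q where b: "b = (p, q)" "p \<in> {1..total_dim n r}" "1 \<le> q" "q \<le> hom_shape n r p"
    by (auto simp: diagram_def)
  obtain j where j: "j \<le> n" "p \<in> block_row r j" using ex_block_row[OF b(2)] by blast
  have q: "q \<le> col_offset n r (Suc j)" using b(4) by (simp add: hom_shape_eq[OF j(2)])
  then have "q \<in> {1..total_dim n r}" using b(3) col_offset_le[of n r "Suc j"] by simp
  then obtain i where i: "i \<le> n" "q \<in> block_col n r i" using ex_block_col by blast
  then have "Suc j < i" using block_col_le_iff[of q n r i "Suc j"] q by simp
  then show "b \<in> D_Hom n r"
    unfolding D_Hom_def using i j by (intro UN_I[of "(j, i)"]) (auto simp: b(1))
qed

lemma zelevinsky_block:
  "zelevinsky n r v \<Longrightarrow> i \<le> n \<Longrightarrow> j + 2 \<le> i \<Longrightarrow> p \<in> block_row r j \<Longrightarrow> v p \<notin> block_col n r i"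
  unfolding zelevinsky_def by blast

lemma zelevinsky_avoids:
  assumes v: "zelevinsky n r v" and x: "x \<in> {1..total_dim n r}"
  shows "hom_shape n r x < v x"
proof (rule ccontr)
  assume "\<not> hom_shape n r x < v x"
  obtain j where j: "j \<le> n" "x \<in> block_row r j" using ex_block_row[OF x] by blast
  have "v x \<in> {1..total_dim n r}" using permutes_in_image[OF zelevinsky_permutes[OF v]] x by blast
  then obtain i where i: "i \<le> n" "v x \<in> block_col n r i" using ex_block_col by blast
  have "Suc j < i"
    using \<open>\<not> hom_shape n r x < v x\<close> block_col_le_iff[OF i(2,1), of "Suc j"]
    by (simp add: hom_shape_eq[OF j(2)])
  then show False using zelevinsky_block[OF v i(1) _ j(2)] i(2) by simp
qed

text \<open>The shape is constant on a block row, so the smaller value of an inversion there would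
  lie in the forbidden part of its own row. The row lengths are also block column boundaries: if two
  inverted values shared a block column, the larger would be forbidden together with the
  smaller.\<close>

lemma dominant_zelevinsky:
  assumes v: "dominant (total_dim n r) (hom_shape n r) v"
  shows "zelevinsky n r v"
proof -
  let ?d = "total_dim n r" and ?l = "hom_shape n r"
  have perm: "v permutes {1..?d}" and avoid: "\<And>x. x \<in> {1..?d} \<Longrightarrow> ?l x < v x"
    and greedy: "\<And>x y. 1 \<le> x \<Longrightarrow> x < y \<Longrightarrow> v y < v x \<Longrightarrow> v y \<le> ?l x"
    using v by (auto simp: dominant_def)
  have neq: "v p \<noteq> v p'" if "p < p'" for p p'
    using permutes_inj[OF perm] that by (metis injD less_irrefl)
  have "v p \<notin> block_col n r i" if h: "i \<le> n" "j + 2 \<le> i" "p \<in> block_row r j" for i j p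
  proof
    assume "v p \<in> block_col n r i"
    then have "v p \<le> ?l p"
      using block_col_le_iff[OF _ h(1), of "v p" r "Suc j"] h by (simp add: hom_shape_eq[OF h(3)])
    moreover have "p \<in> {1..?d}" using block_row_subset[of j n r] h by auto
    ultimately show False using avoid[of p] by simp
  qed
  moreover have "v p < v p'"
    if h: "j \<le> n" "p \<in> block_row r j" "p' \<in> block_row r j" "p < p'" for j p p'
  proof (rule ccontr)
    assume "\<not> v p < v p'"
    then have "v p' < v p" using neq[OF h(4)] by simp
    moreover have p: "p \<in> {1..?d}" "p' \<in> {1..?d}" using block_row_subset[of j n r] h by auto
    ultimately have "v p' \<le> ?l p" using greedy h(4) by simp
    then show False using avoid[OF p(2)] by (simp add: hom_shape_eq[OF h(2)] hom_shape_eq[OF h(3)])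
  qed
  moreover have "v p < v p'"
    if h: "i \<le> n" "v p \<in> block_col n r i" "v p' \<in> block_col n r i" "p < p'" for i p p'
  proof (rule ccontr)
    assume "\<not> v p < v p'"
    then have less: "v p' < v p" using neq[OF h(4)] by simp
    have "v p \<in> {1..?d}" using block_col_subset[OF h(1), of r] h(2) by blast
    then have p: "p \<in> {1..?d}" using permutes_in_image[OF perm] by blast
    then obtain j where j: "p \<in> block_row r j" using ex_block_row by blast
    have "v p' \<le> ?l p" using greedy less h(4) p by simp
    then have "v p \<le> ?l p"
      using block_col_le_iff[OF h(2,1), of "Suc j"] block_col_le_iff[OF h(3,1), of "Suc j"]
      by (simp add: hom_shape_eq[OF j])
    then show False using avoid[OF p] by simp
  qed
  ultimately show ?thesis using perm unfolding zelevinsky_def by blast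
qed

text \<open>The rank array counts 1's to the southeast, dominance concerns counts to the northwest.
  Inclusion and exclusion for a permutation matrix relates the two, stated additively to avoid
  truncated subtraction.\<close>

lemma rank_entry_eq:
  assumes v: "v permutes {1..total_dim n r}" and "i \<le> n" and "j \<le> n"
  shows "rank_entry n r v i j + row_offset r j + col_offset n r i =
    total_dim n r + card {m\<in>{1..row_offset r j}. v m \<le> col_offset n r i}"
proof -
  let ?d = "total_dim n r" and ?a = "row_offset r j" and ?c = "col_offset n r i"
  have le: "?a \<le> ?d" "?c \<le> ?d"
    using row_offset_mono[of j "Suc n" r] assms(3) col_offset_le by (auto simp: total_dim_row_offset)
  have rows: "(\<exists>q\<in>{j..n}. m \<in> block_row r q) \<longleftrightarrow> ?a < m \<and> m \<le> ?d" for m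
  proof
    assume "\<exists>q\<in>{j..n}. m \<in> block_row r q"
    then obtain q where q: "j \<le> q" "q \<le> n" "m \<in> block_row r q" by auto
    then have "m \<le> ?d" using block_row_subset[of q n r] by auto
    then show "?a < m \<and> m \<le> ?d"
      using q row_offset_mono[of j q r] by (simp add: mem_block_row)
  next
    assume m: "?a < m \<and> m \<le> ?d"
    then have "m \<in> {1..?d}" by simp
    then obtain q where q: "q \<le> n" "m \<in> block_row r q" using ex_block_row by blast
    then have "j \<le> q"
      using m row_offset_mono[of "Suc q" j r] by (cases "j \<le> q") (auto simp: mem_block_row)
    then show "\<exists>q\<in>{j..n}. m \<in> block_row r q" using q by auto
  qed
  have cols: "(\<exists>p\<le>i. y \<in> block_col n r p) \<longleftrightarrow> ?c < y \<and> y \<le> ?d" for y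
  proof
    assume "\<exists>p\<le>i. y \<in> block_col n r p"
    then obtain p where p: "p \<le> i" "y \<in> block_col n r p" by blast
    then have "p \<le> n" using assms(2) by simp
    then have "y \<in> {1..?d}" using block_col_subset p(2) by blast
    then show "?c < y \<and> y \<le> ?d" using block_col_le_iff[OF p(2) \<open>p \<le> n\<close>, of i] p(1) by simp
  next
    assume y: "?c < y \<and> y \<le> ?d"
    then have "y \<in> {1..?d}" by simp
    then obtain p where p: "p \<le> n" "y \<in> block_col n r p" using ex_block_col by blast
    then have "p \<le> i" using block_col_le_iff[OF p(2,1), of i] y by simp
    then show "\<exists>p\<le>i. y \<in> block_col n r p" using p by blast
  qed
  have E1: "v -` {?c<..?d} = {m. ?a < m \<and> m \<le> ?d \<and> ?c < v m \<and> v m \<le> ?d} \<union> {m\<in>{1..?a}. ?c < v m}"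
  proof (intro equalityI subsetI)
    fix m assume "m \<in> v -` {?c<..?d}"
    then have vm: "?c < v m" "v m \<le> ?d" by auto
    then have "v m \<in> {1..?d}" by simp
    then have "m \<in> {1..?d}" using permutes_in_image[OF v] by blast
    then show "m \<in> {m. ?a < m \<and> m \<le> ?d \<and> ?c < v m \<and> v m \<le> ?d} \<union> {m\<in>{1..?a}. ?c < v m}"
      using vm by auto
  next
    fix m assume m: "m \<in> {m. ?a < m \<and> m \<le> ?d \<and> ?c < v m \<and> v m \<le> ?d} \<union> {m\<in>{1..?a}. ?c < v m}"
    then have "m \<in> {1..?d}" using le by auto
    then have "v m \<in> {1..?d}" using permutes_in_image[OF v] by blast
    then show "m \<in> v -` {?c<..?d}" using m by auto
  qed
  have E2: "card (v -` {?c<..?d}) = ?d - ?c"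
    using permutes_bij[OF v] by (subst card_vimage_inj) (auto simp: bij_def)
  have E3: "card ({m. ?a < m \<and> m \<le> ?d \<and> ?c < v m \<and> v m \<le> ?d} \<union> {m\<in>{1..?a}. ?c < v m}) =
      rank_entry n r v i j + card {m\<in>{1..?a}. ?c < v m}"
    unfolding rank_entry_def rows cols conj_assoc
    by (rule card_Un_disjoint) auto
  have E4: "card {m\<in>{1..?a}. ?c < v m} + card {m\<in>{1..?a}. v m \<le> ?c} = ?a"
  proof -
    have "card {m\<in>{1..?a}. ?c < v m} + card {m\<in>{1..?a}. v m \<le> ?c} =
        card ({m\<in>{1..?a}. ?c < v m} \<union> {m\<in>{1..?a}. v m \<le> ?c})"
      by (rule card_Un_disjoint[symmetric]) auto
    also have "{m\<in>{1..?a}. ?c < v m} \<union> {m\<in>{1..?a}. v m \<le> ?c} = {1..?a}" by auto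
    finally show ?thesis by simp
  qed
  from E2 E3 have "rank_entry n r v i j + card {m\<in>{1..?a}. ?c < v m} = ?d - ?c"
    unfolding E1 by simp
  then show ?thesis using E4 le by linarith
qed

text \<open>On an interval where \<open>f\<close> increases, the positions with value at most
  \<open>c\<close> form an initial segment, which its size determines.\<close>

lemma increasing_le_iff_card:
  fixes f :: "nat \<Rightarrow> nat"
  assumes "\<And>x y. x \<in> A \<Longrightarrow> y \<in> A \<Longrightarrow> x < y \<Longrightarrow> f x < f y" and A: "A = {a<..b}" and p: "p \<in> A"
  shows "f p \<le> c \<longleftrightarrow> p \<le> a + card {m\<in>A. f m \<le> c}"
proof (cases "f p \<le> c")
  case True
  have "{a<..p} \<subseteq> {m\<in>A. f m \<le> c}"
  proof
    fix m assume m: "m \<in> {a<..p}"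
    then have "m \<in> A" using p A by auto
    moreover have "f m \<le> f p" using assms(1)[OF \<open>m \<in> A\<close> p] m by (cases "m = p") auto
    ultimately show "m \<in> {m\<in>A. f m \<le> c}" using True by simp
  qed
  then have "card {a<..p} \<le> card {m\<in>A. f m \<le> c}"
    by (rule card_mono[rotated]) (simp add: A)
  then show ?thesis using True by simp
next
  case False
  have "{m\<in>A. f m \<le> c} \<subseteq> {a<..<p}"
  proof
    fix m assume m: "m \<in> {m\<in>A. f m \<le> c}"
    then have "m < p" using assms(1)[OF p, of m] False by (cases m p rule: linorder_cases) auto
    then show "m \<in> {a<..<p}" using m A by auto
  qed
  then have "card {m\<in>A. f m \<le> c} \<le> card {a<..<p}" by (rule card_mono[rotated]) simp
  then show ?thesis using False p A by auto
qed

text \<open>Supplies the counts for which the rank array has no entry: for \<open>i > j\<close> the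
  region in question lies inside \<open>D_Hom\<close>.\<close>

lemma zelevinsky_rank_zero:
  assumes v: "zelevinsky n r v" and "j < i" and "j \<le> n"
  shows "{m\<in>{1..row_offset r j}. v m \<le> col_offset n r i} = {}"
proof -
  have "col_offset n r i < v m" if m: "m \<in> {1..row_offset r j}" for m
  proof -
    have "m \<in> {1..total_dim n r}"
      using m row_offset_mono[of j "Suc n" r] assms(3) by (auto simp: total_dim_row_offset)
    note avoid = zelevinsky_avoids[OF v this]
    obtain j' where j': "m \<in> block_row r j'" using ex_block_row[OF \<open>m \<in> {1..total_dim n r}\<close>] by blast
    have "j' < j"
      using m j' row_offset_mono[of j j' r] by (cases "j' < j") (auto simp: mem_block_row)
    then have "col_offset n r i \<le> hom_shape n r m"
      unfolding hom_shape_eq[OF j'] using assms(2) by (intro col_offset_mono) simp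
    then show ?thesis using avoid by simp
  qed
  then show ?thesis by force
qed

text \<open>As a block column is filled in increasing order, a value in it is known from how many
  1's of that block column come no later.\<close>

lemma zelevinsky_block_col_image:
  assumes v: "zelevinsky n r v" and "i \<le> n" and p: "v p \<in> block_col n r i"
  shows "v p = col_offset n r i + card {m. v m \<in> block_col n r i \<and> m \<le> p}"
proof -
  have inj: "inj v" and surj: "surj v"
    using zelevinsky_permutes[OF v] by (auto dest: permutes_inj permutes_surj)
  have "v ` {m. v m \<in> block_col n r i \<and> m \<le> p} = {col_offset n r i<..v p}"
  proof (intro equalityI subsetI)
    fix y assume "y \<in> v ` {m. v m \<in> block_col n r i \<and> m \<le> p}"
    then obtain m where m: "y = v m" "v m \<in> block_col n r i" "m \<le> p" by blast
    then have "v m \<le> v p"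
      using zelevinsky_col_increasing[OF v assms(2) m(2) p] by (cases "m = p") auto
    then show "y \<in> {col_offset n r i<..v p}" using m by (auto simp: block_col_def)
  next
    fix y assume y: "y \<in> {col_offset n r i<..v p}"
    then have yb: "y \<in> block_col n r i" using p by (auto simp: block_col_def)
    obtain m where m: "y = v m" using surj by (metis surjD)
    have "m \<le> p"
    proof (rule ccontr)
      assume "\<not> m \<le> p"
      then have "v p < v m" using zelevinsky_col_increasing[OF v assms(2) p] yb m by simp
      then show False using y m by simp
    qed
    then show "y \<in> v ` {m. v m \<in> block_col n r i \<and> m \<le> p}" using yb m by blast
  qed
  then have "card (v ` {m. v m \<in> block_col n r i \<and> m \<le> p}) = v p - col_offset n r i" by simp
  then have "card {m. v m \<in> block_col n r i \<and> m \<le> p} = v p - col_offset n r i"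
    using card_image[OF inj_on_subset[OF inj subset_UNIV]] by metis
  then show ?thesis using p by (simp add: block_col_def)
qed

text \<open>The ranks give the number of 1's in every block. Monotonicity in block rows then tells
  which block contains the 1 of a given row, and monotonicity in block columns fixes its exact
  column.\<close>

lemma zelevinsky_determined:
  assumes v: "zelevinsky n r v" and w: "zelevinsky n r w"
    and rank: "\<And>i j. j \<le> n \<Longrightarrow> i \<le> j \<Longrightarrow> rank_entry n r v i j = rank_entry n r w i j"
  shows "v = w"
proof -
  let ?d = "total_dim n r"
  have perm: "v permutes {1..?d}" "w permutes {1..?d}"
    using v w by (auto dest: zelevinsky_permutes)
  have count: "card {m\<in>{1..row_offset r j}. v m \<le> col_offset n r i} =
      card {m\<in>{1..row_offset r j}. w m \<le> col_offset n r i}" if "i \<le> n" "j \<le> Suc n" for i j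
  proof -
    have "j = Suc n \<or> (j \<le> n \<and> i \<le> j) \<or> (j \<le> n \<and> j < i)" using that by arith
    then consider "j = Suc n" | "j \<le> n" "i \<le> j" | "j \<le> n" "j < i" by blast
    then show ?thesis
    proof cases
      case 1
      have "card {m\<in>{1..?d}. f m \<le> col_offset n r i} = col_offset n r i" if f: "f permutes {1..?d}" for f
      proof -
        have "m \<in> {m\<in>{1..?d}. f m \<le> col_offset n r i} \<longleftrightarrow> m \<in> f -` {1..col_offset n r i}" for m
          using permutes_in_image[OF f, of m] col_offset_le[of n r i] by auto
        then have "{m\<in>{1..?d}. f m \<le> col_offset n r i} = f -` {1..col_offset n r i}" by blast
        then show ?thesis using permutes_bij[OF f] by (simp, subst card_vimage_inj) (auto simp: bij_def)
      qed
      then show ?thesis using perm 1 by (simp add: total_dim_row_offset)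
    next
      case 2
      then show ?thesis
        using rank_entry_eq[OF perm(1) that(1) 2(1)] rank_entry_eq[OF perm(2) that(1) 2(1)] rank[OF 2]
        by simp
    next
      case 3
      then show ?thesis using zelevinsky_rank_zero[OF v] zelevinsky_rank_zero[OF w] by metis
    qed
  qed
  have le_iff: "v p \<le> col_offset n r i \<longleftrightarrow> w p \<le> col_offset n r i"
    if p: "p \<in> {1..?d}" and i: "i \<le> n" for p i
  proof -
    let ?c = "col_offset n r i"
    obtain j where j: "j \<le> n" "p \<in> block_row r j" using ex_block_row[OF p] by blast
    have A: "block_row r j = {row_offset r j<..row_offset r (Suc j)}" by (auto simp: mem_block_row)
    have split: "card {m\<in>{1..row_offset r (Suc j)}. f m \<le> ?c} =
        card {m\<in>{1..row_offset r j}. f m \<le> ?c} + card {m\<in>block_row r j. f m \<le> ?c}" for f :: "nat \<Rightarrow> nat"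
    proof -
      have "{m\<in>{1..row_offset r (Suc j)}. f m \<le> ?c} =
          {m\<in>{1..row_offset r j}. f m \<le> ?c} \<union> {m\<in>block_row r j. f m \<le> ?c}"
        by (auto simp: mem_block_row row_offset_Suc)
      then show ?thesis by (simp only:) (rule card_Un_disjoint, auto simp: A)
    qed
    have "card {m\<in>block_row r j. v m \<le> ?c} = card {m\<in>block_row r j. w m \<le> ?c}"
      using count[OF i, of j] count[OF i, of "Suc j"] split[of v] split[of w] j(1) by simp
    then show ?thesis
      using increasing_le_iff_card[where f = v and c = ?c, OF zelevinsky_row_increasing[OF v j(1)] A j(2)]
        increasing_le_iff_card[where f = w and c = ?c, OF zelevinsky_row_increasing[OF w j(1)] A j(2)]
      by simp
  qed
  have block: "v p \<in> block_col n r i \<longleftrightarrow> w p \<in> block_col n r i" if i: "i \<le> n" for p i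
  proof (cases "p \<in> {1..?d}")
    case True
    obtain a where a: "a \<le> n" "v p \<in> block_col n r a"
      using ex_block_col[of "v p" n r] permutes_in_image[OF perm(1)] True by blast
    obtain b where b: "b \<le> n" "w p \<in> block_col n r b"
      using ex_block_col[of "w p" n r] permutes_in_image[OF perm(2)] True by blast
    have lt: "c < a \<longleftrightarrow> c < b" if "c \<le> n" for c
      using le_iff[OF True that] block_col_le_iff[OF a(2,1), of c] block_col_le_iff[OF b(2,1), of c] by simp
    have "a = b" using lt[of a] lt[of b] a(1) b(1) by (cases a b rule: linorder_cases) auto
    have only: "x \<in> block_col n r i \<longleftrightarrow> i = e" if "x \<in> block_col n r e" "e \<le> n" for x e
    proof
      assume "x \<in> block_col n r i"
      then show "i = e"
        using block_col_le_iff[OF _ i, of x r i] block_col_le_iff[OF _ i, of x r e]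
          block_col_le_iff[OF that, of i] block_col_le_iff[OF that, of e] by auto
    qed (use that in simp)
    show ?thesis using only[OF a(2,1)] only[OF b(2,1)] \<open>a = b\<close> by simp
  next
    case False
    then show ?thesis using permutes_not_in[OF perm(1)] permutes_not_in[OF perm(2)] by metis
  qed
  show ?thesis
  proof
    fix p
    show "v p = w p"
    proof (cases "p \<in> {1..?d}")
      case True
      obtain i where i: "i \<le> n" "v p \<in> block_col n r i"
        using ex_block_col[of "v p" n r] permutes_in_image[OF perm(1)] True by blast
      then have "w p \<in> block_col n r i" using block by blast
      then show ?thesis
        using zelevinsky_block_col_image[OF v i] zelevinsky_block_col_image[OF w i(1)]
        by (simp add: block[OF i(1)])
    next
      case False
      then show ?thesis using permutes_not_in[OF perm(1)] permutes_not_in[OF perm(2)] by metis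
    qed
  qed
qed

lemma perm_of_array_eq:
  assumes "zelevinsky n r v" and "has_rank_array n r v R"
  shows "perm_of_array n r R = v"
  unfolding perm_of_array_def
proof (rule the_equality)
  fix w assume "zelevinsky n r w \<and> has_rank_array n r w R"
  then show "w = v"
    using zelevinsky_determined[of n r w v] assms by (simp add: has_rank_array_def)
qed (use assms in blast)

lemma perm_Hom_eq:
  assumes v: "dominant (total_dim n r) (hom_shape n r) v"
  shows "perm_Hom n r = v"
  unfolding perm_Hom_def
proof (rule the_equality)
  have zv: "zelevinsky n r v" by (rule dominant_zelevinsky[OF v])
  have perm: "v permutes {1..total_dim n r}" by (rule zelevinsky_permutes[OF zv])
  have max: "rank_entry n r w i j \<le> rank_entry n r v i j"
    if w: "zelevinsky n r w" and ij: "j \<le> n" "i \<le> j" for w i j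
  proof -
    have pw: "w permutes {1..total_dim n r}" by (rule zelevinsky_permutes[OF w])
    have "row_offset r j \<le> total_dim n r"
      using row_offset_mono[of j "Suc n" r] ij by (simp add: total_dim_row_offset)
    then have "card {m\<in>{1..row_offset r j}. w m \<le> col_offset n r i} \<le>
        card {m\<in>{1..row_offset r j}. v m \<le> col_offset n r i}"
      by (intro dominant_rank_maximal[OF partition_rows_hom_shape v pw] zelevinsky_avoids[OF w])
    moreover have "i \<le> n" using ij by simp
    ultimately show ?thesis
      using rank_entry_eq[OF perm _ ij(1), of i] rank_entry_eq[OF pw _ ij(1), of i] by simp
  qed
  then show "zelevinsky n r v \<and> (\<forall>w. zelevinsky n r w \<longrightarrow>
      (\<forall>j\<le>n. \<forall>i\<le>j. rank_entry n r w i j \<le> rank_entry n r v i j))"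
    using zv by blast
  fix w assume w: "zelevinsky n r w \<and> (\<forall>u. zelevinsky n r u \<longrightarrow>
      (\<forall>j\<le>n. \<forall>i\<le>j. rank_entry n r u i j \<le> rank_entry n r w i j))"
  then have zw: "zelevinsky n r w" by blast
  have "rank_entry n r w i j = rank_entry n r v i j" if "j \<le> n" "i \<le> j" for i j
    using max[OF zw that] w zv that by (meson antisym)
  then show "w = v" by (rule zelevinsky_determined[OF zw zv])
qed

lemma ratio_ZY_neq_1: "ratio (Z a) (Y b) \<noteq> 1"
proof
  assume "ratio (Z a) (Y b) = 1"
  then have "Poly_Mapping.keys (ratio (Z a) (Y b)) = Poly_Mapping.keys (1 :: laurent)" by simp
  then have "Poly_Mapping.single (Z a) (1 :: int) - Poly_Mapping.single (Y b) 1 = 0"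
    by (simp add: ratio_def)
  then have "Poly_Mapping.lookup (Poly_Mapping.single (Z a) (1 :: int) - Poly_Mapping.single (Y b) 1) (Z a) = 0"
    by simp
  then show False by (simp add: lookup_minus lookup_single when_def)
qed

theorem theorem2p2:
  fixes n :: nat and r :: "nat \<Rightarrow> nat" and R :: "nat \<Rightarrow> nat \<Rightarrow> nat"
  assumes "\<exists>v. zelevinsky n r v \<and> has_rank_array n r v R"
  shows "(\<forall>P \<in> pipe_dreams (perm_of_array n r R).
            P \<subseteq> {1..total_dim n r} \<times> {1..total_dim n r}) \<and>
         KQ n r R =
           to_fract (\<Sum>P \<in> pipe_dreams (perm_of_array n r R).
             (- 1) ^ (card P - perm_length (perm_of_array n r R)) *
             reverse_monomial n r (P - D_Hom n r))"
proof -
  let ?d = "total_dim n r" and ?D = "D_Hom n r"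
  obtain v where v: "zelevinsky n r v" "has_rank_array n r v R" using assms by blast
  have v_eq: "perm_of_array n r R = v" by (rule perm_of_array_eq[OF v])
  have perm: "v permutes {1..?d}" by (rule zelevinsky_permutes[OF v(1)])
  define h where "h = demazure_product (pipe_word ?D)"
  note shape = partition_rows_hom_shape[of n r]
  have h: "dominant ?d (hom_shape n r) h"
    unfolding h_def D_Hom_diagram by (rule dominant_diagram[OF shape])
  have zh: "zelevinsky n r h" by (rule dominant_zelevinsky[OF h])
  have groth: "grothendieck u = pipe_sum (row_label n r) (col_label n r) u" if "zelevinsky n r u" for u
    using grothendieck_pipe_sum[OF zelevinsky_permutes[OF that]] pipe_sum_labels[OF that] by simp
  have "grothendieck h = reverse_monomial n r ?D"
    unfolding groth[OF zh] pipe_sum_def pipe_dreams_dominant[OF shape h]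
      perm_length_dominant[OF shape h] D_Hom_diagram reverse_monomial_def by simp
  then have Hom: "grothendieck (perm_Hom n r) = reverse_monomial n r ?D"
    by (simp add: perm_Hom_eq[OF h])
  have sub: "P \<subseteq> {1..?d} \<times> {1..?d}" if "P \<in> pipe_dreams v" for P
    using pipe_dreams_subset_staircase[OF perm that] by (auto simp: staircase_def)
  have key: "reverse_monomial n r P = reverse_monomial n r ?D * reverse_monomial n r (P - ?D)"
    if P: "P \<in> pipe_dreams v" for P
  proof -
    have "?D \<subseteq> P"
      unfolding D_Hom_diagram
      by (rule pipe_dream_contains_diagram[OF shape perm zelevinsky_avoids[OF v(1)] P])
    moreover have "finite P" using P by (simp add: pipe_dreams_def)
    ultimately show ?thesis
      unfolding reverse_monomial_def by (simp add: prod.subset_diff mult.commute)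
  qed
  have "grothendieck v = reverse_monomial n r ?D *
      (\<Sum>P\<in>pipe_dreams v. (- 1) ^ (card P - perm_length v) * reverse_monomial n r (P - ?D))"
    unfolding groth[OF v(1)] pipe_sum_def sum_distrib_left
    unfolding reverse_monomial_def[symmetric]
    by (rule sum.cong[OF HOL.refl]) (subst key, simp_all only: mult.left_commute)
  moreover have "reverse_monomial n r ?D \<noteq> 0"
  proof -
    have "?D \<subseteq> {1..?d} \<times> {1..?d}"
      using diagram_subset_staircase[OF shape] by (auto simp: D_Hom_diagram staircase_def)
    then have "1 - ratio (row_label n r p) (col_label n r q) \<noteq> 0" if "(p, q) \<in> ?D" for p q
      using that row_label_eq[of p n r] col_label_eq[of q n r] ratio_ZY_neq_1[THEN not_sym] by auto
    moreover have "finite ?D"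
      unfolding D_Hom_diagram using diagram_subset_staircase[OF shape] finite_staircase finite_subset by blast
    ultimately show ?thesis by (auto simp: reverse_monomial_def)
  qed
  ultimately have "KQ n r R = to_fract (\<Sum>P\<in>pipe_dreams v.
      (- 1) ^ (card P - perm_length v) * reverse_monomial n r (P - ?D))"
    by (simp add: KQ_def v_eq Hom)
  then show ?thesis using sub by (simp add: v_eq)
qed

end
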